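(* For $k\ge1$, $n\ge0$ and every partition $\lambda$ we have $$D_{(k^n)}\,s_\lambda=\sum_{\mu\supset\lambda\,:\,|\mu|-|\lambda|=kn}a_{\lambda\mu}\,s_\mu;$$ the coefficients $a_{\lambda\mu}$ are given by $$a_{\lambda\mu}=\sum_{\lambda=\mu_{(0)}\subset\mu_{(1)}\subset\ldots\subset\mu_{(m)}=\mu}f(\mu_{(0)},\mu_{(1)})\,f(\mu_{(1)},\mu_{(2)})\cdots f(\mu_{(m-1)},\mu_{(m)});$$ here the sum is over all chains (of any length $m$) with strict inclusions such that, for every $i$, $\mu_{(i)}/\mu_{(i-1)}$ is a broken border strip with at most two connected components whose length (number of boxes) is a multiple of $k$, and $$f(\pi,\rho)=\frac{k\,(-k-1)^{(|\rho|-|\pi|)/k-1}}{|\rho|-|\lambda|}\,d_{\pi\rho}.$$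
   Context: Operators. Let $\partial_i=\partial/\partial x_i$ and $D_k:=\sum_{i\ge1}x_i^{k+1}\partial_i$, acting on symmetric functions in $x_1,x_2,\ldots$. For operators in standard form (polynomial part on the left, derivatives on the right) $\vee$ is the bilinear product with $(x_\lambda\partial_\mu)\vee(x_\nu\partial_\pi):=x_\lambda x_\nu\partial_\mu\partial_\pi$. $D_{(k^n)}:=\frac1{n!}D_k^{\vee n}$ ($D_{(k^0)}$ is the identity). $s_\lambda$ are Schur functions. The integers $d_{\lambda\mu}$. Partitions are identified with Young diagrams (English convention). The content of a box $b$ in row $i(b)$, column $j(b)$ is $c(b)=j(b)-i(b)$. A skew shape is a border strip if it is (edge-)connected and contains no $2\times2$ block; it is a broken border strip if it contains no $2\times2$ block (so its connected components are border strips). The height $\operatorname{ht}$ of a broken border strip is one less than the number of rows it occupies. A sharp corner of a broken border strip is a box having no box of the strip above it or to its left; a dull corner is a box having a box to its left and a box above it, but no box directly northwest of it (within the strip). $\operatorname{SC},\operatorname{DC}$ denote the sets of sharp and dull corners. If $\mu/\lambda$ is a border strip, $d_{\lambda\mu}:=(-1)^{\operatorname{ht}(\mu/\lambda)}\bigl(\sum_{b\in\operatorname{SC}(\mu/\lambda)}c(b)-\sum_{b\in\operatorname{DC}(\mu/\lambda)}c(b)\bigr)$; if $\mu/\lambda$ is a broken border strip with exactly two connected components, $d_{\lambda\mu}:=(-1)^{\operatorname{ht}(\mu/\lambda)}$. (These are the coefficients of $s_\mu$ in $D_{|\mu|-|\lambda|}s_\lambda$.) *)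

theory Defs
  imports "HOL-Library.Multiset" "HOL-Library.FuncSet" Complex_Main
begin

text \<open>
  The variables \<open>x\<^sub>0, x\<^sub>1, \<dots>\<close> are indexed by \<^typ>\<open>nat\<close>. A multiset \<open>\<alpha>\<close> of indices stands for
  the monomial \<open>x\<^sub>\<alpha> = (\<Prod>i\<in>#\<alpha>. x\<^sub>i)\<close>, and a power series is its coefficient function.
  Symmetric functions are such series.
\<close>

type_synonym series = "nat multiset \<Rightarrow> rat"

text \<open>The coefficient of \<open>x\<^sub>\<alpha>\<close> in \<open>\<partial>f/\<partial>x\<^sub>i\<close> comes from the term of \<open>x\<^sub>i x\<^sub>\<alpha>\<close> in \<open>f\<close>.\<close>

definition partial :: "nat \<Rightarrow> series \<Rightarrow> series" where
  "partial i f = (\<lambda>\<alpha>. of_nat (count \<alpha> i + 1) * f (add_mset i \<alpha>))"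

text \<open>\<open>\<partial>\<^sub>\<beta> = (\<Prod>i\<in>#\<beta>. \<partial>\<^sub>i)\<close>; the fold is well defined because partial derivatives commute.\<close>

definition partials :: "nat multiset \<Rightarrow> series \<Rightarrow> series" where
  "partials \<beta> f = fold_mset partial f \<beta>"

lemma comp_fun_commute_partial: "comp_fun_commute partial"
  by standard (auto simp: partial_def fun_eq_iff add_mset_commute algebra_simps)

definition mono_times :: "nat multiset \<Rightarrow> series \<Rightarrow> series" where
  "mono_times \<alpha> f = (\<lambda>\<gamma>. if \<alpha> \<subseteq># \<gamma> then f (\<gamma> - \<alpha>) else 0)"

text \<open>
  An operator in standard form is a formal, possibly infinite, sum
  \<open>\<Sum>\<alpha> \<beta>. P \<alpha> \<beta> \<cdot> x\<^sub>\<alpha> \<partial>\<^sub>\<beta>\<close>, given by its coefficients \<open>P \<alpha> \<beta>\<close>.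
\<close>

type_synonym diffop = "nat multiset \<Rightarrow> nat multiset \<Rightarrow> rat"

text \<open>
  Meaningful if every \<open>P \<alpha>\<close> has finite support: then the sum below is finite, since only the
  finitely many \<open>\<alpha> \<subseteq># \<gamma>\<close> contribute to the coefficient at \<open>\<gamma>\<close>.
\<close>

definition apply_op :: "diffop \<Rightarrow> series \<Rightarrow> series" where
  "apply_op P f = (\<lambda>\<gamma>. \<Sum>(\<alpha>, \<beta>) \<in> {(\<alpha>, \<beta>). \<alpha> \<subseteq># \<gamma> \<and> P \<alpha> \<beta> \<noteq> 0}.
     P \<alpha> \<beta> * mono_times \<alpha> (partials \<beta> f) \<gamma>)"

lemma finite_submset: "finite {\<alpha>. \<alpha> \<subseteq># \<gamma>}"
proof (induction \<gamma>)
  case (add x \<gamma>)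
  have "\<alpha> \<in> {\<alpha>. \<alpha> \<subseteq># \<gamma>} \<union> add_mset x ` {\<alpha>. \<alpha> \<subseteq># \<gamma>}" if "\<alpha> \<subseteq># add_mset x \<gamma>" for \<alpha>
  proof (cases "x \<in># \<alpha>")
    case True
    then obtain \<beta> where "\<alpha> = add_mset x \<beta>" by (meson mset_add)
    then show ?thesis using that by auto
  next
    case False
    then show ?thesis using that
      by (auto simp: subseteq_mset_def not_in_iff split: if_splits)
        (metis not_in_iff le0)
  qed
  then have "{\<alpha>. \<alpha> \<subseteq># add_mset x \<gamma>} \<subseteq> {\<alpha>. \<alpha> \<subseteq># \<gamma>} \<union> add_mset x ` {\<alpha>. \<alpha> \<subseteq># \<gamma>}"
    by blast
  then show ?case
    by (rule finite_subset) (use add in auto)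
qed auto

text \<open>
  Bilinear extension of
  \<open>(x\<^sub>\<lambda> \<partial>\<^sub>\<mu>) \<or> (x\<^sub>\<nu> \<partial>\<^sub>\<pi>) = x\<^sub>\<lambda> x\<^sub>\<nu> \<partial>\<^sub>\<mu> \<partial>\<^sub>\<pi>\<close>.
\<close>

definition vee :: "diffop \<Rightarrow> diffop \<Rightarrow> diffop" where
  "vee P Q = (\<lambda>\<alpha> \<beta>. \<Sum>\<alpha>' | \<alpha>' \<subseteq># \<alpha>. \<Sum>\<beta>' | \<beta>' \<subseteq># \<beta>.
     P \<alpha>' \<beta>' * Q (\<alpha> - \<alpha>') (\<beta> - \<beta>'))"

definition id_op :: diffop where
  "id_op = (\<lambda>\<alpha> \<beta>. if \<alpha> = {#} \<and> \<beta> = {#} then 1 else 0)"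

primrec vee_power :: "diffop \<Rightarrow> nat \<Rightarrow> diffop" where
  "vee_power P 0 = id_op"
| "vee_power P (Suc n) = vee P (vee_power P n)"

text \<open>\<open>D\<^sub>k = (\<Sum>i. x\<^sub>i\<^bsup>k+1\<^esup> \<partial>\<^sub>i)\<close>; distinct \<open>i\<close> give distinct terms, hence coefficients 0 and 1.\<close>

definition D_op :: "nat \<Rightarrow> diffop" where
  "D_op k = (\<lambda>\<alpha> \<beta>. if \<exists>i. \<alpha> = replicate_mset (k + 1) i \<and> \<beta> = {#i#} then 1 else 0)"

text \<open>\<open>D\<^bsub>(k\<^sup>n)\<^esub>\<close>\<close>

definition D_rect :: "nat \<Rightarrow> nat \<Rightarrow> diffop" where
  "D_rect k n = (\<lambda>\<alpha> \<beta>. 1 / fact n * vee_power (D_op k) n \<alpha> \<beta>)"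

lemma vee_power_D_op_support:
  assumes "vee_power (D_op k) n \<alpha> \<beta> \<noteq> 0"
  shows "\<alpha> = repeat_mset (k + 1) \<beta>"
  using assms
proof (induction n arbitrary: \<alpha> \<beta>)
  case 0
  then show ?case by (auto simp: id_op_def split: if_splits)
next
  case (Suc n)
  then obtain \<alpha>' \<beta>' where sub: "\<alpha>' \<subseteq># \<alpha>" "\<beta>' \<subseteq># \<beta>"
    and D: "D_op k \<alpha>' \<beta>' \<noteq> 0" and V: "vee_power (D_op k) n (\<alpha> - \<alpha>') (\<beta> - \<beta>') \<noteq> 0"
    by (auto simp: vee_def elim!: sum.not_neutral_contains_not_neutral)
  from D have "\<alpha>' = repeat_mset (k + 1) \<beta>'"
    by (auto simp: D_op_def multiset_eq_iff split: if_splits)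
  moreover from Suc.IH[OF V] have "\<alpha> - \<alpha>' = repeat_mset (k + 1) (\<beta> - \<beta>')" .
  moreover have "\<alpha> = \<alpha>' + (\<alpha> - \<alpha>')" "\<beta> = \<beta>' + (\<beta> - \<beta>')"
    using sub by simp_all
  ultimately show ?case
    by (metis repeat_mset_distrib2)
qed

lemma finite_apply_op_D_rect:
  "finite {(\<alpha>, \<beta>). \<alpha> \<subseteq># \<gamma> \<and> D_rect k n \<alpha> \<beta> \<noteq> 0}"
proof (rule finite_imageD)
  show "finite (fst ` {(\<alpha>, \<beta>). \<alpha> \<subseteq># \<gamma> \<and> D_rect k n \<alpha> \<beta> \<noteq> 0})"
    by (rule finite_subset[OF _ finite_submset[of \<gamma>]]) auto
  show "inj_on fst {(\<alpha>, \<beta>). \<alpha> \<subseteq># \<gamma> \<and> D_rect k n \<alpha> \<beta> \<noteq> 0}"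
  proof (rule inj_onI)
    fix x y
    assume xy: "x \<in> {(\<alpha>, \<beta>). \<alpha> \<subseteq># \<gamma> \<and> D_rect k n \<alpha> \<beta> \<noteq> 0}"
      "y \<in> {(\<alpha>, \<beta>). \<alpha> \<subseteq># \<gamma> \<and> D_rect k n \<alpha> \<beta> \<noteq> 0}" and eq: "fst x = fst y"
    have "fst z = repeat_mset (k + 1) (snd z)" if "z \<in> {x, y}" for z
      using xy that by (auto simp: D_rect_def dest!: vee_power_D_op_support)
    with eq have "repeat_mset (k + 1) (snd x) = repeat_mset (k + 1) (snd y)" by simp
    then have "(k + 1) * count (snd x) i = (k + 1) * count (snd y) i" for i
      by (metis count_repeat_mset)
    then have "snd x = snd y" by (intro multiset_eqI) (metis mult_cancel1 add_is_0 one_neq_zero)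
    with eq show "x = y" by (rule prod_eqI)
  qed
qed

definition is_partition :: "nat list \<Rightarrow> bool" where
  "is_partition lam \<longleftrightarrow> sorted_wrt (\<ge>) lam \<and> 0 \<notin> set lam"

abbreviation psize :: "nat list \<Rightarrow> nat" where
  "psize lam \<equiv> sum_list lam"

lemma finite_partitions: "finite {lam. is_partition lam \<and> psize lam \<le> N}"
proof (rule finite_subset)
  have len: "length lam \<le> sum_list lam" if "0 \<notin> set lam" for lam :: "nat list"
    using that by (induction lam) auto
  show "{lam. is_partition lam \<and> psize lam \<le> N} \<subseteq> {lam. set lam \<subseteq> {..N} \<and> length lam \<le> N}"
    using len member_le_sum_list by (fastforce simp: is_partition_def)
  show "finite {lam. set lam \<subseteq> {..N::nat} \<and> length lam \<le> N}"
    by (rule finite_lists_length_le) simp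
qed

text \<open>
  English convention, boxes \<open>(row, column)\<close>. Rows and columns are counted from 0, which does not
  affect contents.
\<close>

type_synonym box = "nat \<times> nat"

definition diagram :: "nat list \<Rightarrow> box set" where
  "diagram lam = {(i, j). i < length lam \<and> j < lam ! i}"

lemma diagram_eq_Sigma: "diagram lam = (SIGMA i:{..<length lam}. {..<lam ! i})"
  by (auto simp: diagram_def)

lemma finite_diagram: "finite (diagram lam)"
  by (simp add: diagram_eq_Sigma)

lemma card_diagram: "card (diagram lam) = psize lam"
  by (simp add: diagram_eq_Sigma sum_list_sum_nth atLeast0LessThan)

definition content :: "box \<Rightarrow> int" where
  "content b = int (snd b) - int (fst b)"

definition semistandard :: "box set \<Rightarrow> (box \<Rightarrow> nat) \<Rightarrow> bool" where
  "semistandard S T \<longleftrightarrow>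
     (\<forall>i j j'. (i, j) \<in> S \<and> (i, j') \<in> S \<and> j < j' \<longrightarrow> T (i, j) \<le> T (i, j')) \<and>
     (\<forall>i i' j. (i, j) \<in> S \<and> (i', j) \<in> S \<and> i < i' \<longrightarrow> T (i, j) < T (i', j))"

text \<open>
  \<open>s\<^sub>\<lambda> = (\<Sum>T. \<Prod>b. x\<^bsub>T b\<^esub>)\<close> over the semistandard tableaux \<open>T\<close> of shape \<open>\<lambda>\<close>: the coefficient of
  \<open>x\<^sub>\<alpha>\<close> counts the tableaux with entries \<open>\<alpha>\<close>.
\<close>

definition schur :: "nat list \<Rightarrow> series" where
  "schur lam = (\<lambda>\<alpha>. of_nat (card {T \<in> diagram lam \<rightarrow>\<^sub>E (UNIV :: nat set).
     semistandard (diagram lam) T \<and> image_mset T (mset_set (diagram lam)) = \<alpha>}))"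

definition adjacent :: "box \<Rightarrow> box \<Rightarrow> bool" where
  "adjacent b c \<longleftrightarrow> \<bar>int (fst b) - int (fst c)\<bar> + \<bar>int (snd b) - int (snd c)\<bar> = 1"

definition components :: "box set \<Rightarrow> box set set" where
  "components S = S // ({(b, c). b \<in> S \<and> c \<in> S \<and> adjacent b c}\<^sup>*)"

definition broken_border_strip :: "box set \<Rightarrow> bool" where
  "broken_border_strip S \<longleftrightarrow>
     \<not> (\<exists>i j. {(i, j), (i, Suc j), (Suc i, j), (Suc i, Suc j)} \<subseteq> S)"

definition border_strip :: "box set \<Rightarrow> bool" where
  "border_strip S \<longleftrightarrow> broken_border_strip S \<and> card (components S) = 1"

definition height :: "box set \<Rightarrow> nat" where
  "height S = card (fst ` S) - 1"

definition box_above :: "box set \<Rightarrow> box \<Rightarrow> bool" where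
  "box_above S b \<longleftrightarrow> (\<exists>i j. b = (Suc i, j) \<and> (i, j) \<in> S)"

definition box_left :: "box set \<Rightarrow> box \<Rightarrow> bool" where
  "box_left S b \<longleftrightarrow> (\<exists>i j. b = (i, Suc j) \<and> (i, j) \<in> S)"

definition box_northwest :: "box set \<Rightarrow> box \<Rightarrow> bool" where
  "box_northwest S b \<longleftrightarrow> (\<exists>i j. b = (Suc i, Suc j) \<and> (i, j) \<in> S)"

definition sharp_corners :: "box set \<Rightarrow> box set" where
  "sharp_corners S = {b \<in> S. \<not> box_above S b \<and> \<not> box_left S b}"

definition dull_corners :: "box set \<Rightarrow> box set" where
  "dull_corners S = {b \<in> S. box_above S b \<and> box_left S b \<and> \<not> box_northwest S b}"

definition skew :: "nat list \<Rightarrow> nat list \<Rightarrow> box set" where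
  "skew lam mu = diagram mu - diagram lam"

text \<open>
  The value 0 outside the two cases is a convention; it is not used below, since chains only
  contain steps of these two kinds.
\<close>

definition d_coeff :: "nat list \<Rightarrow> nat list \<Rightarrow> int" where
  "d_coeff lam mu = (let S = skew lam mu in
     if border_strip S then
       (- 1) ^ height S * ((\<Sum>b\<in>sharp_corners S. content b) - (\<Sum>b\<in>dull_corners S. content b))
     else if broken_border_strip S \<and> card (components S) = 2 then (- 1) ^ height S
     else 0)"

text \<open>The division in the exponent is exact along chains.\<close>

definition f_coeff :: "nat \<Rightarrow> nat list \<Rightarrow> nat list \<Rightarrow> nat list \<Rightarrow> rat" where
  "f_coeff k lam nu rho =
     of_nat k * (- of_nat k - 1) ^ ((psize rho - psize nu) div k - 1)
       / (of_nat (psize rho) - of_nat (psize lam)) * of_int (d_coeff nu rho)"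

definition chain_step :: "nat \<Rightarrow> nat list \<Rightarrow> nat list \<Rightarrow> bool" where
  "chain_step k nu rho \<longleftrightarrow>
     diagram nu \<subset> diagram rho \<and> broken_border_strip (skew nu rho) \<and>
     card (components (skew nu rho)) \<le> 2 \<and> k dvd card (skew nu rho)"

definition chains :: "nat \<Rightarrow> nat list \<Rightarrow> nat list \<Rightarrow> nat list list set" where
  "chains k lam mu = {c. c \<noteq> [] \<and> hd c = lam \<and> last c = mu \<and>
     (\<forall>p\<in>set c. is_partition p) \<and> successively (chain_step k) c}"

lemma finite_chains: "finite (chains k lam mu)"
proof (rule finite_subset)
  have *: "distinct c \<and> (\<forall>p\<in>set c. diagram (hd c) \<subseteq> diagram p \<and> diagram p \<subseteq> diagram (last c))"
    if "successively (chain_step k) c" for c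
    using that
  proof (induction c rule: induct_list012)
    case (3 x y zs)
    then have "diagram x \<subset> diagram y" and IH: "distinct (y # zs)"
      "\<forall>p\<in>set (y # zs). diagram y \<subseteq> diagram p \<and> diagram p \<subseteq> diagram (last (y # zs))"
      by (auto simp: chain_step_def)
    then have "\<forall>p\<in>set (y # zs). diagram x \<subset> diagram p" by blast
    with IH show ?case by auto
  qed auto
  let ?P = "{p. is_partition p \<and> psize p \<le> psize mu}"
  show "chains k lam mu \<subseteq> {c. set c \<subseteq> ?P \<and> distinct c}"
    using * by (fastforce simp: chains_def simp flip: card_diagram
        intro: card_mono finite_diagram)
  show "finite {c. set c \<subseteq> ?P \<and> distinct c}"
    by (rule finite_subset_distinct[OF finite_partitions])
qed

definition a_coeff :: "nat \<Rightarrow> nat list \<Rightarrow> nat list \<Rightarrow> rat" where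
  "a_coeff k lam mu =
     (\<Sum>c\<in>chains k lam mu. \<Prod>i<length c - 1. f_coeff k lam (c ! i) (c ! Suc i))"

end

theory Submission
  imports "Jordan_Normal_Form.Determinant" Defs
begin

text \<open>
  Taylor's formula identifies \<open>\<Sum>n. t\<^sup>n D\<^bsub>(k\<^sup>n)\<^esub>\<close> with the substitution \<open>x\<^sub>i \<mapsto> x\<^sub>i + t x\<^sub>i\<^bsup>k+1\<^esup>\<close>. By the chain rule
  \<open>\<partial>\<^sub>i\<close> of the substituted series picks up the factor \<open>1 + (k + 1) t x\<^sub>i\<^sup>k\<close>; solving for the derivative in \<open>t\<close>
  and expanding the inverse of this factor gives
  \<open>n D\<^bsub>(k\<^sup>n)\<^esub> = (\<Sum>m<n. (-k-1)\<^sup>m D\<^bsub>k(m+1)\<^esub> D\<^bsub>(k\<^bsup>n-1-m\<^esup>)\<^esub>)\<close>. Removing the last step of a chain shows that the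
  coefficients \<open>a\<^bsub>\<lambda>\<mu>\<^esub>\<close> satisfy the same recursion, provided that \<open>D\<^sub>r s\<^sub>\<lambda> = (\<Sum>\<mu>. d\<^bsub>\<lambda>\<mu>\<^esub> s\<^sub>\<mu>)\<close>.

  The latter is proved in \<open>N\<close> variables from \<open>s\<^sub>\<lambda> A\<^sub>\<delta> = A\<^bsub>\<lambda>+\<delta>\<^esub>\<close>, where \<open>A\<^sub>e\<close> is the alternant with exponents \<open>e\<close>. Up to
  a multiple of \<open>A\<^sub>e\<close> by a factor that does not depend on \<open>e\<close>, the derivative \<open>D\<^sub>r A\<^sub>e\<close> is a combination of
  alternants with one exponent raised by \<open>r\<close>, or with two exponents raised by \<open>p\<close> and \<open>r - p\<close>. For \<open>e = \<delta>\<close>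
  this combination vanishes, and for \<open>e = \<lambda> + \<delta>\<close> sorting the exponents adds to \<open>\<lambda>\<close> one border strip or two
  disconnected ones.
\<close>

section \<open>The operators as a substitution\<close>

text \<open>The recursion holds for every series and involves no combinatorics. It explains the
  weights \<open>f_coeff\<close>: powers of \<open>-k-1\<close> are its coefficients, and the
  denominator, which equals \<open>k n\<close> at the last step of a chain, carries out the division
  by \<open>n\<close>. Combinatorics enters only through a single derivation
  \<open>D\<^sub>r\<close>, with \<open>r\<close> a multiple of \<open>k\<close>. For that case let
  \<open>s A\<^sub>\<delta> = A\<^sub>e\<close> with \<open>e = \<lambda> + \<delta>\<close>, and
  suppose \<open>D\<^sub>r A\<^sub>e = R\<^sub>e + K A\<^sub>e\<close> with \<open>K\<close>
  independent of \<open>e\<close>. The product rule then loses \<open>K\<close>, and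
  \<open>R\<^sub>\<delta> = 0\<close> leaves
  \<open>(D\<^sub>r s) A\<^sub>\<delta> = R\<^sub>e\<close>. The only possible \<open>K\<close> is
  the logarithmic derivative of the Vandermonde product \<open>A\<^sub>\<delta>\<close>. Subtracting
  it also removes the dependence on the number of variables: a strip with top row \<open>t\<close>
  and bottom row \<open>b\<close> gets the coefficient \<open>\<lambda>\<^sub>b - t\<close> up to
  sign. This is the number to which the corner contents in \<open>d_coeff\<close> telescope.\<close>

lemma sum_choose_alternating:
  fixes k e b :: nat
  shows "(\<Sum>m<b. (- of_nat k - 1) ^ m * of_nat (e + k * (b - m - 1)) * of_nat (e choose (b - m - 1)))
    = (of_nat b * of_nat (e choose b) :: rat)"
proof (induction b)
  case (Suc b)
  have "(\<Sum>m<Suc b. (- of_nat k - 1) ^ m * of_nat (e + k * (Suc b - m - 1)) * of_nat (e choose (Suc b - m - 1)))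
    = of_nat (e + k * b) * of_nat (e choose b) + (- of_nat k - 1) *
      (\<Sum>m<b. (- of_nat k - 1) ^ m * of_nat (e + k * (b - m - 1)) * of_nat (e choose (b - m - 1)) :: rat)"
    by (subst sum.lessThan_Suc_shift) (simp add: sum_distrib_left mult.assoc)
  also have "\<dots> = of_nat (e + k * b) * of_nat (e choose b) + (- of_nat k - 1) * (of_nat b * of_nat (e choose b))"
    by (simp only: Suc.IH)
  also have "\<dots> = (of_nat e - of_nat b) * of_nat (e choose b)"
    by (simp add: algebra_simps)
  also have "\<dots> = of_nat (Suc b) * of_nat (e choose Suc b)"
  proof (cases "b \<le> e")
    case True
    have "Suc b * (e choose Suc b) = (e - b) * (e choose b)"
      by (metis binomial_absorb_comp binomial_absorption)
    then have "of_nat (Suc b * (e choose Suc b)) = (of_nat ((e - b) * (e choose b)) :: rat)" by (rule arg_cong)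
    with True show ?thesis by (simp only: of_nat_mult of_nat_diff)
  qed (simp add: binomial_eq_0 not_le)
  finally show ?case .
qed simp

text \<open>
  The coefficient of \<open>t\<^sup>n\<close> in the series obtained from \<open>f\<close> by \<open>x\<^sub>i \<mapsto> x\<^sub>i + t x\<^sub>i\<^bsup>k+1\<^esup>\<close>.
\<close>
definition subst_coeff :: "nat \<Rightarrow> nat \<Rightarrow> series \<Rightarrow> series" where
  "subst_coeff k n f = (\<lambda>\<gamma>. \<Sum>\<beta> | size \<beta> = n \<and> repeat_mset k \<beta> \<subseteq># \<gamma>.
     of_nat (\<Prod>i\<in>set_mset \<gamma>. (count \<gamma> i - k * count \<beta> i) choose count \<beta> i) * f (\<gamma> - repeat_mset k \<beta>))"

lemma subseteq_repeat_mset: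
  assumes "k \<ge> 1"
  shows "\<beta> \<subseteq># repeat_mset k \<beta>"
  using assms by (simp add: subseteq_mset_def)

lemma finite_repeat_mset_subset:
  assumes "k \<ge> 1"
  shows "finite {\<beta>. P \<beta> \<and> repeat_mset k \<beta> \<subseteq># \<gamma>}"
  by (rule finite_subset[OF _ finite_submset[of \<gamma>]])
    (use subseteq_repeat_mset[OF assms] in \<open>auto intro: subset_mset.order_trans\<close>)

lemma subst_coeff_0:
  assumes "k \<ge> 1" shows "subst_coeff k 0 f = f"
proof -
  have "{\<beta>. size \<beta> = 0 \<and> repeat_mset k \<beta> \<subseteq># \<gamma>} = {{#}}" for \<gamma> :: "nat multiset" by auto
  then show ?thesis by (simp add: subst_coeff_def)
qed

text \<open>For \<open>n = 1\<close> the multiset \<beta> is a single index and the only nontrivial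
  binomial is the exponent before the substitution. This is the action of \<open>D\<^sub>r\<close>
  and the form in which it is used below.\<close>

lemma subst_coeff_1:
  assumes "r \<ge> 1"
  shows "subst_coeff r 1 f \<gamma> = (\<Sum>i | r \<le> count \<gamma> i. of_nat (count \<gamma> i - r) * f (\<gamma> - replicate_mset r i))"
proof -
  have sub: "replicate_mset r i \<subseteq># \<gamma> \<longleftrightarrow> r \<le> count \<gamma> i" for i
    by (auto simp: subseteq_mset_def)
  have "subst_coeff r 1 f \<gamma> = (\<Sum>\<beta>\<in>(\<lambda>i. {#i#}) ` {i. r \<le> count \<gamma> i}.
     of_nat (\<Prod>i\<in>set_mset \<gamma>. (count \<gamma> i - r * count \<beta> i) choose count \<beta> i) * f (\<gamma> - repeat_mset r \<beta>))"
    unfolding subst_coeff_def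
    by (rule sum.cong) (auto simp: sub image_iff dest!: size_1_singleton_mset[unfolded One_nat_def])
  also have "\<dots> = (\<Sum>i | r \<le> count \<gamma> i.
     of_nat (\<Prod>j\<in>set_mset \<gamma>. (count \<gamma> j - r * count {#i#} j) choose count {#i#} j) * f (\<gamma> - replicate_mset r i))"
    by (subst sum.reindex) (auto simp: inj_on_def)
  also have "\<dots> = (\<Sum>i | r \<le> count \<gamma> i. of_nat (count \<gamma> i - r) * f (\<gamma> - replicate_mset r i))"
  proof (rule sum.cong)
    fix i assume "i \<in> {i. r \<le> count \<gamma> i}"
    then have i: "i \<in> set_mset \<gamma>" using assms by (auto simp flip: count_greater_zero_iff)
    have "(\<Prod>j\<in>set_mset \<gamma>. (count \<gamma> j - r * count {#i#} j) choose count {#i#} j)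
      = (count \<gamma> i - r) * (\<Prod>j\<in>set_mset \<gamma> - {i}. (count \<gamma> j - r * count {#i#} j) choose count {#i#} j)"
      using i by (subst prod.remove[of _ i]) auto
    also have "(\<Prod>j\<in>set_mset \<gamma> - {i}. (count \<gamma> j - r * count {#i#} j) choose count {#i#} j) = 1"
      by (rule prod.neutral) auto
    finally show "of_nat (\<Prod>j\<in>set_mset \<gamma>. (count \<gamma> j - r * count {#i#} j) choose count {#i#} j) * f (\<gamma> - replicate_mset r i)
      = of_nat (count \<gamma> i - r) * f (\<gamma> - replicate_mset r i)" by simp
  qed simp
  finally show ?thesis .
qed

text \<open>
  The chain rule, coefficientwise: the terms with the same \<open>\<beta>\<close> on both sides are matched one variable at
  a time by \<open>sum_choose_alternating\<close>.
\<close>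
lemma subst_coeff_rec:
  assumes k: "k \<ge> 1"
  shows "of_nat n * subst_coeff k n f \<gamma> =
    (\<Sum>m<n. (- of_nat k - 1) ^ m * subst_coeff (k * (m + 1)) 1 (subst_coeff k (n - 1 - m) f) \<gamma>)"
proof -
  \<comment> \<open>The product runs over the support of \<gamma> even when \<delta> is smaller, so
    that all these products have the same index set. The additional factors are
    \<open>0 choose 0 = 1\<close>, see \<open>b_eq\<close>.\<close>
  define b where "b \<delta> \<beta> = (\<Prod>i\<in>set_mset \<gamma>. (count \<delta> i - k * count \<beta> i) choose count \<beta> i)" for \<delta> \<beta> :: "nat multiset"
  \<comment> \<open>The factor \<open>n\<close> is split as the sum of the multiplicities of
    \<beta>, and each multiplicity into values of \<open>m\<close>. The term (\<beta>, i, m) then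
    matches the term on the right where the outer operator raises the exponent of variable
    \<open>i\<close> by \<open>k (m + 1)\<close> and the inner substitution uses \<beta> with
    \<open>m + 1\<close> copies of \<open>i\<close> removed.\<close>
  define S where "S = Sigma {\<beta>. size \<beta> = n \<and> repeat_mset k \<beta> \<subseteq># \<gamma>} (\<lambda>\<beta>. SIGMA i:set_mset \<beta>. {m. m < count \<beta> i})"
  define S' where "S' = Sigma {m. m < n} (\<lambda>m. SIGMA i:{i. k * (m + 1) \<le> count \<gamma> i}.
     {\<beta>. size \<beta> = n - 1 - m \<and> repeat_mset k \<beta> \<subseteq># \<gamma> - replicate_mset (k * (m + 1)) i})"
  have fin: "finite {i. k * (m + 1) \<le> count \<gamma> i}" for m
    by (rule finite_subset[of _ "set_mset \<gamma>"]) (use k in \<open>auto simp flip: count_greater_zero_iff\<close>)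
  have base: "of_nat n * of_nat (b \<gamma> \<beta>) = (\<Sum>i\<in>set_mset \<beta>. \<Sum>m<count \<beta> i. (- of_nat k - 1) ^ m * of_nat (count \<gamma> i - k * (m + 1))
      * (of_nat (b (\<gamma> - replicate_mset (k * (m + 1)) i) (\<beta> - replicate_mset (m + 1) i)) :: rat))"
    if \<beta>: "size \<beta> = n" "repeat_mset k \<beta> \<subseteq># \<gamma>" for \<beta>
  proof -
    have cnt: "k * count \<beta> i \<le> count \<gamma> i" for i
      using \<beta>(2) by (auto simp: subseteq_mset_def)
    have "\<beta> \<subseteq># \<gamma>" using \<beta>(2) k subseteq_repeat_mset subset_mset.order_trans by blast
    then have sub: "set_mset \<beta> \<subseteq> set_mset \<gamma>" by (rule set_mset_mono)
    have inner: "(\<Sum>m<count \<beta> i. (- of_nat k - 1) ^ m * of_nat (count \<gamma> i - k * (m + 1))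
      * (of_nat (b (\<gamma> - replicate_mset (k * (m + 1)) i) (\<beta> - replicate_mset (m + 1) i)) :: rat))
      = of_nat (count \<beta> i) * of_nat (b \<gamma> \<beta>)" if i: "i \<in># \<beta>" for i
    proof -
      \<comment> \<open>The exponent of variable \<open>i\<close> in \<open>f\<close>, before any
        substitution. It is the same for all \<open>m\<close>, and so is the product
        \<open>R\<close> over the other variables; only the binomial at \<open>i\<close>
        changes.\<close>
      define e where "e = count \<gamma> i - k * count \<beta> i"
      define R where "R = (\<Prod>j\<in>set_mset \<gamma> - {i}. (count \<gamma> j - k * count \<beta> j) choose count \<beta> j)"
      have bi: "b \<gamma> \<beta> = (e choose count \<beta> i) * R"
        using i sub unfolding b_def e_def R_def by (subst prod.remove[of _ i]) auto
      have bm: "b (\<gamma> - replicate_mset (k * (m + 1)) i) (\<beta> - replicate_mset (m + 1) i)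
        = (e choose (count \<beta> i - m - 1)) * R" if m: "m < count \<beta> i" for m
      proof -
        have e: "count \<gamma> i - k * (m + 1) - k * (count \<beta> i - (m + 1)) = e"
        proof -
          have "k * (m + 1) + k * (count \<beta> i - (m + 1)) = k * count \<beta> i"
            using m by (metis Suc_eq_plus1 Suc_leI distrib_left le_add_diff_inverse)
          then show ?thesis by (simp add: e_def)
        qed
        have "b (\<gamma> - replicate_mset (k * (m + 1)) i) (\<beta> - replicate_mset (m + 1) i)
          = (e choose (count \<beta> i - (m + 1))) * (\<Prod>j\<in>set_mset \<gamma> - {i}. (count \<gamma> j - k * count \<beta> j) choose count \<beta> j)"
          using i sub e unfolding b_def
          by (subst prod.remove[of _ i]) (auto intro!: prod.cong)
        then show ?thesis by (simp add: R_def)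
      qed
      have "(\<Sum>m<count \<beta> i. (- of_nat k - 1) ^ m * of_nat (count \<gamma> i - k * (m + 1))
        * (of_nat (b (\<gamma> - replicate_mset (k * (m + 1)) i) (\<beta> - replicate_mset (m + 1) i)) :: rat))
        = (\<Sum>m<count \<beta> i. (- of_nat k - 1) ^ m * of_nat (e + k * (count \<beta> i - m - 1)) * of_nat (e choose (count \<beta> i - m - 1))) * of_nat R"
        unfolding sum_distrib_right
      proof (rule sum.cong)
        fix m assume "m \<in> {..<count \<beta> i}"
        then have m: "m < count \<beta> i" by simp
        have "k * (m + 1) + k * (count \<beta> i - m - 1) = k * count \<beta> i"
          using m by (metis Suc_eq_plus1 Suc_leI diff_diff_left distrib_left le_add_diff_inverse)
        then have "count \<gamma> i - k * (m + 1) = e + k * (count \<beta> i - m - 1)"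
          using cnt[of i] by (simp add: e_def)
        with bm[OF m] show "(- of_nat k - 1) ^ m * of_nat (count \<gamma> i - k * (m + 1))
        * (of_nat (b (\<gamma> - replicate_mset (k * (m + 1)) i) (\<beta> - replicate_mset (m + 1) i)) :: rat)
         = (- of_nat k - 1) ^ m * of_nat (e + k * (count \<beta> i - m - 1)) * of_nat (e choose (count \<beta> i - m - 1)) * of_nat R"
          by (simp only: of_nat_mult mult.assoc)
      qed simp
      also have "\<dots> = of_nat (count \<beta> i) * of_nat (b \<gamma> \<beta>)"
        unfolding sum_choose_alternating bi by simp
      finally show ?thesis .
    qed
    have "of_nat n * of_nat (b \<gamma> \<beta>) = (\<Sum>i\<in>set_mset \<beta>. of_nat (count \<beta> i) * of_nat (b \<gamma> \<beta>) :: rat)"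
      by (simp add: size_multiset_overloaded_eq sum_distrib_right flip: \<beta>(1))
    also note sum.cong[OF refl inner[symmetric]]
    finally show ?thesis .
  qed
  have "of_nat n * subst_coeff k n f \<gamma> = (\<Sum>\<beta> | size \<beta> = n \<and> repeat_mset k \<beta> \<subseteq># \<gamma>.
     \<Sum>i\<in>set_mset \<beta>. \<Sum>m | m < count \<beta> i. (- of_nat k - 1) ^ m * of_nat (count \<gamma> i - k * (m + 1))
      * of_nat (b (\<gamma> - replicate_mset (k * (m + 1)) i) (\<beta> - replicate_mset (m + 1) i)) * f (\<gamma> - repeat_mset k \<beta>))"
  proof -
    have "of_nat n * subst_coeff k n f \<gamma> = (\<Sum>\<beta> | size \<beta> = n \<and> repeat_mset k \<beta> \<subseteq># \<gamma>.
      (of_nat n * of_nat (b \<gamma> \<beta>)) * f (\<gamma> - repeat_mset k \<beta>))"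
      by (simp add: subst_coeff_def sum_distrib_left mult.assoc b_def)
    then show ?thesis
      by (simp add: base sum_distrib_right lessThan_def)
  qed
  also have "\<dots> = (\<Sum>(\<beta>, i, m)\<in>S. (- of_nat k - 1) ^ m * of_nat (count \<gamma> i - k * (m + 1))
      * of_nat (b (\<gamma> - replicate_mset (k * (m + 1)) i) (\<beta> - replicate_mset (m + 1) i)) * f (\<gamma> - repeat_mset k \<beta>))"
  proof -
    have *: "(\<Sum>i\<in>set_mset \<beta>. \<Sum>m | m < count \<beta> i. g i m)
      = (\<Sum>(i, m)\<in>(SIGMA i:set_mset \<beta>. {m. m < count \<beta> i}). g i m)" for \<beta> and g :: "nat \<Rightarrow> nat \<Rightarrow> rat"
      by (rule sum.Sigma) auto
    show ?thesis
      unfolding S_def * by (rule sum.Sigma) (use finite_repeat_mset_subset[OF k] in auto)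
  qed
  also have "\<dots> = (\<Sum>(m, i, \<beta>)\<in>S'. (- of_nat k - 1) ^ m * of_nat (count \<gamma> i - k * (m + 1))
      * of_nat (b (\<gamma> - replicate_mset (k * (m + 1)) i) \<beta>) * f (\<gamma> - replicate_mset (k * (m + 1)) i - repeat_mset k \<beta>))"
  proof (rule sum.reindex_bij_witness[where i = "\<lambda>(m, i, \<beta>). (\<beta> + replicate_mset (m + 1) i, i, m)"
      and j = "\<lambda>(\<beta>, i, m). (m, i, \<beta> - replicate_mset (m + 1) i)"])
    fix a assume "a \<in> S"
    then obtain \<beta> i m where a: "a = (\<beta>, i, m)" and \<beta>: "size \<beta> = n" "repeat_mset k \<beta> \<subseteq># \<gamma>" "i \<in># \<beta>" "m < count \<beta> i"
      by (auto simp: S_def)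
    define \<beta>' where "\<beta>' = \<beta> - replicate_mset (m + 1) i"
    have "replicate_mset (m + 1) i \<subseteq># \<beta>" using \<beta>(4) by (auto simp: subseteq_mset_def)
    then have \<beta>': "\<beta> = \<beta>' + replicate_mset (m + 1) i" unfolding \<beta>'_def by (rule subset_mset.diff_add[symmetric])
    have rep: "repeat_mset k \<beta> = repeat_mset k \<beta>' + replicate_mset (k * (m + 1)) i"
      by (simp add: \<beta>' repeat_mset_distrib2 multiset_eq_iff del: replicate_mset_Suc)
    have sz: "size \<beta>' = n - 1 - m" "m < n" using \<beta>(1) by (auto simp: \<beta>')
    have cg: "repeat_mset k \<beta>' + replicate_mset (k * (m + 1)) i \<subseteq># \<gamma>" using \<beta>(2) rep by simp
    then have "k * (m + 1) \<le> count \<gamma> i"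
      by (auto simp: subseteq_mset_def dest!: spec[of _ i])
    moreover have "repeat_mset k \<beta>' \<subseteq># \<gamma> - replicate_mset (k * (m + 1)) i"
      using cg by (metis subset_mset.le_diff_conv2 mset_subset_eq_add_right subset_mset.order_trans)
    ultimately show "(case a of (\<beta>, i, m) \<Rightarrow> (m, i, \<beta> - replicate_mset (m + 1) i)) \<in> S'"
      using sz by (simp add: a S'_def \<beta>' del: replicate_mset_Suc)
    show "(case (case a of (\<beta>, i, m) \<Rightarrow> (m, i, \<beta> - replicate_mset (m + 1) i)) of
      (m, i, \<beta>) \<Rightarrow> (\<beta> + replicate_mset (m + 1) i, i, m)) = a"
      by (simp add: a \<beta>' del: replicate_mset_Suc)
    show "(case (case a of (\<beta>, i, m) \<Rightarrow> (m, i, \<beta> - replicate_mset (m + 1) i)) of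
      (m, i, \<beta>) \<Rightarrow> (- of_nat k - 1) ^ m * of_nat (count \<gamma> i - k * (m + 1))
      * of_nat (b (\<gamma> - replicate_mset (k * (m + 1)) i) \<beta>) * f (\<gamma> - replicate_mset (k * (m + 1)) i - repeat_mset k \<beta>))
      = (case a of (\<beta>, i, m) \<Rightarrow> (- of_nat k - 1) ^ m * of_nat (count \<gamma> i - k * (m + 1))
      * of_nat (b (\<gamma> - replicate_mset (k * (m + 1)) i) (\<beta> - replicate_mset (m + 1) i)) * f (\<gamma> - repeat_mset k \<beta>))"
      unfolding a prod.case \<beta>'_def[symmetric] rep by (simp add: add.commute del: replicate_mset_Suc)
  next
    fix a assume "a \<in> S'"
    then obtain \<beta> i m where a: "a = (m, i, \<beta>)" and \<beta>: "m < n" "k * (m + 1) \<le> count \<gamma> i"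
      "size \<beta> = n - 1 - m" "repeat_mset k \<beta> \<subseteq># \<gamma> - replicate_mset (k * (m + 1)) i"
      by (auto simp: S'_def)
    show "(case (case a of (m, i, \<beta>) \<Rightarrow> (\<beta> + replicate_mset (m + 1) i, i, m)) of (\<beta>, i, m) \<Rightarrow> (m, i, \<beta> - replicate_mset (m + 1) i)) = a"
      by (simp add: a del: replicate_mset_Suc)
    have "replicate_mset (k * (m + 1)) i \<subseteq># \<gamma>" using \<beta>(2) by (auto simp: subseteq_mset_def)
    then have "repeat_mset k \<beta> + replicate_mset (k * (m + 1)) i \<subseteq># \<gamma>"
      using \<beta>(4) by (simp add: subset_mset.le_diff_conv2)
    moreover have "repeat_mset k (\<beta> + replicate_mset (m + 1) i) = repeat_mset k \<beta> + replicate_mset (k * (m + 1)) i"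
      by (simp add: repeat_mset_distrib2 multiset_eq_iff del: replicate_mset_Suc)
    ultimately show "(case a of (m, i, \<beta>) \<Rightarrow> (\<beta> + replicate_mset (m + 1) i, i, m)) \<in> S"
      using \<beta>(1,3) by (simp add: a S_def del: replicate_mset_Suc)
  qed
  also have "\<dots> = (\<Sum>m | m < n. \<Sum>i | k * (m + 1) \<le> count \<gamma> i. \<Sum>\<beta> | size \<beta> = n - 1 - m \<and> repeat_mset k \<beta> \<subseteq># \<gamma> - replicate_mset (k * (m + 1)) i.
      (- of_nat k - 1) ^ m * of_nat (count \<gamma> i - k * (m + 1))
      * of_nat (b (\<gamma> - replicate_mset (k * (m + 1)) i) \<beta>) * f (\<gamma> - replicate_mset (k * (m + 1)) i - repeat_mset k \<beta>))"
  proof -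
    have *: "(\<Sum>i | k * (m + 1) \<le> count \<gamma> i. \<Sum>\<beta> | size \<beta> = n - 1 - m \<and> repeat_mset k \<beta> \<subseteq># \<gamma> - replicate_mset (k * (m + 1)) i. g i \<beta>)
      = (\<Sum>(i, \<beta>)\<in>(SIGMA i:{i. k * (m + 1) \<le> count \<gamma> i}.
     {\<beta>. size \<beta> = n - 1 - m \<and> repeat_mset k \<beta> \<subseteq># \<gamma> - replicate_mset (k * (m + 1)) i}). g i \<beta>)" for m and g :: "nat \<Rightarrow> nat multiset \<Rightarrow> rat"
      by (rule sum.Sigma) (use finite_repeat_mset_subset[OF k] fin in \<open>auto simp del: replicate_mset_Suc\<close>)
    show ?thesis
      unfolding S'_def *
      by (rule sum.Sigma[symmetric]) (use finite_repeat_mset_subset[OF k] fin in \<open>auto simp del: replicate_mset_Suc intro!: finite_SigmaI\<close>)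
  qed
  also have "\<dots> = (\<Sum>m | m < n. (- of_nat k - 1) ^ m * (\<Sum>i | k * (m + 1) \<le> count \<gamma> i. of_nat (count \<gamma> i - k * (m + 1))
      * subst_coeff k (n - 1 - m) f (\<gamma> - replicate_mset (k * (m + 1)) i)))"
  proof -
    have b_eq: "of_nat (b (\<gamma> - \<rho>) \<beta>) = (of_nat (\<Prod>j\<in>set_mset (\<gamma> - \<rho>). (count (\<gamma> - \<rho>) j - k * count \<beta> j) choose count \<beta> j) :: rat)"
      if "repeat_mset k \<beta> \<subseteq># \<gamma> - \<rho>" for \<rho> \<beta>
    proof -
      have "\<beta> \<subseteq># \<gamma> - \<rho>" using that k subseteq_repeat_mset subset_mset.order_trans by blast
      then have "set_mset \<beta> \<subseteq> set_mset (\<gamma> - \<rho>)" by (rule set_mset_mono)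
      then have "j \<notin> set_mset (\<gamma> - \<rho>) \<Longrightarrow> count \<beta> j = 0" for j by (metis count_inI subsetD)
      moreover have "set_mset (\<gamma> - \<rho>) \<subseteq> set_mset \<gamma>" by (rule set_mset_mono) simp
      ultimately have "b (\<gamma> - \<rho>) \<beta> = (\<Prod>j\<in>set_mset (\<gamma> - \<rho>). (count (\<gamma> - \<rho>) j - k * count \<beta> j) choose count \<beta> j)"
        unfolding b_def by (intro prod.mono_neutral_right) auto
      then show ?thesis by simp
    qed
    show ?thesis
      unfolding subst_coeff_def sum_distrib_left
      by (intro sum.cong refl) (auto simp: b_eq mult.assoc simp del: replicate_mset_Suc of_nat_prod)
  qed
  also have "\<dots> = (\<Sum>m<n. (- of_nat k - 1) ^ m * subst_coeff (k * (m + 1)) 1 (subst_coeff k (n - 1 - m) f) \<gamma>)"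
  proof -
    have "1 \<le> k * (m + 1)" for m using k by simp
    from subst_coeff_1[OF this] show ?thesis by (simp only: lessThan_def)
  qed
  finally show ?thesis .
qed


section \<open>Taylor's formula for the operators\<close>

lemma vee_power_D_op:
  "vee_power (D_op k) n \<alpha> \<beta> =
    (if \<alpha> = repeat_mset (k + 1) \<beta> \<and> size \<beta> = n then fact n / (\<Prod>i\<in>set_mset \<beta>. fact (count \<beta> i)) else 0)"
proof (induction n arbitrary: \<alpha> \<beta>)
  case 0
  then show ?case by (auto simp: id_op_def)
next
  case (Suc n)
  define W where "W \<beta> = (\<Prod>i\<in>set_mset \<beta>. fact (count \<beta> i) :: rat)" for \<beta> :: "nat multiset"
  have W0: "W \<beta> \<noteq> 0" for \<beta> by (simp add: W_def)
  have Wi: "W \<beta> = of_nat (count \<beta> i) * W (\<beta> - {#i#})" if i: "i \<in># \<beta>" for i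
  proof -
    have "W \<beta> = fact (count \<beta> i) * (\<Prod>j\<in>set_mset \<beta> - {i}. fact (count \<beta> j))"
      unfolding W_def using i by (subst prod.remove[of _ i]) auto
    moreover have "W (\<beta> - {#i#}) = (\<Prod>j\<in>set_mset \<beta>. fact (count (\<beta> - {#i#}) j))"
      unfolding W_def
      using i by (intro prod.mono_neutral_left) (auto simp: in_diff_count not_in_iff split: if_splits)
    moreover have "\<dots> = fact (count \<beta> i - 1) * (\<Prod>j\<in>set_mset \<beta> - {i}. fact (count \<beta> j))"
      using i by (subst prod.remove[of _ i]) (auto intro!: prod.cong)
    ultimately show ?thesis
      using i by (simp add: fact_reduce[of "count \<beta> i"])
  qed
  show ?case
  proof (cases "\<alpha> = repeat_mset (k + 1) \<beta>")
    case False
    then have "vee_power (D_op k) (Suc n) \<alpha> \<beta> = 0"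
      using vee_power_D_op_support by blast
    with False show ?thesis by simp
  next
    case True
    let ?g = "\<lambda>i. (replicate_mset (k + 1) i, {#i#})"
    have "vee_power (D_op k) (Suc n) \<alpha> \<beta> = (\<Sum>(\<alpha>', \<beta>')\<in>{\<alpha>'. \<alpha>' \<subseteq># \<alpha>} \<times> {\<beta>'. \<beta>' \<subseteq># \<beta>}.
      D_op k \<alpha>' \<beta>' * vee_power (D_op k) n (\<alpha> - \<alpha>') (\<beta> - \<beta>'))"
      by (simp add: vee_def sum.cartesian_product)
    also have "\<dots> = (\<Sum>(\<alpha>', \<beta>')\<in>?g ` set_mset \<beta>. D_op k \<alpha>' \<beta>' * vee_power (D_op k) n (\<alpha> - \<alpha>') (\<beta> - \<beta>'))"
    proof (rule sum.mono_neutral_right)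
      show "finite ({\<alpha>'. \<alpha>' \<subseteq># \<alpha>} \<times> {\<beta>'. \<beta>' \<subseteq># \<beta>})"
        by (intro finite_cartesian_product finite_submset)
      show "?g ` set_mset \<beta> \<subseteq> {\<alpha>'. \<alpha>' \<subseteq># \<alpha>} \<times> {\<beta>'. \<beta>' \<subseteq># \<beta>}"
      proof clarify
        fix i assume "i \<in># \<beta>"
        then have "1 \<le> count \<beta> i" by (simp add: Suc_leI)
        from mult_le_mono[OF order.refl[of "Suc k"] this]
        show "replicate_mset (k + 1) i \<in> {\<alpha>'. \<alpha>' \<subseteq># \<alpha>} \<and> {#i#} \<in> {\<beta>'. \<beta>' \<subseteq># \<beta>}"
          using \<open>i \<in># \<beta>\<close> by (auto simp: True subseteq_mset_def simp del: replicate_mset_Suc)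
      qed
    qed (auto simp: D_op_def)
    also have "\<dots> = (\<Sum>i\<in>set_mset \<beta>. D_op k (replicate_mset (k + 1) i) {#i#} *
        vee_power (D_op k) n (\<alpha> - replicate_mset (k + 1) i) (\<beta> - {#i#}))"
      by (subst sum.reindex) (auto simp: inj_on_def simp del: replicate_mset_Suc)
    also have "\<dots> = (\<Sum>i\<in>set_mset \<beta>. if size \<beta> = Suc n then fact n / W (\<beta> - {#i#}) else 0)"
    proof (rule sum.cong)
      fix i assume i: "i \<in># \<beta>"
      have "\<alpha> - replicate_mset (k + 1) i = repeat_mset (k + 1) (\<beta> - {#i#})"
      proof -
        obtain \<beta>' where "\<beta> = add_mset i \<beta>'" using i by (rule mset_add)
        then show ?thesis by (simp add: True)
      qed
      moreover have "size (\<beta> - {#i#}) = n \<longleftrightarrow> size \<beta> = Suc n"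
        using i by (auto simp: size_Diff_singleton dest: multi_member_split)
      moreover have "D_op k (replicate_mset (k + 1) i) {#i#} = 1"
        unfolding D_op_def by auto
      ultimately show "D_op k (replicate_mset (k + 1) i) {#i#} * vee_power (D_op k) n (\<alpha> - replicate_mset (k + 1) i) (\<beta> - {#i#})
        = (if size \<beta> = Suc n then fact n / W (\<beta> - {#i#}) else 0)"
        by (simp add: Suc.IH W_def)
    qed simp
    also have "\<dots> = (if size \<beta> = Suc n then (\<Sum>i\<in>set_mset \<beta>. of_nat (count \<beta> i)) * (fact n / W \<beta>) else 0)"
    proof -
      have "fact n / W (\<beta> - {#i#}) = of_nat (count \<beta> i) * (fact n / W \<beta>)" if "i \<in># \<beta>" for i
        using that by (simp add: Wi[OF that] W0 not_in_iff flip: count_greater_zero_iff)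
      then show ?thesis unfolding sum_distrib_right by simp
    qed
    also have "\<dots> = (if size \<beta> = Suc n then fact (Suc n) / W \<beta> else 0)"
      by (simp add: size_multiset_overloaded_eq flip: of_nat_sum)
    finally show ?thesis using True by (simp add: W_def)
  qed
qed

text \<open>Every variable contributes a falling factorial, written as a quotient of factorials. The
  index set \<open>A\<close> may exceed the support of \<beta>, so that the product can be merged
  with others over the support of a monomial \<gamma>.\<close>

lemma partials_eq:
  assumes "finite A" "set_mset \<beta> \<subseteq> A"
  shows "partials \<beta> f \<delta> = (\<Prod>i\<in>A. fact (count (\<delta> + \<beta>) i) / fact (count \<delta> i)) * f (\<delta> + \<beta>)"
  using assms(2)
proof (induction \<beta> arbitrary: \<delta>)
  case empty
  then show ?case by (simp add: partials_def)
next
  case (add x \<beta>)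
  interpret comp_fun_commute partial by (rule comp_fun_commute_partial)
  have x: "x \<in> A" using add.prems by simp
  have "partials (add_mset x \<beta>) f \<delta> = of_nat (count \<delta> x + 1) * partials \<beta> f (add_mset x \<delta>)"
    by (simp add: partials_def partial_def)
  also have "partials \<beta> f (add_mset x \<delta>)
    = (\<Prod>i\<in>A. fact (count (\<delta> + add_mset x \<beta>) i) / fact (count (add_mset x \<delta>) i)) * f (\<delta> + add_mset x \<beta>)"
    using add.IH[of "add_mset x \<delta>"] add.prems by (simp only: union_mset_add_mset_left union_mset_add_mset_right) simp
  also have "of_nat (count \<delta> x + 1) * \<dots> = (of_nat (count \<delta> x + 1) *
      (\<Prod>i\<in>A. fact (count (\<delta> + add_mset x \<beta>) i) / fact (count (add_mset x \<delta>) i))) * f (\<delta> + add_mset x \<beta>)"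
    by (rule mult.assoc[symmetric])
  also have "of_nat (count \<delta> x + 1) * (\<Prod>i\<in>A. fact (count (\<delta> + add_mset x \<beta>) i) / fact (count (add_mset x \<delta>) i))
    = (\<Prod>i\<in>A. fact (count (\<delta> + add_mset x \<beta>) i) / fact (count \<delta> i) :: rat)"
  proof -
    have "(\<Prod>i\<in>A - {x}. fact (count (\<delta> + add_mset x \<beta>) i) / fact (count (add_mset x \<delta>) i))
      = (\<Prod>i\<in>A - {x}. fact (count (\<delta> + add_mset x \<beta>) i) / fact (count \<delta> i) :: rat)"
      by (rule prod.cong) auto
    moreover have "of_nat (count \<delta> x + 1) * (fact (count (\<delta> + add_mset x \<beta>) x) / fact (count (add_mset x \<delta>) x))
      = (fact (count (\<delta> + add_mset x \<beta>) x) / fact (count \<delta> x) :: rat)"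
      by (simp del: of_nat_Suc)
    ultimately show ?thesis
      by (simp only: prod.remove[OF assms(1) x] mult.assoc[symmetric])
  qed
  finally show ?case .
qed

lemma apply_op_D_rect:
  assumes k: "k \<ge> 1"
  shows "apply_op (D_rect k n) f = subst_coeff k n f"
proof
  fix \<gamma> :: "nat multiset"
  let ?B = "{\<beta>. size \<beta> = n \<and> repeat_mset (k + 1) \<beta> \<subseteq># \<gamma>}"
  have D: "D_rect k n \<alpha> \<beta> = (if \<alpha> = repeat_mset (k + 1) \<beta> \<and> size \<beta> = n then 1 / (\<Prod>i\<in>set_mset \<beta>. fact (count \<beta> i)) else 0)" for \<alpha> \<beta>
    by (simp add: D_rect_def vee_power_D_op)
  have "apply_op (D_rect k n) f \<gamma> = (\<Sum>(\<alpha>, \<beta>)\<in>(\<lambda>\<beta>. (repeat_mset (k + 1) \<beta>, \<beta>)) ` ?B.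
     D_rect k n \<alpha> \<beta> * mono_times \<alpha> (partials \<beta> f) \<gamma>)"
    unfolding apply_op_def by (rule sum.cong) (auto simp: D simp del: repeat_mset_Suc)
  also have "\<dots> = (\<Sum>\<beta>\<in>?B. D_rect k n (repeat_mset (k + 1) \<beta>) \<beta> * mono_times (repeat_mset (k + 1) \<beta>) (partials \<beta> f) \<gamma>)"
    by (subst sum.reindex) (auto simp: inj_on_def)
  also have "\<dots> = (\<Sum>\<beta>\<in>?B. of_nat (\<Prod>i\<in>set_mset \<gamma>. (count \<gamma> i - k * count \<beta> i) choose count \<beta> i) * f (\<gamma> - repeat_mset k \<beta>))"
  proof (rule sum.cong)
    fix \<beta> assume \<beta>: "\<beta> \<in> ?B"
    then have le: "count \<beta> i + k * count \<beta> i \<le> count \<gamma> i" for i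
      by (auto simp: subseteq_mset_def simp del: repeat_mset_Suc)
    then have "\<beta> \<subseteq># \<gamma>" by (auto simp: subseteq_mset_def intro: order.trans[OF le_add1])
    then have sub: "set_mset \<beta> \<subseteq> set_mset \<gamma>" by (rule set_mset_mono)
    let ?\<delta> = "\<gamma> - repeat_mset (k + 1) \<beta>"
    have eq: "?\<delta> + \<beta> = \<gamma> - repeat_mset k \<beta>"
    proof (rule multiset_eqI)
      fix i show "count (?\<delta> + \<beta>) i = count (\<gamma> - repeat_mset k \<beta>) i"
        using le[of i] by simp
    qed
    have "(\<Prod>i\<in>set_mset \<beta>. fact (count \<beta> i)) = (\<Prod>i\<in>set_mset \<gamma>. fact (count \<beta> i) :: rat)"
      using sub by (intro prod.mono_neutral_left) (auto simp: not_in_iff)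
    then have "D_rect k n (repeat_mset (k + 1) \<beta>) \<beta> * mono_times (repeat_mset (k + 1) \<beta>) (partials \<beta> f) \<gamma>
      = (\<Prod>i\<in>set_mset \<gamma>. fact (count (?\<delta> + \<beta>) i) / fact (count ?\<delta> i) / fact (count \<beta> i)) * f (?\<delta> + \<beta>)"
      using \<beta> sub by (simp add: D mono_times_def partials_eq[of "set_mset \<gamma>"] prod_dividef prod.distrib del: repeat_mset_Suc)
    also have "(\<Prod>i\<in>set_mset \<gamma>. fact (count (?\<delta> + \<beta>) i) / fact (count ?\<delta> i) / fact (count \<beta> i))
      = (\<Prod>i\<in>set_mset \<gamma>. of_nat ((count \<gamma> i - k * count \<beta> i) choose count \<beta> i) :: rat)"
    proof (rule prod.cong)
      fix i
      have *: "count \<beta> i \<le> count \<gamma> i - k * count \<beta> i" using le[of i] by simp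
      have "count ?\<delta> i = count \<gamma> i - k * count \<beta> i - count \<beta> i" by simp
      with * show "fact (count (?\<delta> + \<beta>) i) / fact (count ?\<delta> i) / fact (count \<beta> i) = (of_nat ((count \<gamma> i - k * count \<beta> i) choose count \<beta> i) :: rat)"
        unfolding eq by (simp add: binomial_fact field_simps del: repeat_mset_Suc)
    qed simp
    finally show "D_rect k n (repeat_mset (k + 1) \<beta>) \<beta> * mono_times (repeat_mset (k + 1) \<beta>) (partials \<beta> f) \<gamma>
      = of_nat (\<Prod>i\<in>set_mset \<gamma>. (count \<gamma> i - k * count \<beta> i) choose count \<beta> i) * f (\<gamma> - repeat_mset k \<beta>)"
      by (simp only: eq of_nat_prod)
  qed simp
  also have "\<dots> = subst_coeff k n f \<gamma>"
    unfolding subst_coeff_def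
  \<comment> \<open>\<open>subst_coeff\<close> only asks for
    \<open>repeat_mset k \<beta> \<subseteq># \<gamma>\<close>. If the same fails for
    \<open>k + 1\<close>, some variable has an exponent
    \<open>count \<gamma> i - k * count \<beta> i\<close> smaller than
    \<open>count \<beta> i\<close>, and its binomial is 0.\<close>
  proof (rule sum.mono_neutral_left)
    show "finite {\<beta>. size \<beta> = n \<and> repeat_mset k \<beta> \<subseteq># \<gamma>}" by (rule finite_repeat_mset_subset[OF k])
    show "?B \<subseteq> {\<beta>. size \<beta> = n \<and> repeat_mset k \<beta> \<subseteq># \<gamma>}"
      by (auto simp: subseteq_mset_def intro: order.trans[rotated])
    show "\<forall>\<beta>\<in>{\<beta>. size \<beta> = n \<and> repeat_mset k \<beta> \<subseteq># \<gamma>} - ?B.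
      of_nat (\<Prod>i\<in>set_mset \<gamma>. (count \<gamma> i - k * count \<beta> i) choose count \<beta> i) * f (\<gamma> - repeat_mset k \<beta>) = 0"
    proof
      fix \<beta> assume "\<beta> \<in> {\<beta>. size \<beta> = n \<and> repeat_mset k \<beta> \<subseteq># \<gamma>} - ?B"
      then have le: "\<forall>i. k * count \<beta> i \<le> count \<gamma> i" and "\<exists>i. \<not> count \<beta> i + k * count \<beta> i \<le> count \<gamma> i"
        by (auto simp: subseteq_mset_def)
      then obtain i where "\<not> count \<beta> i + k * count \<beta> i \<le> count \<gamma> i" by auto
      with le have i: "count \<gamma> i - k * count \<beta> i < count \<beta> i" by (simp add: not_le less_diff_conv2)
      have "count \<gamma> i \<noteq> 0"
      proof
        assume "count \<gamma> i = 0"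
        with le k have "count \<beta> i = 0" by (metis le_zero_eq mult_is_0 not_one_le_zero)
        with i show False by simp
      qed
      then have "i \<in># \<gamma>" by (metis count_inI)
      with i have "(\<Prod>i\<in>set_mset \<gamma>. (count \<gamma> i - k * count \<beta> i) choose count \<beta> i) = 0"
        by (auto simp: prod_zero_iff binomial_eq_0 intro!: bexI[of _ i])
      then show "of_nat (\<Prod>i\<in>set_mset \<gamma>. (count \<gamma> i - k * count \<beta> i) choose count \<beta> i) * f (\<gamma> - repeat_mset k \<beta>) = 0"
        by simp
    qed
  qed
  finally show "apply_op (D_rect k n) f \<gamma> = subst_coeff k n f \<gamma>" .
qed

section \<open>Chains\<close>

lemma diagram_inject:
  assumes "is_partition lam" "is_partition mu" "diagram lam = diagram mu"
  shows "lam = mu"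
proof -
  have row: "{j. (i, j) \<in> diagram p} = (if i < length p then {..<p ! i} else {})" for p i
    by (auto simp: diagram_def)
  have pos: "p ! i \<noteq> 0" if "is_partition p" "i < length p" for p i
    using that unfolding is_partition_def by (metis nth_mem)
  have le: "i < length q" if "is_partition p" "diagram p = diagram q" "i < length p" for p q i
  proof (rule ccontr)
    assume "\<not> i < length q"
    moreover have "(i, 0) \<in> diagram p" using pos[OF that(1,3)] that(3) by (simp add: diagram_def)
    ultimately show False unfolding that(2) by (simp add: diagram_def)
  qed
  have l: "length lam = length mu"
    using le[OF assms(1,3), of "length mu"] le[OF assms(2) assms(3)[symmetric], of "length lam"] by linarith
  show ?thesis
  proof (rule nth_equalityI[OF l])
    fix i assume i: "i < length lam"
    have "{j. (i, j) \<in> diagram lam} = {j. (i, j) \<in> diagram mu}" by (simp only: assms(3))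
    then show "lam ! i = mu ! i" using i l by (simp add: row)
  qed
qed

lemma card_skew:
  assumes "diagram lam \<subseteq> diagram mu"
  shows "card (skew lam mu) = psize mu - psize lam" "psize lam \<le> psize mu"
  unfolding skew_def card_diagram[symmetric]
  by (rule card_Diff_subset[OF finite_diagram assms], rule card_mono[OF finite_diagram assms])

lemma chains_diagram_mono:
  assumes "c \<in> chains k lam mu"
  shows "diagram lam \<subseteq> diagram mu" "k dvd psize mu - psize lam" "length c > 1 \<Longrightarrow> diagram lam \<subset> diagram mu"
proof -
  have "diagram (hd c) \<subseteq> diagram (last c) \<and> k dvd psize (last c) - psize (hd c) \<and>
      (length c > 1 \<longrightarrow> diagram (hd c) \<subset> diagram (last c))" if "successively (chain_step k) c" "c \<noteq> []" for c
    using that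
  proof (induction c rule: induct_list012)
    case (3 x y zs)
    then have step: "chain_step k x y" and IH: "diagram y \<subseteq> diagram (last (y # zs))" "k dvd psize (last (y # zs)) - psize y"
      by auto
    from step have sub: "diagram x \<subset> diagram y" by (simp add: chain_step_def)
    from step have "k dvd psize y - psize x"
      by (auto simp: chain_step_def card_skew)
    moreover have "psize (last (y # zs)) - psize x = (psize (last (y # zs)) - psize y) + (psize y - psize x)"
      using card_skew(2)[OF IH(1)] card_skew(2)[of x y] sub by auto
    ultimately show ?case using IH sub by (auto simp del: last.simps simp: last_ConsR)
  qed auto
  from this[of c] assms
  show "diagram lam \<subseteq> diagram mu" "k dvd psize mu - psize lam" "length c > 1 \<Longrightarrow> diagram lam \<subset> diagram mu"
    by (auto simp: chains_def)
qed

lemma a_coeff_nonzero: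
  assumes "a_coeff k lam mu \<noteq> 0"
  shows "diagram lam \<subseteq> diagram mu" "k dvd psize mu - psize lam"
proof -
  from assms obtain c where "c \<in> chains k lam mu"
    unfolding a_coeff_def by (rule sum.not_neutral_contains_not_neutral)
  then show "diagram lam \<subseteq> diagram mu" "k dvd psize mu - psize lam"
    by (rule chains_diagram_mono)+
qed

lemma a_coeff_refl:
  assumes "is_partition lam"
  shows "a_coeff k lam lam = 1"
proof -
  have "chains k lam lam = {[lam]}"
  proof (intro equalityI subsetI)
    fix c assume c: "c \<in> chains k lam lam"
    then have "\<not> length c > 1" using chains_diagram_mono(3) by blast
    with c show "c \<in> {[lam]}" by (cases c) (auto simp: chains_def)
  qed (use assms in \<open>auto simp: chains_def\<close>)
  then show ?thesis by (simp add: a_coeff_def)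
qed

lemma finite_chain_step: "finite {nu. is_partition nu \<and> chain_step k nu mu}"
  by (rule finite_subset[OF _ finite_partitions[of "psize mu"]])
    (auto simp: chain_step_def intro: card_skew(2))

text \<open>It matters that the last step is removed and not the first: the denominators in
  \<open>f_coeff\<close> refer to the start \<open>lam\<close> of the whole chain, so only an
  initial segment of a chain keeps its weights.\<close>

lemma a_coeff_rec:
  assumes "is_partition mu" "lam \<noteq> mu"
  shows "a_coeff k lam mu = (\<Sum>nu | is_partition nu \<and> chain_step k nu mu. a_coeff k lam nu * f_coeff k lam nu mu)"
proof -
  let ?S = "Sigma {nu. is_partition nu \<and> chain_step k nu mu} (chains k lam)"
  have "a_coeff k lam mu = (\<Sum>(nu, c)\<in>?S. (\<Prod>i<length c - 1. f_coeff k lam (c ! i) (c ! Suc i)) * f_coeff k lam nu mu)"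
    unfolding a_coeff_def
  proof (rule sum.reindex_bij_witness[where i = "\<lambda>(nu, c). c @ [mu]" and j = "\<lambda>c. (last (butlast c), butlast c)"])
    fix c assume c: "c \<in> chains k lam mu"
    then have c': "c = butlast c @ [mu]" by (auto simp: chains_def append_butlast_last_id)
    have ne: "butlast c \<noteq> []"
    proof
      assume "butlast c = []"
      with c' have "c = [mu]" by simp
      with c assms(2) show False by (simp add: chains_def)
    qed
    obtain d where d: "c = d @ [mu]" "d \<noteq> []" using c' ne by blast
    show "(case (last (butlast c), butlast c) of (nu, c) \<Rightarrow> c @ [mu]) = c" by (simp add: d)
    show "(last (butlast c), butlast c) \<in> ?S"
      using c by (auto simp: d chains_def successively_append_iff)
    have "(\<Prod>i<length c - 1. f_coeff k lam (c ! i) (c ! Suc i))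
      = (\<Prod>i<length d - 1. f_coeff k lam (c ! i) (c ! Suc i)) * f_coeff k lam (c ! (length d - 1)) (c ! length d)"
      using d(2) by (cases "length d") (auto simp: d(1))
    also have "(\<Prod>i<length d - 1. f_coeff k lam (c ! i) (c ! Suc i)) = (\<Prod>i<length d - 1. f_coeff k lam (d ! i) (d ! Suc i))"
      by (rule prod.cong) (auto simp: d(1) nth_append)
    also have "c ! (length d - 1) = last d" using d(2) by (simp add: d(1) nth_append last_conv_nth)
    finally show "(case (last (butlast c), butlast c) of (nu, c) \<Rightarrow>
      (\<Prod>i<length c - 1. f_coeff k lam (c ! i) (c ! Suc i)) * f_coeff k lam nu mu) = (\<Prod>i<length c - 1. f_coeff k lam (c ! i) (c ! Suc i))"
      by (simp add: d(1))
  next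
    fix x assume "x \<in> ?S"
    then obtain nu c where x: "x = (nu, c)" "is_partition nu" "chain_step k nu mu" "c \<in> chains k lam nu" by auto
    then show "(last (butlast (case x of (nu, c) \<Rightarrow> c @ [mu])), butlast (case x of (nu, c) \<Rightarrow> c @ [mu])) = x"
      by (simp add: chains_def)
    show "(case x of (nu, c) \<Rightarrow> c @ [mu]) \<in> chains k lam mu"
      using x assms(1) by (auto simp: chains_def successively_append_iff)
  qed
  also have "\<dots> = (\<Sum>nu | is_partition nu \<and> chain_step k nu mu. a_coeff k lam nu * f_coeff k lam nu mu)"
    by (subst sum.Sigma[symmetric])
      (auto simp: finite_chain_step finite_chains a_coeff_def sum_distrib_right)
  finally show ?thesis .
qed

text \<open>Through the default value 0 of \<open>d_coeff\<close>, a sum over all intermediate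
  partitions can be cut down to those that form a \<open>chain_step\<close>.\<close>

lemma d_coeff_nonzero:
  assumes "d_coeff lam mu \<noteq> 0"
  shows "broken_border_strip (skew lam mu)" "card (components (skew lam mu)) \<le> 2"
  using assms by (auto simp: d_coeff_def Let_def border_strip_def split: if_splits)

lemma subst_coeff_1_sum:
  assumes "r \<ge> 1"
  shows "subst_coeff r 1 (\<lambda>\<alpha>. \<Sum>x\<in>A. c x * g x \<alpha>) \<gamma> = (\<Sum>x\<in>A. c x * subst_coeff r 1 (g x) \<gamma>)"
proof -
  have "subst_coeff r 1 (\<lambda>\<alpha>. \<Sum>x\<in>A. c x * g x \<alpha>) \<gamma> = (\<Sum>i | r \<le> count \<gamma> i. \<Sum>x\<in>A.
      c x * (of_nat (count \<gamma> i - r) * g x (\<gamma> - replicate_mset r i)))"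
    unfolding subst_coeff_1[OF assms] by (simp add: sum_distrib_left mult.left_commute)
  also have "\<dots> = (\<Sum>x\<in>A. c x * subst_coeff r 1 (g x) \<gamma>)"
    unfolding subst_coeff_1[OF assms] by (subst sum.swap) (simp add: sum_distrib_left)
  finally show ?thesis .
qed

definition extensions :: "nat list \<Rightarrow> nat \<Rightarrow> nat list set" where
  "extensions lam r = {mu. is_partition mu \<and> diagram lam \<subseteq> diagram mu \<and> psize mu = psize lam + r}"

lemma finite_extensions: "finite (extensions lam r)"
  by (rule finite_subset[OF _ finite_partitions[of "psize lam + r"]]) (auto simp: extensions_def)

text \<open>Strong induction, since \<open>subst_coeff_rec\<close> reaches back to all smaller
  \<open>n\<close>. The coefficient of \<open>schur mu\<close> is collected over the last
  intermediate partition \<open>nu\<close>, whose size determines \<open>m\<close>; what results is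
  \<open>a_coeff_rec\<close> multiplied by \<open>n\<close>.\<close>

lemma subst_coeff_schur:
  assumes D: "\<And>r nu \<gamma>. r \<ge> 1 \<Longrightarrow> is_partition nu \<Longrightarrow>
      subst_coeff r 1 (schur nu) \<gamma> = (\<Sum>mu\<in>extensions nu r. of_int (d_coeff nu mu) * schur mu \<gamma>)"
    and k: "k \<ge> 1" and lam: "is_partition lam"
  shows "subst_coeff k n (schur lam) \<gamma> = (\<Sum>mu\<in>extensions lam (k * n). a_coeff k lam mu * schur mu \<gamma>)"
proof (induction n arbitrary: \<gamma> rule: less_induct)
  case (less n)
  show ?case
  proof (cases "n = 0")
    case True
    have "extensions lam 0 = {lam}"
    proof (intro equalityI subsetI)
      fix mu assume "mu \<in> extensions lam 0"
      then have mu: "is_partition mu" "diagram lam \<subseteq> diagram mu" "card (diagram lam) = card (diagram mu)"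
        by (auto simp: extensions_def card_diagram)
      then have "diagram lam = diagram mu" by (intro card_subset_eq finite_diagram)
      then show "mu \<in> {lam}" using diagram_inject[OF lam mu(1)] by simp
    qed (use lam in \<open>simp add: extensions_def\<close>)
    then show ?thesis by (simp add: True subst_coeff_0[OF k] a_coeff_refl[OF lam])
  next
    case False
    let ?q = "- of_nat k - 1 :: rat"
    let ?U = "\<lambda>mu m. {nu \<in> extensions lam (k * (n - 1 - m)). diagram nu \<subseteq> diagram mu}"
    have finU: "finite (?U mu m)" for mu m by (simp add: finite_extensions)
    have inner: "(\<Sum>m<n. \<Sum>nu\<in>?U mu m. ?q ^ m * a_coeff k lam nu * of_int (d_coeff nu mu)) = of_nat n * a_coeff k lam mu"
      if mu: "mu \<in> extensions lam (k * n)" for mu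
    proof -
      have mu': "is_partition mu" "psize mu = psize lam + k * n" using mu by (auto simp: extensions_def)
      then have "lam \<noteq> mu" using False k by auto
      let ?g = "\<lambda>nu. of_nat n * (a_coeff k lam nu * f_coeff k lam nu mu)"
      have U_size: "psize mu - psize nu = k * (m + 1)" if "nu \<in> ?U mu m" "m < n" for nu m
      proof -
        have "k * n = k * (n - 1 - m) + k * (m + 1)"
          unfolding distrib_left[symmetric] using that(2) by simp
        then show ?thesis using that(1) mu' by (simp add: extensions_def)
      qed
      have "(\<Sum>m<n. \<Sum>nu\<in>?U mu m. ?q ^ m * a_coeff k lam nu * of_int (d_coeff nu mu)) = (\<Sum>m<n. \<Sum>nu\<in>?U mu m. ?g nu)"
      proof (intro sum.cong refl)
        fix m nu assume "m \<in> {..<n}" and nu: "nu \<in> ?U mu m"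
        then have m: "m < n" by simp
        from U_size[OF nu m] have "(psize mu - psize nu) div k - 1 = m"
          using k by simp
        \<comment> \<open>Since \<open>mu\<close> has \<open>k n\<close> boxes more than
          \<open>lam\<close>, the denominator cancels the \<open>k\<close> in the numerator and
          leaves the division by \<open>n\<close> of the recursion.\<close>
        then have "f_coeff k lam nu mu = of_nat k * ?q ^ m / (of_nat k * of_nat n) * of_int (d_coeff nu mu)"
          by (simp add: f_coeff_def mu')
        then show "?q ^ m * a_coeff k lam nu * of_int (d_coeff nu mu) = ?g nu"
          using k False by simp
      qed
      also have "\<dots> = (\<Sum>nu\<in>(\<Union>m<n. ?U mu m). ?g nu)"
      proof (rule sum.UNION_disjoint[symmetric])
        show "\<forall>i\<in>{..<n}. \<forall>j\<in>{..<n}. i \<noteq> j \<longrightarrow> ?U mu i \<inter> ?U mu j = {}"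
        proof (intro ballI impI equals0I)
          fix i j nu assume ij: "i \<in> {..<n}" "j \<in> {..<n}" "i \<noteq> j" and nu: "nu \<in> ?U mu i \<inter> ?U mu j"
          have "psize mu - psize nu = k * (i + 1)" by (rule U_size) (use ij nu in auto)
          moreover have "psize mu - psize nu = k * (j + 1)" by (rule U_size) (use ij nu in auto)
          ultimately have "k * (i + 1) = k * (j + 1)" by (rule trans[OF sym])
          with k ij show False by simp
        qed
      qed (simp_all add: finite_extensions)
      \<comment> \<open>The two index sets agree up to zero terms: a \<open>nu\<close> without
        \<open>chain_step\<close> has \<open>d_coeff nu mu = 0\<close>, and a
        \<open>chain_step\<close> from a \<open>nu\<close> outside the union has
        \<open>a_coeff k lam nu = 0\<close>, because every \<open>nu\<close> reached by a chain from
        \<open>lam\<close> has an admissible size.\<close>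
      also have "\<dots> = (\<Sum>nu\<in>(\<Union>m<n. ?U mu m) \<inter> {nu. is_partition nu \<and> chain_step k nu mu}. ?g nu)"
      proof (rule sum.mono_neutral_right)
        show "\<forall>nu\<in>(\<Union>m<n. ?U mu m) - (\<Union>m<n. ?U mu m) \<inter> {nu. is_partition nu \<and> chain_step k nu mu}. ?g nu = 0"
        proof
          fix nu assume nu: "nu \<in> (\<Union>m<n. ?U mu m) - (\<Union>m<n. ?U mu m) \<inter> {nu. is_partition nu \<and> chain_step k nu mu}"
          then obtain m where m: "m < n" "nu \<in> ?U mu m" by auto
          then have nu': "is_partition nu" "diagram nu \<subseteq> diagram mu" by (auto simp: extensions_def)
          then have "\<not> chain_step k nu mu" using nu m by blast
          moreover have "card (skew nu mu) = k * (m + 1)"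
            using card_skew(1)[OF nu'(2)] U_size[OF m(2,1)] by simp
          moreover have "diagram nu \<noteq> diagram mu"
          proof
            assume "diagram nu = diagram mu"
            then have "psize nu = psize mu" by (metis card_diagram)
            then show False using U_size[OF m(2,1)] k by simp
          qed
          ultimately have "d_coeff nu mu = 0"
            using d_coeff_nonzero[of nu mu] nu' by (auto simp: chain_step_def)
          then show "?g nu = 0" by (simp add: f_coeff_def)
        qed
      qed (auto simp: finite_extensions)
      also have "\<dots> = (\<Sum>nu | is_partition nu \<and> chain_step k nu mu. ?g nu)"
      proof (rule sum.mono_neutral_left)
        show "\<forall>nu\<in>{nu. is_partition nu \<and> chain_step k nu mu} - (\<Union>m<n. ?U mu m) \<inter> {nu. is_partition nu \<and> chain_step k nu mu}. ?g nu = 0"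
        proof
          fix nu assume nu: "nu \<in> {nu. is_partition nu \<and> chain_step k nu mu} - (\<Union>m<n. ?U mu m) \<inter> {nu. is_partition nu \<and> chain_step k nu mu}"
          then have nu': "is_partition nu" "diagram nu \<subset> diagram mu" and notin: "\<And>m. m < n \<Longrightarrow> nu \<notin> ?U mu m"
            by (auto simp: chain_step_def)
          have "a_coeff k lam nu = 0"
          proof (rule ccontr)
            assume "a_coeff k lam nu \<noteq> 0"
            note a = a_coeff_nonzero[OF this]
            from a(2) obtain l where l: "psize nu - psize lam = k * l" by blast
            then have l': "psize nu = psize lam + k * l" using card_skew(2)[OF a(1)] by simp
            have "card (diagram nu) < card (diagram mu)" using nu'(2) by (intro psubset_card_mono finite_diagram)
            then have "l < n" using l' mu' by (simp add: card_diagram)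
            then have "n - 1 - l < n" "n - 1 - (n - 1 - l) = l" by auto
            with notin[of "n - 1 - l"] a(1) l' nu' show False by (auto simp: extensions_def)
          qed
          then show "?g nu = 0" by simp
        qed
      qed (auto simp: finite_chain_step)
      also have "\<dots> = of_nat n * a_coeff k lam mu"
        by (simp add: a_coeff_rec[OF mu'(1) \<open>lam \<noteq> mu\<close>] sum_distrib_left)
      finally show ?thesis .
    qed
    have "of_nat n * subst_coeff k n (schur lam) \<gamma> =
      (\<Sum>m<n. ?q ^ m * subst_coeff (k * (m + 1)) 1 (subst_coeff k (n - 1 - m) (schur lam)) \<gamma>)"
      by (rule subst_coeff_rec[OF k])
    also have "\<dots> = (\<Sum>m<n. \<Sum>nu\<in>extensions lam (k * (n - 1 - m)). \<Sum>mu\<in>extensions nu (k * (m + 1)).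
        ?q ^ m * a_coeff k lam nu * of_int (d_coeff nu mu) * schur mu \<gamma>)"
    proof (rule sum.cong)
      fix m assume "m \<in> {..<n}"
      then have "subst_coeff k (n - 1 - m) (schur lam) = (\<lambda>\<gamma>. \<Sum>nu\<in>extensions lam (k * (n - 1 - m)). a_coeff k lam nu * schur nu \<gamma>)"
        using less.IH by (intro ext) auto
      moreover have r: "k * (m + 1) \<ge> 1" using k by simp
      ultimately have "subst_coeff (k * (m + 1)) 1 (subst_coeff k (n - 1 - m) (schur lam)) \<gamma>
        = (\<Sum>nu\<in>extensions lam (k * (n - 1 - m)). a_coeff k lam nu * subst_coeff (k * (m + 1)) 1 (schur nu) \<gamma>)"
        by (simp only: subst_coeff_1_sum)
      also have "\<dots> = (\<Sum>nu\<in>extensions lam (k * (n - 1 - m)). a_coeff k lam nu *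
          (\<Sum>mu\<in>extensions nu (k * (m + 1)). of_int (d_coeff nu mu) * schur mu \<gamma>))"
        by (intro sum.cong refl arg_cong2[of _ _ _ _ "(*)"] D[OF r]) (simp add: extensions_def)
      finally show "?q ^ m * subst_coeff (k * (m + 1)) 1 (subst_coeff k (n - 1 - m) (schur lam)) \<gamma> = (\<Sum>nu\<in>extensions lam (k * (n - 1 - m)).
          \<Sum>mu\<in>extensions nu (k * (m + 1)). ?q ^ m * a_coeff k lam nu * of_int (d_coeff nu mu) * schur mu \<gamma>)"
        by (simp only: sum_distrib_left mult.assoc)
    qed simp
    also have "\<dots> = (\<Sum>m<n. \<Sum>mu\<in>extensions lam (k * n). \<Sum>nu\<in>?U mu m.
        ?q ^ m * a_coeff k lam nu * of_int (d_coeff nu mu) * schur mu \<gamma>)"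
    proof (rule sum.cong)
      fix m assume "m \<in> {..<n}"
      then have kn: "k * n = k * (n - 1 - m) + k * (m + 1)"
        unfolding distrib_left[symmetric] by simp
      let ?h = "\<lambda>nu mu. ?q ^ m * a_coeff k lam nu * of_int (d_coeff nu mu) * schur mu \<gamma>"
      let ?E = "extensions lam (k * (n - 1 - m))"
      have E: "extensions nu (k * (m + 1)) = {mu \<in> extensions lam (k * n). diagram nu \<subseteq> diagram mu}"
        if "nu \<in> ?E" for nu
        using that kn by (auto simp: extensions_def)
      have "(\<Sum>nu\<in>?E. \<Sum>mu\<in>extensions nu (k * (m + 1)). ?h nu mu) =
        (\<Sum>nu\<in>?E. \<Sum>mu | mu \<in> extensions lam (k * n) \<and> diagram nu \<subseteq> diagram mu. ?h nu mu)"
        by (intro sum.cong refl E)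
      also have "\<dots> = (\<Sum>mu\<in>extensions lam (k * n). \<Sum>nu\<in>?U mu m. ?h nu mu)"
        by (rule sum.swap_restrict) (simp_all add: finite_extensions)
      finally show "(\<Sum>nu\<in>?E. \<Sum>mu\<in>extensions nu (k * (m + 1)). ?h nu mu) =
        (\<Sum>mu\<in>extensions lam (k * n). \<Sum>nu\<in>?U mu m. ?h nu mu)" .
    qed simp
    also have "\<dots> = (\<Sum>mu\<in>extensions lam (k * n). (\<Sum>m<n. \<Sum>nu\<in>?U mu m.
        ?q ^ m * a_coeff k lam nu * of_int (d_coeff nu mu)) * schur mu \<gamma>)"
      by (subst sum.swap) (simp only: sum_distrib_right)
    also have "\<dots> = of_nat n * (\<Sum>mu\<in>extensions lam (k * n). a_coeff k lam mu * schur mu \<gamma>)"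
      unfolding sum_distrib_left by (intro sum.cong refl) (simp only: inner mult.assoc[symmetric])
    finally show ?thesis using False by simp
  qed
qed

section \<open>Alternants and Schur functions\<close>

text \<open>The ring is arbitrary because the variables are specialised both to rational numbers and
  to the polynomials \<open>flow r x\<close>, along which alternants are differentiated.\<close>

definition alternant :: "nat \<Rightarrow> (nat \<Rightarrow> nat) \<Rightarrow> (nat \<Rightarrow> 'a :: comm_ring_1) \<Rightarrow> 'a" where
  "alternant N e x = det (mat N N (\<lambda>(i, j). x j ^ e i))"

lemma alternant_altdef:
  "alternant N e x = (\<Sum>p | p permutes {0..<N}. signof p * (\<Prod>i=0..<N. x (p i) ^ e i))"
proof -
  have "(\<Prod>i=0..<N. mat N N (\<lambda>(i, j). x j ^ e i) $$ (i, p i)) = (\<Prod>i=0..<N. x (p i) ^ e i)"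
    if "p permutes {0..<N}" for p
    using permutes_in_image[OF that] by (intro prod.cong) auto
  then show ?thesis
    unfolding alternant_def by (subst det_def'[of _ N]) auto
qed

lemma alternant_cong:
  "(\<And>i. i < N \<Longrightarrow> e i = e' i) \<Longrightarrow> alternant N e x = alternant N e' x"
  by (simp add: alternant_altdef)

lemma alternant_permute:
  assumes "q permutes {0..<N}"
  shows "alternant N (e \<circ> q) x = signof q * alternant N e x"
proof -
  have "mat N N (\<lambda>(i, j). mat N N (\<lambda>(i, j). x j ^ e i) $$ (q i, j)) = mat N N (\<lambda>(i, j). x j ^ (e \<circ> q) i)"
    using permutes_in_image[OF assms] by (intro eq_matI) auto
  then show ?thesis
    using det_permute_rows[OF _ assms, of "mat N N (\<lambda>(i, j). x j ^ e i)"]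
    by (simp add: alternant_def)
qed

lemma alternant_repeated:
  assumes "i < N" "j < N" "i \<noteq> j" "e i = e j"
  shows "alternant N e x = 0"
  unfolding alternant_def
  by (rule det_identical_rows[where n = N, OF _ assms(3,1,2)]) (use assms in \<open>auto intro!: eq_vecI\<close>)

text \<open>A geometric sum multiplied by \<open>x ^ c\<close>. The powers of \<open>x\<close> run
  through the interval from \<open>c\<close> to \<open>d - 1\<close>; in
  \<open>alternant_Suc\<close> these become the exponents of the smaller alternant.\<close>

lemma power_diff_interval:
  fixes x y :: "'a :: comm_ring_1"
  assumes "c \<le> d"
  shows "x ^ d - y ^ (d - c) * x ^ c = (x - y) * (\<Sum>b=c..<d. x ^ b * y ^ (d - 1 - b))"
  using assms
proof (induction d rule: dec_induct)
  case (step d)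
  have "(\<Sum>b=c..<Suc d. x ^ b * y ^ (Suc d - 1 - b)) = (\<Sum>b=c..<d. x ^ b * y ^ (Suc d - 1 - b)) + x ^ d"
    using step.hyps by simp
  also have "(\<Sum>b=c..<d. x ^ b * y ^ (Suc d - 1 - b)) = y * (\<Sum>b=c..<d. x ^ b * y ^ (d - 1 - b))"
    unfolding sum_distrib_left
  proof (rule sum.cong)
    fix b assume "b \<in> {c..<d}"
    then have "Suc d - 1 - b = Suc (d - 1 - b)" by auto
    then show "x ^ b * y ^ (Suc d - 1 - b) = y * (x ^ b * y ^ (d - 1 - b))"
      by (simp only: power_Suc mult.left_commute)
  qed simp
  finally have "(x - y) * (\<Sum>b=c..<Suc d. x ^ b * y ^ (Suc d - 1 - b))
      = y * ((x - y) * (\<Sum>b=c..<d. x ^ b * y ^ (d - 1 - b))) + (x - y) * x ^ d"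
    by (simp add: algebra_simps)
  also have "\<dots> = y * (x ^ d - y ^ (d - c) * x ^ c) + (x - y) * x ^ d"
    by (simp only: step.IH)
  also have "\<dots> = x ^ Suc d - y ^ (Suc d - c) * x ^ c"
    using step.hyps by (simp add: Suc_diff_le algebra_simps)
  finally show ?case by simp
qed simp

text \<open>The branching rule for alternants. Subtracting from each row a multiple of the next one,
  which is multiplication by the unitriangular \<open>L\<close>, clears the last column except for
  its bottom entry. In the remaining minor \<open>x j - x N\<close> splits off every column, and
  each row is left with a geometric sum whose expansion chooses one exponent \<open>b i\<close> from
  the gap between \<open>e (Suc i)\<close> and \<open>e i\<close>.\<close>

lemma alternant_Suc:
  assumes dec: "\<And>i. i < N \<Longrightarrow> e (Suc i) \<le> e i"
  shows "alternant (Suc N) e x = (\<Prod>j<N. x j - x N) *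
    (\<Sum>b\<in>PiE {0..<N} (\<lambda>i. {e (Suc i)..<e i}). x N ^ e N * (\<Prod>i=0..<N. x N ^ (e i - 1 - b i)) * alternant N b x)"
proof -
  let ?n = "Suc N"
  define A where "A = mat ?n ?n (\<lambda>(i, j). x j ^ e i)"
  define L where "L = mat ?n ?n (\<lambda>(i, j). if i = j then 1 else if j = Suc i then - (x N ^ (e i - e (Suc i))) else 0)"
  define B where "B = mat ?n ?n (\<lambda>(i, j). x j ^ e i - (if i < N then x N ^ (e i - e (Suc i)) * x j ^ e (Suc i) else 0))"
  have [simp]: "A \<in> carrier_mat ?n ?n" "L \<in> carrier_mat ?n ?n" "B \<in> carrier_mat ?n ?n"
    by (auto simp: A_def L_def B_def)
  have "L * A = B"
  proof (rule eq_matI)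
    fix i j assume ij: "i < dim_row B" "j < dim_col B"
    then have "(L * A) $$ (i, j) = (\<Sum>l=0..<?n. (if i = l then 1 else if l = Suc i then - (x N ^ (e i - e (Suc i))) else 0) * x j ^ e l)"
      by (simp add: A_def L_def B_def scalar_prod_def)
    also have "\<dots> = (\<Sum>l=0..<?n. (if l = i then x j ^ e l else 0) + (if l = Suc i then - (x N ^ (e i - e (Suc i))) * x j ^ e l else 0))"
      by (rule sum.cong) auto
    also have "\<dots> = B $$ (i, j)"
      using ij by (cases "i = N") (auto simp: sum.distrib B_def)
    finally show "(L * A) $$ (i, j) = B $$ (i, j)" .
  qed (auto simp: A_def L_def B_def)
  moreover have "det L = 1"
  proof -
    have "upper_triangular L" by (auto simp: upper_triangular_def L_def)
    then have "det L = prod_list (diag_mat L)" by (rule det_upper_triangular[of _ ?n]) simp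
    also have "diag_mat L = map (\<lambda>_. 1) [0..<?n]"
      by (auto simp: diag_mat_def L_def simp del: upt_Suc)
    also have "prod_list (map (\<lambda>_. 1) xs) = (1 :: 'a)" for xs :: "nat list" by (induction xs) auto
    finally show ?thesis .
  qed
  ultimately have "det A = det B" using det_mult[of L ?n A] by simp
  also have "det B = (\<Sum>i<?n. B $$ (i, N) * cofactor B i N)"
    by (rule laplace_expansion_column) auto
  also have "\<dots> = B $$ (N, N) * cofactor B N N + (\<Sum>i<N. B $$ (i, N) * cofactor B i N)"
    by simp
  also have "(\<Sum>i<N. B $$ (i, N) * cofactor B i N) = 0"
    by (rule sum.neutral) (use dec in \<open>auto simp: B_def simp flip: power_add\<close>)
  also have "B $$ (N, N) = x N ^ e N" by (simp add: B_def)
  also have "cofactor B N N = det (mat_delete B N N)" by (simp add: cofactor_def)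
  also have "mat_delete B N N = mat N N (\<lambda>(i, j). (x j - x N) * (\<Sum>b=e (Suc i)..<e i. x j ^ b * x N ^ (e i - 1 - b)))"
    by (intro eq_matI) (auto simp: mat_delete_def B_def power_diff_interval[OF dec])
  also have "det \<dots> = (\<Sum>p | p permutes {0..<N}. signof p * (\<Prod>i=0..<N. (x (p i) - x N) * (\<Sum>b=e (Suc i)..<e i. x (p i) ^ b * x N ^ (e i - 1 - b))))"
  proof -
    have "(\<Prod>i=0..<N. mat N N (\<lambda>(i, j). (x j - x N) * (\<Sum>b=e (Suc i)..<e i. x j ^ b * x N ^ (e i - 1 - b))) $$ (i, p i))
      = (\<Prod>i=0..<N. (x (p i) - x N) * (\<Sum>b=e (Suc i)..<e i. x (p i) ^ b * x N ^ (e i - 1 - b)))"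
      if "p permutes {0..<N}" for p
      using permutes_in_image[OF that] by (intro prod.cong) auto
    then show ?thesis by (subst det_def'[of _ N]) auto
  qed
  also have "\<dots> = (\<Sum>p | p permutes {0..<N}. (\<Prod>j<N. x j - x N) * (\<Sum>b\<in>PiE {0..<N} (\<lambda>i. {e (Suc i)..<e i}).
      (\<Prod>i=0..<N. x N ^ (e i - 1 - b i)) * (signof p * (\<Prod>i=0..<N. x (p i) ^ b i))))"
  proof (rule sum.cong)
    fix p assume "p \<in> {p. p permutes {0..<N}}"
    then have p: "p permutes {0..<N}" by simp
    have "(\<Prod>i=0..<N. x (p i) - x N) = (\<Prod>j=0..<N. x j - x N)"
      by (rule prod.permute[OF p, symmetric, unfolded o_def])
    moreover have "(\<Prod>i=0..<N. \<Sum>b=e (Suc i)..<e i. x (p i) ^ b * x N ^ (e i - 1 - b))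
      = (\<Sum>b\<in>PiE {0..<N} (\<lambda>i. {e (Suc i)..<e i}). \<Prod>i=0..<N. x (p i) ^ b i * x N ^ (e i - 1 - b i))"
      by (rule prod_sum_PiE) auto
    ultimately have "(\<Prod>i=0..<N. (x (p i) - x N) * (\<Sum>b=e (Suc i)..<e i. x (p i) ^ b * x N ^ (e i - 1 - b)))
      = (\<Prod>j<N. x j - x N) * (\<Sum>b\<in>PiE {0..<N} (\<lambda>i. {e (Suc i)..<e i}). \<Prod>i=0..<N. x (p i) ^ b i * x N ^ (e i - 1 - b i))"
      by (simp only: prod.distrib[of "\<lambda>i. x (p i) - x N"] lessThan_atLeast0)
    then show "signof p * (\<Prod>i=0..<N. (x (p i) - x N) * (\<Sum>b=e (Suc i)..<e i. x (p i) ^ b * x N ^ (e i - 1 - b)))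
      = (\<Prod>j<N. x j - x N) * (\<Sum>b\<in>PiE {0..<N} (\<lambda>i. {e (Suc i)..<e i}).
      (\<Prod>i=0..<N. x N ^ (e i - 1 - b i)) * (signof p * (\<Prod>i=0..<N. x (p i) ^ b i)))"
      by (simp only: sum_distrib_left prod.distrib mult_ac)
  qed simp
  also have "\<dots> = (\<Prod>j<N. x j - x N) * (\<Sum>b\<in>PiE {0..<N} (\<lambda>i. {e (Suc i)..<e i}).
      (\<Prod>i=0..<N. x N ^ (e i - 1 - b i)) * alternant N b x)"
    unfolding sum_distrib_left[symmetric] by (subst sum.swap) (simp only: sum_distrib_left[symmetric] alternant_altdef)
  finally show ?thesis
    by (simp add: alternant_def A_def sum_distrib_left mult_ac)
qed

definition delta :: "nat \<Rightarrow> nat \<Rightarrow> nat" where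
  "delta N i = N - 1 - i"

text \<open>For \<delta> every gap contains exactly one exponent, so the branching sum has a single
  term and the power of \<open>x N\<close> is trivial.\<close>

lemma alternant_delta_Suc:
  "alternant (Suc N) (delta (Suc N)) x = (\<Prod>j<N. x j - x N) * alternant N (delta N) x"
proof -
  have "PiE {0..<N} (\<lambda>i. {delta (Suc N) (Suc i)..<delta (Suc N) i}) = PiE {0..<N} (\<lambda>i. {delta N i})"
    by (rule PiE_cong) (auto simp: delta_def)
  also have "\<dots> = {restrict (delta N) {0..<N}}" by (subst PiE_eq_singleton) simp
  finally show ?thesis
    by (subst alternant_Suc)
      (auto simp: delta_def intro!: arg_cong2[of _ _ _ _ "(*)"] prod.neutral alternant_cong)
qed

section \<open>Schur polynomials and the bialternant formula\<close>

text \<open>Row lengths are given by a function on all rows, eventually 0, so that the row below is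
  always defined and row lengths can be added to \<open>delta N\<close> pointwise.\<close>

definition shape :: "(nat \<Rightarrow> nat) \<Rightarrow> box set" where
  "shape l = {(i, j). j < l i}"

definition tableaux :: "nat \<Rightarrow> (nat \<Rightarrow> nat) \<Rightarrow> (box \<Rightarrow> nat) set" where
  "tableaux N l = {T \<in> shape l \<rightarrow>\<^sub>E {..<N}. semistandard (shape l) T}"

definition tableaux_sum :: "nat \<Rightarrow> (nat \<Rightarrow> nat) \<Rightarrow> (nat \<Rightarrow> 'a :: comm_ring_1) \<Rightarrow> 'a" where
  "tableaux_sum N l x = (\<Sum>T\<in>tableaux N l. \<Prod>b\<in>shape l. x (T b))"

lemma shape_eq_Sigma:
  assumes "\<And>i. i \<ge> N \<Longrightarrow> l i = 0"
  shows "shape l = (SIGMA i:{..<N}. {..<l i})"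
  using assms by (auto simp: shape_def) (metis not_less not_less0)

lemma finite_shape:
  assumes "\<And>i. i \<ge> N \<Longrightarrow> l i = 0"
  shows "finite (shape l)"
  using shape_eq_Sigma[OF assms] by simp

lemma card_shape:
  assumes "\<And>i. i \<ge> N \<Longrightarrow> l i = 0"
  shows "card (shape l) = (\<Sum>i<N. l i)"
  using shape_eq_Sigma[OF assms] by simp

lemma finite_tableaux:
  assumes "finite (shape l)"
  shows "finite (tableaux N l)"
  unfolding tableaux_def by (rule finite_Collect_conjI) (use assms in \<open>auto intro!: finite_PiE\<close>)

lemma tableau_less:
  assumes "T \<in> tableaux N l" "b \<in> shape l"
  shows "T b < N"
proof -
  have "T \<in> shape l \<rightarrow>\<^sub>E {..<N}" using assms(1) by (simp add: tableaux_def)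
  from PiE_mem[OF this assms(2)] show ?thesis by simp
qed

lemma tableau_outside:
  assumes "T \<in> tableaux N l" "b \<notin> shape l"
  shows "T b = undefined"
proof -
  have "T \<in> shape l \<rightarrow>\<^sub>E {..<N}" using assms(1) by (simp add: tableaux_def)
  from PiE_arb[OF this assms(2)] show ?thesis .
qed

text \<open>Columns increase strictly from row 0. Hence entries smaller than \<open>N\<close> lie in
  the first \<open>N\<close> rows only.\<close>

lemma tableau_entry_ge:
  assumes "antimono l" "T \<in> tableaux N l" "j < l i"
  shows "i \<le> T (i, j)"
  using assms(3)
proof (induction i)
  case (Suc i)
  have "j < l i" using antimonoD[OF assms(1), of i "Suc i"] Suc.prems by simp
  then have "(i, j) \<in> shape l" "(Suc i, j) \<in> shape l" using Suc.prems by (auto simp: shape_def)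
  then have "T (i, j) < T (Suc i, j)"
    using assms(2) unfolding tableaux_def semistandard_def by blast
  then show ?case using Suc.IH[OF \<open>j < l i\<close>] by simp
qed simp

text \<open>For \<open>l\<close> with at most \<open>N + 1\<close> rows these are the shapes
  \<open>v\<close> with at most \<open>N\<close> rows for which \<open>l / v\<close> is a horizontal
  strip, the possible position of the largest letter.\<close>

definition interlacing :: "nat \<Rightarrow> (nat \<Rightarrow> nat) \<Rightarrow> (nat \<Rightarrow> nat) set" where
  "interlacing N l = {v. (\<forall>i<N. l (Suc i) \<le> v i \<and> v i \<le> l i) \<and> (\<forall>i\<ge>N. v i = 0)}"

lemma interlacing_antimono:
  assumes "v \<in> interlacing N l"
  shows "antimono v"
proof (rule decseq_SucI)
  fix i show "v (Suc i) \<le> v i"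
  proof (cases "Suc i < N")
    case True
    then have "v (Suc i) \<le> l (Suc i)" "l (Suc i) \<le> v i" using assms by (auto simp: interlacing_def)
    then show ?thesis by simp
  qed (use assms in \<open>auto simp: interlacing_def\<close>)
qed

lemma finite_interlacing: "finite (interlacing N l)"
proof (rule finite_subset)
  show "interlacing N l \<subseteq> (\<lambda>v i. if i < N then v i else 0) ` PiE {..<N} (\<lambda>i. {..l i})"
  proof
    fix v assume v: "v \<in> interlacing N l"
    show "v \<in> (\<lambda>v i. if i < N then v i else 0) ` PiE {..<N} (\<lambda>i. {..l i})"
      by (rule image_eqI[of _ _ "restrict v {..<N}"]) (use v in \<open>auto simp: interlacing_def fun_eq_iff\<close>)
  qed
qed (auto intro!: finite_PiE)

text \<open>The boxes with entries below \<open>N\<close> form the shape of a tableau in one variable less.\<close>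
lemma tableaux_sum_Suc:
  assumes anti: "antimono l" and fin: "\<And>i. i \<ge> Suc N \<Longrightarrow> l i = 0"
  shows "tableaux_sum (Suc N) l x =
    (\<Sum>v\<in>interlacing N l. x N ^ ((\<Sum>i\<le>N. l i) - (\<Sum>i<N. v i)) * tableaux_sum N v x)"
proof -
  have vle: "v i \<le> l i" if "v \<in> interlacing N l" for v i
    using that by (cases "i < N") (auto simp: interlacing_def)
  have sub: "shape v \<subseteq> shape l" if "v \<in> interlacing N l" for v
    using vle[OF that] by (fastforce simp: shape_def dest: less_le_trans)
  have vfin: "i \<ge> N \<Longrightarrow> v i = 0" if "v \<in> interlacing N l" for v i
    using that by (auto simp: interlacing_def)
  have finl: "finite (shape l)" by (rule finite_shape[OF fin])
  have finv: "finite (shape v)" if "v \<in> interlacing N l" for v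
    by (rule finite_subset[OF sub[OF that] finl])
  \<comment> \<open>Inverse constructions: \<open>small\<close> keeps the entries below
    \<open>N\<close>, which form an initial segment of each row because rows increase weakly, and
    \<open>ext\<close> fills the boxes outside \<open>v\<close> with \<open>N\<close>.\<close>
  define small where "small T = (\<lambda>i. card {j. j < l i \<and> T (i, j) < N})" for T :: "box \<Rightarrow> nat"
  define ext where "ext v T = (\<lambda>b. if b \<in> shape v then T b else if b \<in> shape l then N else undefined)" for v and T :: "box \<Rightarrow> nat"
  have small: "j < small T i \<longleftrightarrow> j < l i \<and> T (i, j) < N" if "T \<in> tableaux (Suc N) l" for T i j
  proof -
    have mono: "T (i, j') \<le> T (i, j)" if "j < l i" "j' \<le> j" for j j'
    proof (cases "j' = j")
      case False
      then have "(i, j') \<in> shape l" "(i, j) \<in> shape l" "j' < j" using that by (auto simp: shape_def)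
      then show ?thesis
        using \<open>T \<in> tableaux (Suc N) l\<close> unfolding tableaux_def semistandard_def by blast
    qed simp
    let ?J = "{j. j < l i \<and> T (i, j) < N}"
    have down: "j' \<in> ?J" if "j \<in> ?J" "j' \<le> j" for j j'
      using mono[of j j'] that by auto
    have "finite ?J" by simp
    have "?J = {..<card ?J}"
    proof (cases "?J = {}")
      case False
      note M = Max_in[OF \<open>finite ?J\<close> False]
      have "?J = {..<Suc (Max ?J)}"
      proof (intro equalityI subsetI)
        fix j assume "j \<in> {..<Suc (Max ?J)}"
        then show "j \<in> ?J" by (intro down[OF M]) simp
      qed (simp only: lessThan_iff less_Suc_eq_le Max_ge[OF \<open>finite ?J\<close>])
      then show ?thesis using card_lessThan by metis
    qed (simp only: card.empty lessThan_0)
    then show ?thesis unfolding small_def by blast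
  qed
  have small_shape: "shape (small T) = {b \<in> shape l. T b < N}" if "T \<in> tableaux (Suc N) l" for T
    using small[OF that] by (auto simp: shape_def)
  have small_inter: "small T \<in> interlacing N l" if T: "T \<in> tableaux (Suc N) l" for T
  proof -
    \<comment> \<open>The largest letter \<open>N\<close> occurs at most once in a column, so a box
      with another box of \<open>l\<close> directly below it has an entry smaller than
      \<open>N\<close>.\<close>
    have "l (Suc i) \<le> small T i" for i
    proof (rule ccontr)
      assume "\<not> l (Suc i) \<le> small T i"
      then have j: "small T i < l (Suc i)" by simp
      then have j': "small T i < l i" using antimonoD[OF anti, of i "Suc i"] by simp
      have "(i, small T i) \<in> shape l" "(Suc i, small T i) \<in> shape l" using j j' by (auto simp: shape_def)
      moreover from this have "T (Suc i, small T i) < Suc N"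
        using tableau_less[OF T] by simp
      moreover from calculation have "T (i, small T i) < T (Suc i, small T i)"
        using T unfolding tableaux_def semistandard_def by blast
      ultimately have "T (i, small T i) < N" by simp
      with small[OF T, of "small T i" i] j' show False by simp
    qed
    moreover have "small T i \<le> l i" for i
      using small[OF T, of "l i" i] by (meson not_le less_irrefl)
    moreover have "small T i = 0" if "i \<ge> N" for i
    proof (rule ccontr)
      assume "small T i \<noteq> 0"
      then have "0 < l i" "T (i, 0) < N" using small[OF T, of 0 i] by auto
      with tableau_entry_ge[OF anti T, of 0 i] that show False by simp
    qed
    ultimately show ?thesis by (simp add: interlacing_def)
  qed
  have ext_tab: "ext v T \<in> tableaux (Suc N) l" "small (ext v T) = v"
    if v: "v \<in> interlacing N l" and T: "T \<in> tableaux N v" for v T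
  proof -
    have TN: "T b < N" if "b \<in> shape v" for b
      using tableau_less[OF T that] .
    have "ext v T \<in> shape l \<rightarrow>\<^sub>E {..<Suc N}"
      using sub[OF v] by (auto simp: ext_def PiE_def extensional_def less_Suc_eq dest: TN)
    moreover have "semistandard (shape l) (ext v T)"
      unfolding semistandard_def
    proof (intro conjI allI impI)
      fix i j j' assume a: "(i, j) \<in> shape l \<and> (i, j') \<in> shape l \<and> j < j'"
      show "ext v T (i, j) \<le> ext v T (i, j')"
      proof (cases "(i, j') \<in> shape v")
        case True
        then have "(i, j) \<in> shape v" using a by (auto simp: shape_def)
        moreover from this True a have "T (i, j) \<le> T (i, j')"
          using T unfolding tableaux_def semistandard_def by blast
        ultimately show ?thesis using True by (simp add: ext_def)
      qed (use a TN[of "(i, j)"] in \<open>auto simp: ext_def intro: less_imp_le\<close>)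
    next
      fix i i' j assume a: "(i, j) \<in> shape l \<and> (i', j) \<in> shape l \<and> i < i'"
      then have "j < l (Suc i)" using antimonoD[OF anti, of "Suc i" i'] by (auto simp: shape_def)
      moreover have "i < N"
      proof (rule ccontr)
        assume "\<not> i < N" then show False using \<open>j < l (Suc i)\<close> fin[of "Suc i"] by simp
      qed
      ultimately have iv: "(i, j) \<in> shape v" using v by (auto simp: interlacing_def shape_def)
      show "ext v T (i, j) < ext v T (i', j)"
      proof (cases "(i', j) \<in> shape v")
        case True
        with iv a have "T (i, j) < T (i', j)"
          using T unfolding tableaux_def semistandard_def by blast
        then show ?thesis using True iv by (simp add: ext_def)
      qed (use a iv TN in \<open>auto simp: ext_def\<close>)
    qed
    ultimately show tab: "ext v T \<in> tableaux (Suc N) l" by (simp add: tableaux_def)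
    show "small (ext v T) = v"
    proof
      fix i
      have "{j. j < l i \<and> ext v T (i, j) < N} = {..<v i}"
        using vle[OF v, of i] TN by (auto simp: ext_def shape_def)
      then show "small (ext v T) i = v i" by (simp add: small_def)
    qed
  qed
  have "tableaux_sum (Suc N) l x = (\<Sum>(v, T)\<in>Sigma (interlacing N l) (tableaux N).
      x N ^ ((\<Sum>i\<le>N. l i) - (\<Sum>i<N. v i)) * (\<Prod>b\<in>shape v. x (T b)))"
    unfolding tableaux_sum_def
  proof (rule sum.reindex_bij_witness[where i = "\<lambda>(v, T). ext v T" and j = "\<lambda>T. (small T, restrict T (shape (small T)))"])
    fix T assume T: "T \<in> tableaux (Suc N) l"
    note v = small_inter[OF T]
    show "(case (small T, restrict T (shape (small T))) of (v, T) \<Rightarrow> ext v T) = T"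
    proof
      fix b
      have "T b = N" if "b \<in> shape l" "b \<notin> shape (small T)"
      proof -
        have "T b < Suc N" using tableau_less[OF T that(1)] .
        then show ?thesis using that by (simp add: small_shape[OF T])
      qed
      moreover have "T b = undefined" if "b \<notin> shape l"
        using tableau_outside[OF T that] .
      ultimately show "(case (small T, restrict T (shape (small T))) of (v, T) \<Rightarrow> ext v T) b = T b"
        by (auto simp: ext_def)
    qed
    have "restrict T (shape (small T)) \<in> tableaux N (small T)"
      unfolding tableaux_def
    proof (intro CollectI conjI)
      show "restrict T (shape (small T)) \<in> shape (small T) \<rightarrow>\<^sub>E {..<N}"
        by (auto simp: small_shape[OF T])
      have "semistandard (shape l) T" using T by (simp add: tableaux_def)
      then show "semistandard (shape (small T)) (restrict T (shape (small T)))"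
        using sub[OF v] unfolding semistandard_def by (simp add: subset_iff)
    qed
    with v show "(small T, restrict T (shape (small T))) \<in> Sigma (interlacing N l) (tableaux N)" by simp
    have "(\<Prod>b\<in>shape l. x (T b)) = (\<Prod>b\<in>shape l - shape (small T). x (T b)) * (\<Prod>b\<in>shape (small T). x (T b))"
      by (rule prod.subset_diff[OF sub[OF v] finl])
    also have "(\<Prod>b\<in>shape l - shape (small T). x (T b)) = (\<Prod>b\<in>shape l - shape (small T). x N)"
    proof (rule prod.cong)
      fix b assume b: "b \<in> shape l - shape (small T)"
      then have "T b < Suc N" using tableau_less[OF T] by simp
      with b have "T b = N" by (auto simp: small_shape[OF T])
      then show "x (T b) = x N" by simp
    qed simp
    also have "\<dots> = x N ^ ((\<Sum>i\<le>N. l i) - (\<Sum>i<N. small T i))"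
      using card_shape[OF fin] card_shape[OF vfin[OF v]]
      by (simp add: card_Diff_subset[OF finv[OF v] sub[OF v]] lessThan_Suc_atMost)
    finally show "(case (small T, restrict T (shape (small T))) of (v, T) \<Rightarrow>
        x N ^ ((\<Sum>i\<le>N. l i) - (\<Sum>i<N. v i)) * (\<Prod>b\<in>shape v. x (T b))) = (\<Prod>b\<in>shape l. x (T b))"
      by simp
  next
    fix a assume "a \<in> Sigma (interlacing N l) (tableaux N)"
    then obtain v T where a: "a = (v, T)" and v: "v \<in> interlacing N l" and T: "T \<in> tableaux N v" by auto
    show "(case a of (v, T) \<Rightarrow> ext v T) \<in> tableaux (Suc N) l" using ext_tab[OF v T] by (simp add: a)
    have "restrict (ext v T) (shape v) = T"
      using tableau_outside[OF T] by (auto simp: ext_def fun_eq_iff)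
    then show "(small (case a of (v, T) \<Rightarrow> ext v T), restrict (case a of (v, T) \<Rightarrow> ext v T)
        (shape (small (case a of (v, T) \<Rightarrow> ext v T)))) = a"
      using ext_tab[OF v T] by (simp add: a)
  qed
  also have "\<dots> = (\<Sum>v\<in>interlacing N l. x N ^ ((\<Sum>i\<le>N. l i) - (\<Sum>i<N. v i)) * tableaux_sum N v x)"
    by (subst sum.Sigma[symmetric]) (auto simp: finite_interlacing finite_tableaux finv tableaux_sum_def sum_distrib_left)
  finally show ?thesis .
qed

text \<open>Both sides satisfy the same recursion in \<open>N\<close>. Since
  \<open>delta (Suc N) i\<close> is \<open>delta N i + 1\<close> for \<open>i < N\<close>, the
  half-open gaps of \<open>alternant_Suc\<close> turn into the weak inequalities of
  \<open>interlacing\<close> after subtracting \<open>delta N\<close>. The powers of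
  \<open>x N\<close> add up to the number of boxes of \<open>l / v\<close>.\<close>

lemma tableaux_sum_alternant:
  assumes "antimono l" "\<And>i. i \<ge> N \<Longrightarrow> l i = 0"
  shows "tableaux_sum N l x * alternant N (delta N) x = alternant N (\<lambda>i. l i + delta N i) x"
  using assms
proof (induction N arbitrary: l)
  case 0
  then have "shape l = {}" by (auto simp: shape_def)
  then have "tableaux 0 l = {\<lambda>_. undefined}" by (auto simp: tableaux_def semistandard_def)
  then show ?case by (simp add: tableaux_sum_def \<open>shape l = {}\<close> alternant_def)
next
  case (Suc N)
  define e where "e i = l i + delta (Suc N) i" for i
  have dec: "e (Suc i) \<le> e i" for i
    using antimonoD[OF Suc.prems(1), of i "Suc i"] by (simp add: e_def delta_def)
  let ?V = "\<Prod>j<N. x j - x N"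
  have "alternant (Suc N) e x = ?V * (\<Sum>b\<in>PiE {0..<N} (\<lambda>i. {e (Suc i)..<e i}).
      x N ^ e N * (\<Prod>i=0..<N. x N ^ (e i - 1 - b i)) * alternant N b x)"
    using dec by (rule alternant_Suc)
  also have "(\<Sum>b\<in>PiE {0..<N} (\<lambda>i. {e (Suc i)..<e i}).
      x N ^ e N * (\<Prod>i=0..<N. x N ^ (e i - 1 - b i)) * alternant N b x)
    = (\<Sum>v\<in>interlacing N l. x N ^ ((\<Sum>i\<le>N. l i) - (\<Sum>i<N. v i)) * (tableaux_sum N v x * alternant N (delta N) x))"
  proof (rule sum.reindex_bij_witness[where
      i = "\<lambda>v. restrict (\<lambda>i. v i + delta N i) {0..<N}" and j = "\<lambda>b i. if i < N then b i - delta N i else 0"])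
    fix b assume b: "b \<in> PiE {0..<N} (\<lambda>i. {e (Suc i)..<e i})"
    let ?v = "\<lambda>i. if i < N then b i - delta N i else 0"
    have bi: "l (Suc i) + delta N i \<le> b i" "b i < l i + Suc (delta N i)" if "i < N" for i
    proof -
      have "e (Suc i) \<le> b i" "b i < e i" using b that by (auto simp: PiE_def Pi_def)
      moreover have "delta (Suc N) i = Suc (delta N i)" "delta (Suc N) (Suc i) = delta N i"
        using that by (auto simp: delta_def)
      ultimately show "l (Suc i) + delta N i \<le> b i" "b i < l i + Suc (delta N i)" by (auto simp: e_def)
    qed
    have vb: "?v i + delta N i = b i" if "i < N" for i using bi[OF that] that by simp
    show "restrict (\<lambda>i. ?v i + delta N i) {0..<N} = b"
      using b vb by (auto simp: PiE_def extensional_def fun_eq_iff)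
    have v: "?v \<in> interlacing N l"
      unfolding interlacing_def
    proof (intro CollectI conjI allI impI)
      fix i assume "i < N"
      then show "l (Suc i) \<le> ?v i" "?v i \<le> l i" using bi[of i] by auto
    qed simp
    then show "?v \<in> interlacing N l" .
    have "tableaux_sum N ?v x * alternant N (delta N) x = alternant N (\<lambda>i. ?v i + delta N i) x"
      by (rule Suc.IH[OF interlacing_antimono[OF v]]) simp
    also have "\<dots> = alternant N b x" using vb by (intro alternant_cong)
    finally have alt: "tableaux_sum N ?v x * alternant N (delta N) x = alternant N b x" .
    have "e N + (\<Sum>i=0..<N. e i - 1 - b i) = (\<Sum>i\<le>N. l i) - (\<Sum>i<N. ?v i)"
    proof -
      have "e i - 1 - b i = l i - ?v i" if "i < N" for i
        using bi[OF that] that by (simp add: e_def delta_def)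
      then have "(\<Sum>i=0..<N. e i - 1 - b i) = (\<Sum>i<N. l i - ?v i)"
        by (simp add: lessThan_atLeast0)
      also have "\<dots> = (\<Sum>i<N. l i) - (\<Sum>i<N. ?v i)"
        using v by (intro sum_subtractf_nat) (simp add: interlacing_def)
      moreover have "(\<Sum>i<N. ?v i) \<le> (\<Sum>i<N. l i)"
        using v by (intro sum_mono) (simp add: interlacing_def)
      moreover have "e N = l N" by (simp add: e_def delta_def)
      ultimately show ?thesis by (simp flip: lessThan_Suc_atMost)
    qed
    then show "x N ^ ((\<Sum>i\<le>N. l i) - (\<Sum>i<N. ?v i)) * (tableaux_sum N ?v x * alternant N (delta N) x)
      = x N ^ e N * (\<Prod>i=0..<N. x N ^ (e i - 1 - b i)) * alternant N b x"
      unfolding alt by (simp flip: power_sum power_add)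
  next
    fix v assume v: "v \<in> interlacing N l"
    then show "(\<lambda>i. if i < N then restrict (\<lambda>i. v i + delta N i) {0..<N} i - delta N i else 0) = v"
      by (auto simp: interlacing_def fun_eq_iff)
    show "restrict (\<lambda>i. v i + delta N i) {0..<N} \<in> PiE {0..<N} (\<lambda>i. {e (Suc i)..<e i})"
    proof (rule PiE_I)
      fix i assume "i \<in> {0..<N}"
      moreover from this have "delta (Suc N) i = Suc (delta N i)" "delta (Suc N) (Suc i) = delta N i"
        by (auto simp: delta_def)
      ultimately show "restrict (\<lambda>i. v i + delta N i) {0..<N} i \<in> {e (Suc i)..<e i}"
        using v by (auto simp: interlacing_def e_def)
    qed simp
  qed
  also have "\<dots> = (\<Sum>v\<in>interlacing N l. x N ^ ((\<Sum>i\<le>N. l i) - (\<Sum>i<N. v i)) * tableaux_sum N v x) * alternant N (delta N) x"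
    by (simp add: sum_distrib_right mult.assoc)
  also have "(\<Sum>v\<in>interlacing N l. x N ^ ((\<Sum>i\<le>N. l i) - (\<Sum>i<N. v i)) * tableaux_sum N v x) = tableaux_sum (Suc N) l x"
    using Suc.prems by (simp add: tableaux_sum_Suc)
  finally show ?case
    unfolding e_def[abs_def, symmetric] by (simp add: alternant_delta_Suc mult_ac flip: e_def)
qed

section \<open>Derivatives of alternants\<close>

lemma prod_power_upd:
  assumes "finite I" "i \<in> I"
  shows "(\<Prod>j\<in>I. x (p j) ^ (e(i := e i + c)) j) = x (p i) ^ c * (\<Prod>j\<in>I. x (p j) ^ e j :: 'a :: comm_ring_1)"
proof -
  have "(\<Prod>j\<in>I - {i}. x (p j) ^ (e(i := e i + c)) j) = (\<Prod>j\<in>I - {i}. x (p j) ^ e j)"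
    by (rule prod.cong) auto
  then show ?thesis
    by (simp add: prod.remove[OF assms] power_add mult_ac)
qed

text \<open>
  \<open>D\<^sub>r f\<close> at \<open>x\<close> is the derivative of \<open>f\<close> along the curve \<open>x\<^sub>j + t x\<^sub>j\<^bsup>r+1\<^esup>\<close> at \<open>t = 0\<close>.
\<close>
definition flow :: "nat \<Rightarrow> (nat \<Rightarrow> rat) \<Rightarrow> nat \<Rightarrow> rat poly" where
  "flow r x j = [:x j, x j ^ Suc r:]"

definition flow_deriv :: "rat poly \<Rightarrow> rat" where
  "flow_deriv F = poly (pderiv F) 0"

lemma flow_deriv_mult: "flow_deriv (F * G) = poly F 0 * flow_deriv G + poly G 0 * flow_deriv F"
  by (simp add: flow_deriv_def pderiv_mult)

lemma flow_deriv_sum: "flow_deriv (sum f A) = (\<Sum>a\<in>A. flow_deriv (f a))"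
  by (induction A rule: infinite_finite_induct) (simp_all add: flow_deriv_def pderiv_add)

lemma flow_deriv_of_int_mult: "flow_deriv (of_int c * F) = of_int c * flow_deriv F"
  by (simp add: flow_deriv_def of_int_poly pderiv_smult)

lemma flow_deriv_of_nat_mult: "flow_deriv (of_nat c * F) = of_nat c * flow_deriv F"
  using flow_deriv_of_int_mult[of "int c" F] by simp

lemma flow_deriv_prod:
  assumes "finite I"
  shows "flow_deriv (\<Prod>i\<in>I. flow r x (q i) ^ e i) = (\<Sum>i\<in>I. of_nat (e i) * x (q i) ^ r) * (\<Prod>i\<in>I. x (q i) ^ e i)"
  using assms
proof (induction I rule: finite_induct)
  case empty
  then show ?case by (simp add: flow_deriv_def)
next
  case (insert i I)
  have "flow_deriv (flow r x (q i) ^ e i) = of_nat (e i) * x (q i) ^ r * x (q i) ^ e i"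
  proof (cases "e i")
    case (Suc n)
    have "flow_deriv (flow r x (q i) ^ Suc n) = of_nat (Suc n) * poly (flow r x (q i)) 0 ^ n * flow_deriv (flow r x (q i))"
      unfolding flow_deriv_def pderiv_power_Suc by simp
    then show ?thesis
      by (simp add: Suc flow_def flow_deriv_def pderiv_pCons del: of_nat_Suc)
  qed (simp add: flow_deriv_def)
  moreover have "poly (\<Prod>i\<in>I. flow r x (q i) ^ e i) 0 = (\<Prod>i\<in>I. x (q i) ^ e i)"
    by (simp add: poly_prod flow_def)
  moreover have "poly (flow r x (q i) ^ e i) 0 = x (q i) ^ e i" by (simp add: flow_def)
  ultimately show ?case
    using insert by (simp add: flow_deriv_mult algebra_simps)
qed

lemma poly_alternant_flow: "poly (alternant N e (flow r x)) 0 = alternant N e x"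
  by (simp add: alternant_altdef poly_sum poly_prod flow_def)

lemma poly_tableaux_sum_flow: "poly (tableaux_sum N l (flow r x)) 0 = tableaux_sum N l x"
  by (simp add: tableaux_sum_def poly_sum poly_prod flow_def)

lemma alternant_upd:
  assumes "i < N"
  shows "alternant N (e(i := e i + c)) x = (\<Sum>p | p permutes {0..<N}. signof p * (x (p i) ^ c * (\<Prod>i=0..<N. x (p i) ^ e i)))"
  unfolding alternant_altdef using assms by (simp add: prod_power_upd del: fun_upd_apply)

lemma alternant_upd2:
  assumes "i < N" "j < N" "i \<noteq> j"
  shows "alternant N (e(i := e i + a, j := e j + b)) x
    = (\<Sum>p | p permutes {0..<N}. signof p * (x (p i) ^ a * x (p j) ^ b * (\<Prod>i=0..<N. x (p i) ^ e i)))"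
proof -
  have "alternant N (e(i := e i + a, j := e j + b)) x = alternant N ((e(i := e i + a))(j := (e(i := e i + a)) j + b)) x"
    using assms(3) by simp
  also have "\<dots> = (\<Sum>p | p permutes {0..<N}. signof p * (x (p j) ^ b * (x (p i) ^ a * (\<Prod>i=0..<N. x (p i) ^ e i))))"
    unfolding alternant_upd[OF assms(2)] using assms(1) by (simp add: prod_power_upd del: fun_upd_apply)
  finally show ?thesis by (simp add: mult_ac)
qed

lemma flow_deriv_alternant:
  "flow_deriv (alternant N e (flow r x)) = (\<Sum>i<N. of_nat (e i) * alternant N (e(i := e i + r)) x)"
proof -
  have "flow_deriv (alternant N e (flow r x)) = (\<Sum>p | p permutes {0..<N}. \<Sum>i<N.
      of_nat (e i) * (signof p * (x (p i) ^ r * (\<Prod>i=0..<N. x (p i) ^ e i))))"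
    unfolding alternant_altdef flow_deriv_sum flow_deriv_of_int_mult flow_deriv_prod[OF finite_atLeastLessThan]
    by (simp add: sum_distrib_left sum_distrib_right mult_ac lessThan_atLeast0)
  also have "\<dots> = (\<Sum>i<N. \<Sum>p | p permutes {0..<N}. of_nat (e i) * (signof p * (x (p i) ^ r * (\<Prod>i=0..<N. x (p i) ^ e i))))"
    by (rule sum.swap)
  also have "\<dots> = (\<Sum>i<N. of_nat (e i) * alternant N (e(i := e i + r)) x)"
    by (intro sum.cong refl) (simp add: alternant_upd sum_distrib_left)
  finally show ?thesis .
qed

text \<open>The power sum is symmetric, so in the term of a permutation \<open>p\<close> it may be
  written in the variables \<open>x (p i)\<close>; each summand then raises the exponent of row
  \<open>i\<close>.\<close>

lemma power_sum_mult_alternant: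
  "(\<Sum>i<N. x i ^ r) * alternant N e x = (\<Sum>i<N. alternant N (e(i := e i + r)) x)"
proof -
  have "(\<Sum>i<N. x i ^ r) * (signof p * (\<Prod>i=0..<N. x (p i) ^ e i))
      = (\<Sum>i<N. signof p * (x (p i) ^ r * (\<Prod>i=0..<N. x (p i) ^ e i)))" if p: "p permutes {0..<N}" for p
  proof -
    have "(\<Sum>i<N. x i ^ r) = (\<Sum>i<N. x (p i) ^ r)"
      using sum.permute[OF p, of "\<lambda>i. x i ^ r"] by (simp add: o_def lessThan_atLeast0)
    then show ?thesis by (simp add: sum_distrib_left sum_distrib_right mult_ac)
  qed
  then have "(\<Sum>i<N. x i ^ r) * alternant N e x = (\<Sum>p | p permutes {0..<N}. \<Sum>i<N.
      signof p * (x (p i) ^ r * (\<Prod>i=0..<N. x (p i) ^ e i)))"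
    unfolding alternant_altdef sum_distrib_left by (intro sum.cong) auto
  also have "\<dots> = (\<Sum>i<N. \<Sum>p | p permutes {0..<N}. signof p * (x (p i) ^ r * (\<Prod>i=0..<N. x (p i) ^ e i)))"
    by (rule sum.swap)
  also have "\<dots> = (\<Sum>i<N. alternant N (e(i := e i + r)) x)"
    by (intro sum.cong refl) (simp add: alternant_upd)
  finally show ?thesis .
qed

text \<open>Ordered pairs, because a permutation maps this set onto itself but does not preserve
  \<open>i < j\<close>. Every unordered pair is counted twice, which explains the division by 2 in
  \<open>flow_deriv_alternant_decomp\<close>.\<close>

definition off_diagonal :: "nat \<Rightarrow> (nat \<times> nat) set" where
  "off_diagonal N = {(i, j). i < N \<and> j < N \<and> i \<noteq> j}"

lemma finite_off_diagonal: "finite (off_diagonal N)"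
  by (rule finite_subset[of _ "{..<N} \<times> {..<N}"]) (auto simp: off_diagonal_def)

lemma pair_sum_mult_alternant:
  "(\<Sum>(i, j)\<in>off_diagonal N. \<Sum>a=1..<r. x i ^ a * x j ^ (r - a)) * alternant N e x
    = (\<Sum>(i, j)\<in>off_diagonal N. \<Sum>a=1..<r. alternant N (e(i := e i + a, j := e j + (r - a))) x)"
proof -
  have "(\<Sum>(i, j)\<in>off_diagonal N. \<Sum>a=1..<r. x i ^ a * x j ^ (r - a)) * (signof p * (\<Prod>i=0..<N. x (p i) ^ e i))
      = (\<Sum>(i, j)\<in>off_diagonal N. \<Sum>a=1..<r. signof p * (x (p i) ^ a * x (p j) ^ (r - a) * (\<Prod>i=0..<N. x (p i) ^ e i)))"
    if p: "p permutes {0..<N}" for p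
  proof -
    have inj: "inj_on (map_prod p p) (off_diagonal N)"
      using injD[OF permutes_inj[OF p]] by (auto simp: inj_on_def)
    have img: "map_prod p p ` off_diagonal N = off_diagonal N"
    proof (rule endo_inj_surj[OF finite_off_diagonal _ inj])
      show "map_prod p p ` off_diagonal N \<subseteq> off_diagonal N"
        using permutes_in_image[OF p] injD[OF permutes_inj[OF p]] by (auto simp: off_diagonal_def)
    qed
    have "(\<Sum>(i, j)\<in>off_diagonal N. \<Sum>a=1..<r. x i ^ a * x j ^ (r - a))
      = (\<Sum>(i, j)\<in>map_prod p p ` off_diagonal N. \<Sum>a=1..<r. x i ^ a * x j ^ (r - a))"
      by (simp only: img)
    also have "\<dots> = (\<Sum>(i, j)\<in>off_diagonal N. \<Sum>a=1..<r. x (p i) ^ a * x (p j) ^ (r - a))"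
      by (subst sum.reindex[OF inj]) (simp add: split_def)
    finally show ?thesis
      by (simp add: sum_distrib_left sum_distrib_right mult_ac split_def)
  qed
  then have "(\<Sum>(i, j)\<in>off_diagonal N. \<Sum>a=1..<r. x i ^ a * x j ^ (r - a)) * alternant N e x
    = (\<Sum>p | p permutes {0..<N}. \<Sum>(i, j)\<in>off_diagonal N. \<Sum>a=1..<r. signof p * (x (p i) ^ a * x (p j) ^ (r - a) * (\<Prod>i=0..<N. x (p i) ^ e i)))"
    unfolding alternant_altdef sum_distrib_left[of _ _ "{p. p permutes {0..<N}}"] by (intro sum.cong) auto
  also have "\<dots> = (\<Sum>z\<in>off_diagonal N. \<Sum>p | p permutes {0..<N}. case z of (i, j) \<Rightarrow> \<Sum>a=1..<r. signof p * (x (p i) ^ a * x (p j) ^ (r - a) * (\<Prod>i=0..<N. x (p i) ^ e i)))"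
    by (rule sum.swap)
  also have "\<dots> = (\<Sum>(i, j)\<in>off_diagonal N. \<Sum>a=1..<r. alternant N (e(i := e i + a, j := e j + (r - a))) x)"
  proof (intro sum.cong refl, clarify)
    fix i j assume "(i, j) \<in> off_diagonal N"
    then show "(\<Sum>p | p permutes {0..<N}. \<Sum>a=1..<r. signof p * (x (p i) ^ a * x (p j) ^ (r - a) * (\<Prod>i=0..<N. x (p i) ^ e i)))
      = (\<Sum>a=1..<r. alternant N (e(i := e i + a, j := e j + (r - a))) x)"
      by (subst sum.swap) (intro sum.cong refl, subst alternant_upd2, auto simp: off_diagonal_def)
  qed
  finally show ?thesis .
qed

text \<open>
  \<open>D\<^sub>r A\<^sub>e\<close> without a multiple of the alternant \<open>A\<^sub>e\<close> by a factor independent of \<open>e\<close>, see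
  \<open>flow_deriv_alternant_decomp\<close>.
\<close>
definition reduced_deriv :: "nat \<Rightarrow> nat \<Rightarrow> (nat \<Rightarrow> nat) \<Rightarrow> (nat \<Rightarrow> rat) \<Rightarrow> rat" where
  "reduced_deriv N r e x = (\<Sum>j<N. (of_nat (e j) + 1 - of_nat N) * alternant N (e(j := e j + r)) x)
     - (\<Sum>j<N. \<Sum>i<j. \<Sum>a=1..<r. alternant N (e(i := e i + a, j := e j + (r - a))) x)"

lemma flow_deriv_alternant_decomp:
  "flow_deriv (alternant N e (flow r x)) = reduced_deriv N r e x +
     ((of_nat N - 1) * (\<Sum>i<N. x i ^ r) + (\<Sum>(i, j)\<in>off_diagonal N. \<Sum>a=1..<r. x i ^ a * x j ^ (r - a)) / 2) * alternant N e x"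
proof -
  define F where "F i j = (\<Sum>a=1..<r. alternant N (e(i := e i + a, j := e j + (r - a))) x)" for i j
  have F_sym: "F i j = F j i" if "i \<noteq> j" for i j
    unfolding F_def
    by (rule sum.reindex_bij_witness[where i = "\<lambda>a. r - a" and j = "\<lambda>a. r - a"])
      (use that in \<open>auto simp: fun_upd_twist\<close>)
  have "off_diagonal N = (SIGMA j:{..<N}. {..<j}) \<union> prod.swap ` (SIGMA j:{..<N}. {..<j})"
    by (auto simp: off_diagonal_def image_iff)
  then have "(\<Sum>(i, j)\<in>off_diagonal N. F i j) = (\<Sum>(i, j)\<in>(SIGMA j:{..<N}. {..<j}). F i j)
      + (\<Sum>(i, j)\<in>prod.swap ` (SIGMA j:{..<N}. {..<j}). F i j)"
    by (simp only:) (rule sum.union_disjoint, auto)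
  also have "(\<Sum>(i, j)\<in>prod.swap ` (SIGMA j:{..<N}. {..<j}). F i j) = (\<Sum>(j, i)\<in>(SIGMA j:{..<N}. {..<j}). F i j)"
    by (subst sum.reindex) (auto simp: inj_on_def split_def)
  also have "(\<Sum>(i, j)\<in>(SIGMA j:{..<N}. {..<j}). F i j) = (\<Sum>(j, i)\<in>(SIGMA j:{..<N}. {..<j}). F i j)"
    by (intro sum.cong) (auto intro: F_sym)
  also have "(\<Sum>(j, i)\<in>(SIGMA j:{..<N}. {..<j}). F i j) = (\<Sum>j<N. \<Sum>i<j. F i j)"
    by (rule sum.Sigma[symmetric]) auto
  finally have pairs: "(\<Sum>(i, j)\<in>off_diagonal N. F i j) = 2 * (\<Sum>j<N. \<Sum>i<j. F i j)" by simp
  have "((of_nat N - 1) * (\<Sum>i<N. x i ^ r) + (\<Sum>(i, j)\<in>off_diagonal N. \<Sum>a=1..<r. x i ^ a * x j ^ (r - a)) / 2) * alternant N e x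
    = (of_nat N - 1) * ((\<Sum>i<N. x i ^ r) * alternant N e x)
      + ((\<Sum>(i, j)\<in>off_diagonal N. \<Sum>a=1..<r. x i ^ a * x j ^ (r - a)) * alternant N e x) / 2"
    by (simp add: algebra_simps)
  also have "\<dots> = (of_nat N - 1) * (\<Sum>i<N. alternant N (e(i := e i + r)) x) + (\<Sum>j<N. \<Sum>i<j. F i j)"
    unfolding power_sum_mult_alternant pair_sum_mult_alternant F_def[symmetric] pairs by simp
  finally show ?thesis
    unfolding reduced_deriv_def flow_deriv_alternant F_def
    by (simp add: algebra_simps sum.distrib sum_subtractf sum_distrib_left)
qed

lemma alternant_transpose:
  assumes "i < N" "j < N" "i \<noteq> j"
  shows "alternant N (e(i := u, j := v)) x = - (alternant N (e(i := v, j := u)) x :: rat)"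
proof -
  have "e(i := u, j := v) = e(i := v, j := u) \<circ> Transposition.transpose i j"
    using assms(3) by (auto simp: fun_eq_iff Transposition.transpose_def)
  moreover have "Transposition.transpose i j permutes {0..<N}"
    using assms by (intro permutes_swap_id) auto
  ultimately show ?thesis
    using assms(3) by (simp only: alternant_permute) (simp add: sign_swap_id)
qed

text \<open>
  The terms with \<open>e i < e j + r - a\<close> cancel in pairs \<open>a\<close>, \<open>e j + r - e i - a\<close>, whose exponents
  differ by a transposition.
\<close>
lemma reduced_pair_sum:
  assumes "i < j" "j < N" "e j < e i"
  shows "(\<Sum>a=1..<r. alternant N (e(i := e i + a, j := e j + (r - a))) x)
    = (\<Sum>a | a \<in> {1..<r} \<and> e j + (r - a) < e i. alternant N (e(i := e i + a, j := e j + (r - a))) x)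
      - (if e i < e j + r then alternant N (e(j := e j + r)) x else 0 :: rat)"
proof -
  define t where "t a = alternant N (e(i := e i + a, j := e j + (r - a))) x" for a
  have ij: "i < N" "j < N" "i \<noteq> j" using assms by auto
  let ?A = "{a \<in> {1..<r}. e i < e j + (r - a)}" and ?B = "{a \<in> {1..<r}. e j + (r - a) = e i}"
    and ?C = "{a \<in> {1..<r}. e j + (r - a) < e i}"
  have "{1..<r} = (?A \<union> ?B) \<union> ?C" by auto
  then have "sum t {1..<r} = sum t ((?A \<union> ?B) \<union> ?C)" by (rule arg_cong)
  also have "\<dots> = sum t ?A + sum t ?B + sum t ?C"
    by (subst sum.union_disjoint; (subst sum.union_disjoint)?) auto
  also have "sum t ?A = 0"
  proof -
    let ?c = "e j + r - e i"
    have "sum t ?A = (\<Sum>a\<in>?A. - t a)"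
    proof (rule sum.reindex_bij_witness[where i = "\<lambda>a. ?c - a" and j = "\<lambda>a. ?c - a"])
      fix a assume "a \<in> ?A"
      then have a: "1 \<le> a" "a < r" "e i < e j + (r - a)" by auto
      then have eqs: "e i + (?c - a) = e j + (r - a)" "e j + (r - (?c - a)) = e i + a"
        using assms(3) by auto
      then show "- t (?c - a) = t a"
        by (simp only: t_def eqs alternant_transpose[OF ij, of e "e j + (r - a)" "e i + a"] minus_minus)
      show "?c - a \<in> ?A" using a assms(3) by auto
      show "?c - (?c - a) = a" using a by auto
    qed (use assms(3) in auto)
    then show ?thesis by (simp add: sum_negf)
  qed
  \<comment> \<open>Raising row \<open>j\<close> exactly to \<open>e i\<close> moves row
    \<open>i\<close> to \<open>e j + r\<close>. These are the exponents of
    \<open>e(j := e j + r)\<close> with rows \<open>i\<close> and \<open>j\<close> exchanged, whence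
    the sign.\<close>
  also have "sum t ?B = (if e i < e j + r then - alternant N (e(j := e j + r)) x else 0)"
  proof (cases "e i < e j + r")
    case True
    let ?a = "e j + r - e i"
    have "?B = {?a}" using True assms(3) by auto
    then have "sum t ?B = t ?a" by simp
    also have "\<dots> = alternant N (e(i := e j + r, j := e i)) x"
      using True assms(3) by (simp add: t_def)
    also have "\<dots> = - alternant N (e(j := e j + r)) x"
      by (subst alternant_transpose[OF ij]) simp
    finally show ?thesis using True by simp
  next
    case False
    then have "?B = {}" by auto
    then show ?thesis using False by (simp only: sum.empty if_False)
  qed
  finally show ?thesis by (simp add: t_def)
qed

text \<open>Summing \<open>reduced_pair_sum\<close> over the pairs: in the remaining double terms
  row \<open>j\<close> stays below the old exponent of row \<open>i\<close>, and each row overtaken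
  by \<open>e j + r\<close> adds 1 to the coefficient of the single term of
  \<open>j\<close>.\<close>

lemma reduced_deriv_decreasing:
  assumes dec: "\<And>i j. i < j \<Longrightarrow> j < N \<Longrightarrow> e j < e i"
  shows "reduced_deriv N r e x =
    (\<Sum>j<N. (of_nat (e j) + 1 - of_nat N + of_nat (card {i. i < j \<and> e i < e j + r})) * alternant N (e(j := e j + r)) x)
     - (\<Sum>j<N. \<Sum>i<j. \<Sum>a | a \<in> {1..<r} \<and> e j + (r - a) < e i. alternant N (e(i := e i + a, j := e j + (r - a))) x)"
proof -
  have "(\<Sum>i<j. \<Sum>a=1..<r. alternant N (e(i := e i + a, j := e j + (r - a))) x) =
    (\<Sum>i<j. \<Sum>a | a \<in> {1..<r} \<and> e j + (r - a) < e i. alternant N (e(i := e i + a, j := e j + (r - a))) x)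
      - of_nat (card {i. i < j \<and> e i < e j + r}) * alternant N (e(j := e j + r)) x" if j: "j < N" for j
  proof -
    have "{..<j} \<inter> {i. e i < e j + r} = {i. i < j \<and> e i < e j + r}" by auto
    moreover have "(\<Sum>i<j. \<Sum>a=1..<r. alternant N (e(i := e i + a, j := e j + (r - a))) x) =
      (\<Sum>i<j. (\<Sum>a | a \<in> {1..<r} \<and> e j + (r - a) < e i. alternant N (e(i := e i + a, j := e j + (r - a))) x)
      - (if e i < e j + r then alternant N (e(j := e j + r)) x else 0))"
      by (intro sum.cong refl reduced_pair_sum) (use j dec in auto)
    ultimately show ?thesis
      unfolding sum_subtractf by (simp only: sum.If_cases[OF finite_lessThan] sum_constant sum.neutral_const add_0_right)
  qed
  then have "(\<Sum>j<N. \<Sum>i<j. \<Sum>a=1..<r. alternant N (e(i := e i + a, j := e j + (r - a))) x) =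
    (\<Sum>j<N. (\<Sum>i<j. \<Sum>a | a \<in> {1..<r} \<and> e j + (r - a) < e i. alternant N (e(i := e i + a, j := e j + (r - a))) x)
      - of_nat (card {i. i < j \<and> e i < e j + r}) * alternant N (e(j := e j + r)) x)"
    by (intro sum.cong) auto
  then show ?thesis
    unfolding reduced_deriv_def by (simp only: sum_subtractf sum.distrib distrib_right)
qed

text \<open>The exponents of \<delta> fill the interval from 0 to \<open>N - 1\<close>. Raising row
  \<open>j\<close> by \<open>r \<le> j\<close> therefore hits the exponent of row
  \<open>j - r\<close>. For \<open>r > j\<close> all \<open>j\<close> rows above are overtaken and
  the coefficient is \<open>(N - 1 - j) + 1 - N + j = 0\<close>. In a double term the raised row
  \<open>j\<close> collides with a row strictly between \<open>i\<close> and
  \<open>j\<close>.\<close>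

lemma reduced_deriv_delta:
  assumes "r \<ge> 1"
  shows "reduced_deriv N r (delta N) x = 0"
proof -
  have dec: "delta N j < delta N i" if "i < j" "j < N" for i j
    using that by (auto simp: delta_def)
  have "(of_nat (delta N j) + 1 - of_nat N + of_nat (card {i. i < j \<and> delta N i < delta N j + r}))
      * alternant N ((delta N)(j := delta N j + r)) x = 0" if j: "j < N" for j
  proof (cases "r \<le> j")
    case True
    have "alternant N ((delta N)(j := delta N j + r)) x = 0"
      by (rule alternant_repeated[of j _ "j - r"]) (use True j assms in \<open>auto simp: delta_def\<close>)
    then show ?thesis by simp
  next
    case False
    then have "{i. i < j \<and> delta N i < delta N j + r} = {..<j}"
      using j by (auto simp: delta_def)
    moreover have "of_nat (delta N j) = (of_nat N - 1 - of_nat j :: rat)"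
      using j by (simp add: delta_def of_nat_diff)
    ultimately show ?thesis by simp
  qed
  moreover have "alternant N ((delta N)(i := delta N i + a, j := delta N j + (r - a))) x = 0"
    if "j < N" "i < j" "a \<in> {1..<r}" "delta N j + (r - a) < delta N i" for i j a
    by (rule alternant_repeated[of j _ "j - (r - a)"]) (use that in \<open>auto simp: delta_def\<close>)
  ultimately show ?thesis
    by (subst reduced_deriv_decreasing[OF dec]) (auto intro!: sum.neutral simp del: diff_add_assoc add_diff_assoc)
qed

lemma flow_deriv_tableaux_sum:
  assumes "r \<ge> 1" "antimono l" "\<And>i. i \<ge> N \<Longrightarrow> l i = 0"
  shows "flow_deriv (tableaux_sum N l (flow r x)) * alternant N (delta N) x = reduced_deriv N r (\<lambda>i. l i + delta N i) x"
proof -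
  let ?K = "(of_nat N - 1) * (\<Sum>i<N. x i ^ r) + (\<Sum>(i, j)\<in>off_diagonal N. \<Sum>a=1..<r. x i ^ a * x j ^ (r - a)) / 2"
  have "flow_deriv (tableaux_sum N l (flow r x) * alternant N (delta N) (flow r x))
      = flow_deriv (alternant N (\<lambda>i. l i + delta N i) (flow r x))"
    by (simp only: tableaux_sum_alternant[OF assms(2,3)])
  moreover have "tableaux_sum N l x * alternant N (delta N) x = alternant N (\<lambda>i. l i + delta N i) x"
    by (rule tableaux_sum_alternant[OF assms(2,3)])
  \<comment> \<open>The product rule with \<open>d\<close> and \<open>a\<close> for the alternants
    of \<delta> and of \<open>l\<close> + \<delta>, \<open>s\<close> for the Schur polynomial and
    \<open>D\<close> for its derivative; the 0 is the reduced derivative of \<delta>.\<close>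
  moreover have "D * d = R" if "s * (0 + K * d) + d * D = R + K * a" "s * d = a" for s d D R K a :: rat
    using that by (auto simp: algebra_simps)
  ultimately show ?thesis
    unfolding flow_deriv_mult poly_alternant_flow poly_tableaux_sum_flow flow_deriv_alternant_decomp[of N] reduced_deriv_delta[OF assms(1)]
    by blast
qed

section \<open>From Schur polynomials back to formal series\<close>

definition part :: "nat list \<Rightarrow> nat \<Rightarrow> nat" where
  "part lam i = (if i < length lam then lam ! i else 0)"

lemma diagram_eq_shape: "diagram lam = shape (part lam)"
  by (auto simp: diagram_def shape_def part_def split: if_splits)

lemma antimono_part:
  assumes "is_partition lam"
  shows "antimono (part lam)"
proof (rule antimonoI)
  fix i j :: nat assume "i \<le> j"
  then show "part lam j \<le> part lam i"
    using assms sorted_wrt_nth_less[of "(\<ge>)" lam i j]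
    by (cases "i = j") (auto simp: part_def is_partition_def)
qed

lemma length_le_psize:
  assumes "is_partition lam"
  shows "length lam \<le> psize lam"
proof -
  have "0 \<notin> set lam \<Longrightarrow> length lam \<le> sum_list lam" for lam :: "nat list"
    by (induction lam) auto
  then show ?thesis using assms by (simp add: is_partition_def)
qed

lemma part_eq_0:
  assumes "is_partition lam" "i \<ge> psize lam"
  shows "part lam i = 0"
  using length_le_psize[OF assms(1)] assms(2) by (simp add: part_def)

definition monomials :: "nat \<Rightarrow> nat \<Rightarrow> nat multiset set" where
  "monomials N d = {\<gamma>. size \<gamma> = d \<and> set_mset \<gamma> \<subseteq> {..<N}}"

lemma finite_monomials: "finite (monomials N d)"
proof (rule finite_subset[OF _ finite_submset[of "repeat_mset d (mset_set {..<N})"]])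
  have "count \<gamma> i \<le> count (repeat_mset d (mset_set {..<N})) i" if "\<gamma> \<in> monomials N d" for \<gamma> i
  proof (cases "i \<in># \<gamma>")
    case True
    then have "i < N" using that by (auto simp: monomials_def)
    then show ?thesis using that count_le_size[of \<gamma> i] by (simp add: monomials_def)
  qed (simp add: not_in_iff)
  then show "monomials N d \<subseteq> {\<alpha>. \<alpha> \<subseteq># repeat_mset d (mset_set {..<N})}"
    by (auto simp: subseteq_mset_def)
qed

definition fillings :: "nat list \<Rightarrow> nat multiset \<Rightarrow> (box \<Rightarrow> nat) set" where
  "fillings lam \<gamma> = {T \<in> diagram lam \<rightarrow>\<^sub>E UNIV. semistandard (diagram lam) T \<and> image_mset T (mset_set (diagram lam)) = \<gamma>}"

lemma schur_eq_card: "schur lam \<gamma> = of_nat (card (fillings lam \<gamma>))"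
  by (simp add: schur_def fillings_def)

lemma schur_eq_0:
  assumes "size \<gamma> \<noteq> psize lam"
  shows "schur lam \<gamma> = 0"
proof -
  have "fillings lam \<gamma> = {}"
    using assms by (auto simp: fillings_def simp flip: card_diagram)
  then show ?thesis by (simp add: schur_eq_card)
qed

text \<open>Tableaux are grouped by content. The coefficients are written as cardinalities because
  the formula is applied over the rationals and over rational polynomials, while
  \<open>schur\<close> has values in the rationals.\<close>

lemma tableaux_sum_eq:
  fixes x :: "nat \<Rightarrow> 'a :: comm_ring_1"
  shows "tableaux_sum N (part lam) x =
    (\<Sum>\<gamma>\<in>monomials N (psize lam). of_nat (card (fillings lam \<gamma>)) * (\<Prod>i<N. x i ^ count \<gamma> i))"
proof -
  let ?w = "\<lambda>T. image_mset T (mset_set (diagram lam))"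
  have fin: "finite (tableaux N (part lam))"
    using finite_diagram[of lam] by (intro finite_tableaux) (simp add: diagram_eq_shape)
  have w: "?w T \<in> monomials N (psize lam)" if "T \<in> tableaux N (part lam)" for T
    using tableau_less[OF that] by (auto simp: monomials_def finite_diagram card_diagram simp flip: diagram_eq_shape)
  have fill: "{T \<in> tableaux N (part lam). ?w T = \<gamma>} = fillings lam \<gamma>" if "\<gamma> \<in> monomials N (psize lam)" for \<gamma>
  proof (intro equalityI subsetI)
    fix T assume T: "T \<in> fillings lam \<gamma>"
    have "T b < N" if "b \<in> diagram lam" for b
    proof -
      have "T b \<in># \<gamma>" using T that by (auto simp: fillings_def finite_diagram)
      then show ?thesis using \<open>\<gamma> \<in> monomials N (psize lam)\<close> by (auto simp: monomials_def)
    qed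
    then show "T \<in> {T \<in> tableaux N (part lam). ?w T = \<gamma>}"
      using T by (auto simp: fillings_def tableaux_def PiE_def simp flip: diagram_eq_shape)
  qed (auto simp: fillings_def tableaux_def PiE_def simp flip: diagram_eq_shape)
  have "tableaux_sum N (part lam) x = (\<Sum>\<gamma>\<in>monomials N (psize lam). \<Sum>T | T \<in> tableaux N (part lam) \<and> ?w T = \<gamma>. \<Prod>b\<in>diagram lam. x (T b))"
    unfolding tableaux_sum_def diagram_eq_shape[symmetric]
    by (rule sum.group[symmetric]) (use fin finite_monomials w in auto)
  also have "\<dots> = (\<Sum>\<gamma>\<in>monomials N (psize lam). \<Sum>T | T \<in> tableaux N (part lam) \<and> ?w T = \<gamma>. \<Prod>i<N. x i ^ count \<gamma> i)"
  proof (intro sum.cong refl)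
    fix \<gamma> T assume "\<gamma> \<in> monomials N (psize lam)" "T \<in> {T \<in> tableaux N (part lam). ?w T = \<gamma>}"
    then have \<gamma>: "set_mset \<gamma> \<subseteq> {..<N}" "?w T = \<gamma>" by (auto simp: monomials_def)
    have "(\<Prod>b\<in>diagram lam. x (T b)) = prod_mset (image_mset x (?w T))"
      by (simp add: prod_unfold_prod_mset image_mset.compositionality o_def)
    also have "\<dots> = (\<Prod>i\<in>set_mset \<gamma>. x i ^ count \<gamma> i)"
      by (simp add: \<gamma>(2) image_prod_mset_multiplicity)
    also have "\<dots> = (\<Prod>i<N. x i ^ count \<gamma> i)"
      using \<gamma>(1) by (intro prod.mono_neutral_left) (auto simp: not_in_iff)
    finally show "(\<Prod>b\<in>diagram lam. x (T b)) = (\<Prod>i<N. x i ^ count \<gamma> i)" .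
  qed
  also have "\<dots> = (\<Sum>\<gamma>\<in>monomials N (psize lam). of_nat (card (fillings lam \<gamma>)) * (\<Prod>i<N. x i ^ count \<gamma> i))"
    by (intro sum.cong refl) (simp add: fill)
  finally show ?thesis .
qed

lemma tableaux_sum_schur:
  "tableaux_sum N (part lam) x = (\<Sum>\<gamma>\<in>monomials N (psize lam). schur lam \<gamma> * (\<Prod>i<N. x i ^ count \<gamma> i))"
  by (simp add: tableaux_sum_eq schur_eq_card)

text \<open>Identifies differentiation along the flow with the formal \<open>D\<^sub>r\<close>,
  coefficient by coefficient: \<open>D\<^sub>r\<close> turns a monomial into the monomials with
  \<open>r\<close> further copies of one index \<open>i\<close>, weighted by the old exponent of
  \<open>i\<close>.\<close>

lemma flow_deriv_tableaux_sum_schur: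
  assumes r: "r \<ge> 1"
  shows "flow_deriv (tableaux_sum N (part lam) (flow r x)) =
    (\<Sum>\<gamma>\<in>monomials N (psize lam + r). subst_coeff r 1 (schur lam) \<gamma> * (\<Prod>i<N. x i ^ count \<gamma> i))"
proof -
  have sub: "{i. r \<le> count \<gamma> i} \<subseteq> {..<N}" if "\<gamma> \<in> monomials N d" for \<gamma> d
  proof
    fix i assume "i \<in> {i. r \<le> count \<gamma> i}"
    then have "i \<in># \<gamma>" using r by (simp flip: count_greater_zero_iff)
    then show "i \<in> {..<N}" using that by (auto simp: monomials_def)
  qed
  have fin: "finite {i. r \<le> count \<gamma> i}" if "\<gamma> \<in> monomials N d" for \<gamma> d
    by (rule finite_subset[OF sub[OF that]]) simp
  have "(\<Sum>\<gamma>\<in>monomials N (psize lam + r). subst_coeff r 1 (schur lam) \<gamma> * (\<Prod>i<N. x i ^ count \<gamma> i))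
    = (\<Sum>\<gamma>\<in>monomials N (psize lam + r). \<Sum>i | r \<le> count \<gamma> i.
        of_nat (count \<gamma> i - r) * schur lam (\<gamma> - replicate_mset r i) * (\<Prod>i<N. x i ^ count \<gamma> i))"
    by (simp only: subst_coeff_1[OF r] sum_distrib_right)
  also have "\<dots> = (\<Sum>(\<gamma>, i)\<in>Sigma (monomials N (psize lam + r)) (\<lambda>\<gamma>. {i. r \<le> count \<gamma> i}).
        of_nat (count \<gamma> i - r) * schur lam (\<gamma> - replicate_mset r i) * (\<Prod>i<N. x i ^ count \<gamma> i))"
    by (rule sum.Sigma[OF finite_monomials]) (intro ballI, erule fin)
  also have "\<dots> = (\<Sum>(\<gamma>, i)\<in>monomials N (psize lam) \<times> {..<N}.
        of_nat (count \<gamma> i) * schur lam \<gamma> * (x i ^ r * (\<Prod>i<N. x i ^ count \<gamma> i)))"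
  proof (rule sum.reindex_bij_witness[where j = "\<lambda>(\<gamma>, i). (\<gamma> - replicate_mset r i, i)"
        and i = "\<lambda>(\<gamma>, i). (\<gamma> + replicate_mset r i, i)"])
    fix z assume "z \<in> Sigma (monomials N (psize lam + r)) (\<lambda>\<gamma>. {i. r \<le> count \<gamma> i})"
    then obtain \<gamma> i where z: "z = (\<gamma>, i)" "\<gamma> \<in> monomials N (psize lam + r)" "r \<le> count \<gamma> i" by auto
    have i: "i < N" using sub[OF z(2)] z(3) by auto
    have "replicate_mset r i \<subseteq># \<gamma>" using z(3) by (auto simp: subseteq_mset_def)
    from subset_mset.diff_add[OF this, symmetric] obtain \<delta> where \<delta>: "\<gamma> = \<delta> + replicate_mset r i" by (rule that)
    show "(case (case z of (\<gamma>, i) \<Rightarrow> (\<gamma> - replicate_mset r i, i)) of (\<gamma>, i) \<Rightarrow> (\<gamma> + replicate_mset r i, i)) = z"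
      by (simp add: z(1) \<delta>)
    show "(case z of (\<gamma>, i) \<Rightarrow> (\<gamma> - replicate_mset r i, i)) \<in> monomials N (psize lam) \<times> {..<N}"
      using z(2) i by (auto simp: z(1) \<delta> monomials_def)
    have "(\<Prod>j<N. x j ^ count \<gamma> j) = (\<Prod>j<N. x j ^ ((count \<delta>)(i := count \<delta> i + r)) j)"
      by (rule prod.cong) (auto simp: \<delta>)
    also have "\<dots> = x i ^ r * (\<Prod>j<N. x j ^ count \<delta> j)"
      using prod_power_upd[of "{..<N}" i x "\<lambda>i. i" "count \<delta>" r] i by simp
    finally show "(case (case z of (\<gamma>, i) \<Rightarrow> (\<gamma> - replicate_mset r i, i)) of
        (\<gamma>, i) \<Rightarrow> of_nat (count \<gamma> i) * schur lam \<gamma> * (x i ^ r * (\<Prod>i<N. x i ^ count \<gamma> i)))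
      = (case z of (\<gamma>, i) \<Rightarrow> of_nat (count \<gamma> i - r) * schur lam (\<gamma> - replicate_mset r i) * (\<Prod>i<N. x i ^ count \<gamma> i))"
      by (simp add: z(1)) (simp add: \<delta>)
  qed (auto simp: monomials_def split: if_splits)
  also have "\<dots> = (\<Sum>\<gamma>\<in>monomials N (psize lam). \<Sum>i<N. of_nat (count \<gamma> i) * schur lam \<gamma> * (x i ^ r * (\<Prod>i<N. x i ^ count \<gamma> i)))"
    by (rule sum.Sigma[symmetric]) (auto simp: finite_monomials)
  also have "\<dots> = flow_deriv (tableaux_sum N (part lam) (flow r x))"
    unfolding tableaux_sum_eq flow_deriv_sum flow_deriv_of_nat_mult flow_deriv_prod[OF finite_lessThan] schur_eq_card
    by (simp add: sum_distrib_left sum_distrib_right mult_ac)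
  finally show ?thesis by simp
qed

lemma base_expansion_inject:
  fixes M :: nat
  assumes "\<And>i. i < N \<Longrightarrow> a i < M" "\<And>i. i < N \<Longrightarrow> b i < M"
    "(\<Sum>i<N. a i * M ^ i) = (\<Sum>i<N. b i * M ^ i)" "i < N"
  shows "a i = b i"
  using assms
proof (induction N arbitrary: a b i)
  case (Suc N)
  have shift: "(\<Sum>i<Suc N. c i * M ^ i) = c 0 + M * (\<Sum>i<N. c (Suc i) * M ^ i)" for c :: "nat \<Rightarrow> nat"
    by (subst sum.lessThan_Suc_shift) (simp add: sum_distrib_left mult_ac)
  have 0: "a 0 < M" "b 0 < M" using Suc.prems by auto
  have eq: "a 0 + M * (\<Sum>i<N. a (Suc i) * M ^ i) = b 0 + M * (\<Sum>i<N. b (Suc i) * M ^ i)"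
    using Suc.prems(3) by (simp only: shift)
  have "a 0 = (a 0 + M * (\<Sum>i<N. a (Suc i) * M ^ i)) mod M" using 0 by simp
  also have "\<dots> = b 0" unfolding eq using 0 by simp
  finally have a0: "a 0 = b 0" .
  with eq 0 have "(\<Sum>i<N. a (Suc i) * M ^ i) = (\<Sum>i<N. b (Suc i) * M ^ i)" by simp
  with Suc.IH[of "\<lambda>i. a (Suc i)" "\<lambda>i. b (Suc i)"] Suc.prems(1,2,4) a0 show ?case
    by (cases i) auto
qed simp

lemma alternant_delta_nonzero:
  fixes x :: "nat \<Rightarrow> 'a :: idom"
  assumes "inj_on x {..<N}"
  shows "alternant N (delta N) x \<noteq> 0"
  using assms
proof (induction N)
  case (Suc N)
  have "x j \<noteq> x N" if "j < N" for j
    using inj_onD[OF Suc.prems, of j N] that by auto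
  with Suc show ?case by (auto simp: alternant_delta_Suc inj_on_subset)
qed (simp add: alternant_def)

text \<open>Kronecker substitution \<open>x\<^sub>i = y\<^bsup>M^i\<^esup>\<close> with \<open>M > d\<close>.\<close>
lemma monomials_independent:
  fixes c :: "nat multiset \<Rightarrow> rat"
  assumes zero: "\<And>x. inj_on x {..<N} \<Longrightarrow> (\<Sum>\<gamma>\<in>monomials N d. c \<gamma> * (\<Prod>i<N. x i ^ count \<gamma> i)) = 0"
    and \<gamma>: "\<gamma> \<in> monomials N d"
  shows "c \<gamma> = 0"
proof -
  \<comment> \<open>The base must exceed the exponents, which are at most \<open>d\<close>, and must
    be at least 2 even for \<open>d = 0\<close>, so that the powers \<open>M ^ i\<close> are
    distinct.\<close>
  define M where "M = d + 2"
  define e where "e \<gamma> = (\<Sum>i<N. count \<gamma> i * M ^ i)" for \<gamma> :: "nat multiset"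
  define p where "p = (\<Sum>\<gamma>\<in>monomials N d. monom (c \<gamma>) (e \<gamma>))"
  have cnt: "count \<gamma> i < M" if "\<gamma> \<in> monomials N d" for \<gamma> i
    using that count_le_size[of \<gamma> i] by (simp add: monomials_def M_def)
  have inj: "inj_on e (monomials N d)"
  proof (rule inj_onI, rule multiset_eqI)
    fix \<alpha> \<beta> i assume *: "\<alpha> \<in> monomials N d" "\<beta> \<in> monomials N d" "e \<alpha> = e \<beta>"
    show "count \<alpha> i = count \<beta> i"
    proof (cases "i < N")
      case True
      show ?thesis
        by (rule base_expansion_inject[OF cnt[OF *(1)] cnt[OF *(2)] *(3)[unfolded e_def] True])
    next
      case False
      with * have "i \<notin># \<alpha>" "i \<notin># \<beta>" by (auto simp: monomials_def)
      then show ?thesis by (simp add: not_in_iff)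
    qed
  qed
  \<comment> \<open>The hypothesis only covers pairwise distinct values. Every integer from 2 on,
    substituted for \<open>y\<close>, yields such values, and infinitely many zeros force
    \<open>p = 0\<close>.\<close>
  have "poly p (of_nat (n + 2)) = 0" for n
  proof -
    let ?y = "of_nat (n + 2) :: rat"
    have y: "1 < ?y" by simp
    have "inj_on (\<lambda>i. ?y ^ (M ^ i)) {..<N}"
    proof (rule inj_onI)
      fix i j assume "?y ^ (M ^ i) = ?y ^ (M ^ j)"
      then have "M ^ i = M ^ j" by (simp only: power_inject_exp[OF y])
      then show "i = j" by (simp add: M_def)
    qed
    from zero[OF this] show ?thesis
      by (simp only: p_def poly_sum poly_monom e_def power_sum power_mult[symmetric] mult.commute)
  qed
  then have "range (\<lambda>n. of_nat (n + 2)) \<subseteq> {y. poly p y = 0}" by auto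
  moreover have "infinite (range (\<lambda>n. of_nat (n + 2) :: rat))"
    by (rule range_inj_infinite) (auto simp: inj_on_def)
  ultimately have "infinite {y. poly p y = 0}" using finite_subset by blast
  then have "p = 0" using poly_roots_finite by blast
  then have "0 = coeff p (e \<gamma>)" by simp
  also have "\<dots> = (\<Sum>\<beta>\<in>monomials N d. if \<beta> = \<gamma> then c \<beta> else 0)"
    unfolding p_def coeff_sum by (intro sum.cong refl) (use inj_onD[OF inj _ _ \<gamma>] in auto)
  also have "\<dots> = c \<gamma>" using \<gamma> by (simp add: finite_monomials)
  finally show ?thesis by simp
qed

text \<open>A coefficient at a fixed \<gamma> involves finitely many variables, so the identity can
  be tested in \<open>N\<close> variables at points where the Vandermonde determinant is nonzero and
  may be cancelled. Both sides are homogeneous, which disposes of \<gamma> of any other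
  degree.\<close>

lemma subst_coeff_1_schur:
  assumes r: "r \<ge> 1" and lam: "is_partition lam"
    and red: "\<And>N x. N \<ge> psize lam + r \<Longrightarrow> reduced_deriv N r (\<lambda>i. part lam i + delta N i) x =
      (\<Sum>mu\<in>extensions lam r. of_int (d_coeff lam mu) * alternant N (\<lambda>i. part mu i + delta N i) x)"
  shows "subst_coeff r 1 (schur lam) \<gamma> = (\<Sum>mu\<in>extensions lam r. of_int (d_coeff lam mu) * schur mu \<gamma>)"
proof (cases "size \<gamma> = psize lam + r")
  case False
  have "schur lam (\<gamma> - replicate_mset r i) = 0" if "r \<le> count \<gamma> i" for i
  proof (rule schur_eq_0)
    have "size (\<gamma> - replicate_mset r i) = size \<gamma> - r"
      using that by (subst size_Diff_submset) (auto simp: subseteq_mset_def)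
    moreover have "r \<le> size \<gamma>" using that count_le_size[of \<gamma> i] by simp
    ultimately show "size (\<gamma> - replicate_mset r i) \<noteq> psize lam" using False by simp
  qed
  then have "subst_coeff r 1 (schur lam) \<gamma> = 0" unfolding subst_coeff_1[OF r] by (intro sum.neutral) auto
  moreover have "schur mu \<gamma> = 0" if "mu \<in> extensions lam r" for mu
    using that False by (intro schur_eq_0) (simp add: extensions_def)
  ultimately show ?thesis by simp
next
  case True
  \<comment> \<open>Larger than every index occurring in \<gamma>, and large enough for every
    \<open>mu\<close> in \<open>extensions lam r\<close> to have at most \<open>N\<close>
    rows.\<close>
  define N where "N = psize lam + r + Suc (sum_mset \<gamma>)"
  let ?S = "\<lambda>\<gamma>. \<Sum>mu\<in>extensions lam r. of_int (d_coeff lam mu) * schur mu \<gamma>"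
  have "i < N" if "i \<in># \<gamma>" for i
    using sum_mset.remove[OF that] by (simp add: N_def)
  then have \<gamma>: "\<gamma> \<in> monomials N (psize lam + r)" using True by (auto simp: monomials_def)
  have "subst_coeff r 1 (schur lam) \<gamma> - ?S \<gamma> = 0"
  proof (rule monomials_independent[OF _ \<gamma>])
    fix x :: "nat \<Rightarrow> rat" assume "inj_on x {..<N}"
    then have nz: "alternant N (delta N) x \<noteq> 0" by (rule alternant_delta_nonzero)
    let ?m = "\<lambda>\<gamma>. \<Prod>i<N. x i ^ count \<gamma> i"
    have "(\<Sum>\<gamma>\<in>monomials N (psize lam + r). ?S \<gamma> * ?m \<gamma>)
      = (\<Sum>mu\<in>extensions lam r. of_int (d_coeff lam mu) * (\<Sum>\<gamma>\<in>monomials N (psize lam + r). schur mu \<gamma> * ?m \<gamma>))"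
      unfolding sum_distrib_right sum_distrib_left by (subst sum.swap) (simp add: mult.assoc)
    also have "\<dots> = (\<Sum>mu\<in>extensions lam r. of_int (d_coeff lam mu) * tableaux_sum N (part mu) x)"
      by (intro sum.cong refl) (simp add: tableaux_sum_schur extensions_def)
    finally have "(\<Sum>\<gamma>\<in>monomials N (psize lam + r). ?S \<gamma> * ?m \<gamma>) * alternant N (delta N) x
      = (\<Sum>mu\<in>extensions lam r. of_int (d_coeff lam mu) * (tableaux_sum N (part mu) x * alternant N (delta N) x))"
      by (simp add: sum_distrib_right mult.assoc)
    also have "\<dots> = (\<Sum>mu\<in>extensions lam r. of_int (d_coeff lam mu) * alternant N (\<lambda>i. part mu i + delta N i) x)"
    proof (intro sum.cong refl arg_cong2[of _ _ _ _ "(*)"] tableaux_sum_alternant antimono_part)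
      fix mu i assume mu: "mu \<in> extensions lam r"
      then show "is_partition mu" by (simp add: extensions_def)
      assume "N \<le> i"
      with mu show "part mu i = 0" by (intro part_eq_0) (auto simp: extensions_def N_def)
    qed
    also have "\<dots> = reduced_deriv N r (\<lambda>i. part lam i + delta N i) x"
      by (rule red[symmetric]) (simp add: N_def)
    also have "\<dots> = flow_deriv (tableaux_sum N (part lam) (flow r x)) * alternant N (delta N) x"
      using lam by (intro flow_deriv_tableaux_sum[symmetric] r antimono_part part_eq_0) (auto simp: N_def)
    finally have "(\<Sum>\<gamma>\<in>monomials N (psize lam + r). ?S \<gamma> * ?m \<gamma>) = flow_deriv (tableaux_sum N (part lam) (flow r x))"
      using nz by simp
    also note flow_deriv_tableaux_sum_schur[OF r]
    finally show "(\<Sum>\<gamma>\<in>monomials N (psize lam + r). (subst_coeff r 1 (schur lam) \<gamma> - ?S \<gamma>) * ?m \<gamma>) = 0"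
      by (simp add: left_diff_distrib sum_subtractf)
  qed
  then show ?thesis by simp
qed

section \<open>Border strips\<close>

definition skew_shape :: "(nat \<Rightarrow> nat) \<Rightarrow> (nat \<Rightarrow> nat) \<Rightarrow> box set" where
  "skew_shape l m = {(i, j). l i \<le> j \<and> j < m i}"

lemma skew_eq_skew_shape: "skew lam mu = skew_shape (part lam) (part mu)"
  by (auto simp: skew_def diagram_eq_shape shape_def skew_shape_def)

definition nonempty_rows :: "(nat \<Rightarrow> nat) \<Rightarrow> (nat \<Rightarrow> nat) \<Rightarrow> nat set" where
  "nonempty_rows l m = {i. l i < m i}"

text \<open>The top nonempty_rows of the connected components.\<close>
definition tops :: "(nat \<Rightarrow> nat) \<Rightarrow> (nat \<Rightarrow> nat) \<Rightarrow> nat set" where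
  "tops l m = {i. l i < m i \<and> (\<forall>i'. i = Suc i' \<longrightarrow> m i \<le> l i')}"

lemma height_skew_shape: "height (skew_shape l m) = card (nonempty_rows l m) - 1"
proof -
  have "fst ` skew_shape l m = nonempty_rows l m"
    by (force simp: skew_shape_def nonempty_rows_def image_iff)
  then show ?thesis by (simp add: height_def)
qed

text \<open>Rows \<open>i\<close> and \<open>Suc i\<close> of \<open>m / l\<close> can share only
  the columns from \<open>l i\<close> to \<open>m (Suc i) - 1\<close>; a 2 by 2 block needs two of
  them.\<close>

lemma broken_border_strip_skew_shape:
  assumes "antimono l" "antimono m"
  shows "broken_border_strip (skew_shape l m) \<longleftrightarrow> (\<forall>i. m (Suc i) \<le> Suc (l i))"
proof -
  have l: "l (Suc i) \<le> l i" and m: "m (Suc i) \<le> m i" for i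
    using assms by (auto intro: antimonoD)
  have "{(i, j), (i, Suc j), (Suc i, j), (Suc i, Suc j)} \<subseteq> skew_shape l m \<longleftrightarrow> l i \<le> j \<and> Suc j < m (Suc i)" for i j
    using l[of i] m[of i] by (auto simp: skew_shape_def)
  then have "broken_border_strip (skew_shape l m) \<longleftrightarrow> (\<forall>i j. \<not> (l i \<le> j \<and> Suc j < m (Suc i)))"
    unfolding broken_border_strip_def by (simp only: not_ex)
  also have "\<dots> \<longleftrightarrow> (\<forall>i. m (Suc i) \<le> Suc (l i))"
  proof (intro iff_allI iffI)
    fix i assume *: "\<forall>j. \<not> (l i \<le> j \<and> Suc j < m (Suc i))"
    show "m (Suc i) \<le> Suc (l i)" using *[rule_format, of "l i"] by simp
  qed auto
  finally show ?thesis .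
qed

text \<open>From any box one walks left to the start of its row and up as long as the row shares a
  column with the one above, and so reaches the first box of a top row. Different tops are not
  connected, because the set \<open>h\<close> of tops at or above the row of a box is invariant
  under adjacency.\<close>

lemma card_components_skew_shape:
  assumes "antimono l" "antimono m"
  shows "card (components (skew_shape l m)) = card (tops l m)"
proof -
  let ?S = "skew_shape l m"
  define R where "R = {(b, c). b \<in> ?S \<and> c \<in> ?S \<and> adjacent b c}"
  define h where "h b = {t \<in> tops l m. t \<le> fst b}" for b :: box
  have l: "l (Suc i) \<le> l i" and m: "m (Suc i) \<le> m i" for i
    using assms by (auto intro: antimonoD)
  have "sym R" by (auto simp: R_def sym_def adjacent_def)
  then have sym: "(c, b) \<in> R\<^sup>*" if "(b, c) \<in> R\<^sup>*" for b c
    using that by (metis sym_rtrancl symD)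
  have h_vert: "h (i, j) = h (Suc i, j')" if "(i, j) \<in> ?S" "(Suc i, j) \<in> ?S" for i j j'
  proof -
    have "Suc i \<notin> tops l m" using that by (auto simp: tops_def skew_shape_def)
    then show ?thesis by (auto simp: h_def le_Suc_eq)
  qed
  have h_R: "h b = h c" if "(b, c) \<in> R" for b c
  proof -
    obtain i j i' j' where bc: "b = (i, j)" "c = (i', j')" by (cases b, cases c)
    with that have S: "(i, j) \<in> ?S" "(i', j') \<in> ?S" and "adjacent (i, j) (i', j')" by (auto simp: R_def)
    then have "i = i' \<or> i' = Suc i \<and> j = j' \<or> i = Suc i' \<and> j = j'"
      unfolding adjacent_def fst_conv snd_conv by linarith
    then consider "i = i'" | "i' = Suc i" "j = j'" | "i = Suc i'" "j = j'" by blast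
    then show ?thesis
      using S h_vert by cases (auto simp: bc h_def)
  qed
  have h_rtrancl: "h b = h c" if "(b, c) \<in> R\<^sup>*" for b c
    using that by induction (auto dest: h_R)
  have horiz: "((i, j), (i, l i)) \<in> R\<^sup>*" if "(i, j) \<in> ?S" for i j
  proof -
    have "l i \<le> j" using that by (simp add: skew_shape_def)
    then show ?thesis using that
    proof (induction j rule: dec_induct)
      case (step j)
      then have "((i, Suc j), (i, j)) \<in> R" by (auto simp: R_def skew_shape_def adjacent_def)
      moreover have "((i, j), (i, l i)) \<in> R\<^sup>*" using step by (simp add: skew_shape_def)
      ultimately show ?case by (rule converse_rtrancl_into_rtrancl)
    qed simp
  qed
  have to_top: "\<exists>t\<in>tops l m. h (i, j) = {t' \<in> tops l m. t' \<le> t} \<and> ((i, j), (t, l t)) \<in> R\<^sup>*"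
    if "(i, j) \<in> ?S" for i j
    using that
  proof (induction i arbitrary: j)
    case 0
    then have "0 \<in> tops l m" by (auto simp: tops_def skew_shape_def)
    then show ?case using horiz[OF 0] by (intro bexI[of _ 0]) (auto simp: h_def)
  next
    case (Suc i)
    show ?case
    proof (cases "Suc i \<in> tops l m")
      case True
      then show ?thesis using horiz[OF Suc.prems] by (intro bexI[of _ "Suc i"]) (auto simp: h_def)
    next
      case False
      then have lt: "l i < m (Suc i)" using Suc.prems by (auto simp: tops_def skew_shape_def)
      then have box: "(i, l i) \<in> ?S" "(Suc i, l i) \<in> ?S" using l[of i] m[of i] by (auto simp: skew_shape_def)
      then have "((Suc i, l i), (i, l i)) \<in> R" by (auto simp: R_def adjacent_def)
      moreover have "((Suc i, j), (Suc i, l i)) \<in> R\<^sup>*"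
        using horiz[OF Suc.prems] sym[OF horiz[OF box(2)]] by (rule rtrancl_trans)
      ultimately have path: "((Suc i, j), (i, l i)) \<in> R\<^sup>*" by (rule rtrancl_into_rtrancl[rotated])
      obtain t where t: "t \<in> tops l m" "h (i, l i) = {t' \<in> tops l m. t' \<le> t}" "((i, l i), (t, l t)) \<in> R\<^sup>*"
        using Suc.IH[OF box(1)] by blast
      have "h (Suc i, j) = {t' \<in> tops l m. t' \<le> t}" using h_rtrancl[OF path] t(2) by simp
      then show ?thesis using t rtrancl_trans[OF path t(3)] by blast
    qed
  qed
  have class_eq: "R\<^sup>* `` {b} = R\<^sup>* `` {c}" if "(b, c) \<in> R\<^sup>*" for b c
    using that sym[OF that] by (auto intro: rtrancl_trans)
  have "components ?S = (\<lambda>t. R\<^sup>* `` {(t, l t)}) ` tops l m"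
  proof (intro equalityI subsetI)
    fix C assume "C \<in> components ?S"
    then obtain i j where C: "(i, j) \<in> ?S" "C = R\<^sup>* `` {(i, j)}"
      by (auto simp: components_def R_def[symmetric] elim!: quotientE)
    with to_top[OF C(1)] class_eq show "C \<in> (\<lambda>t. R\<^sup>* `` {(t, l t)}) ` tops l m" by blast
  next
    fix C assume "C \<in> (\<lambda>t. R\<^sup>* `` {(t, l t)}) ` tops l m"
    then obtain t where t: "t \<in> tops l m" "C = R\<^sup>* `` {(t, l t)}" by blast
    then have "(t, l t) \<in> ?S" by (simp add: tops_def skew_shape_def)
    then show "C \<in> components ?S"
      unfolding components_def R_def[symmetric] t(2) by (rule quotientI)
  qed
  moreover have "inj_on (\<lambda>t. R\<^sup>* `` {(t, l t)}) (tops l m)"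
  proof (rule inj_onI)
    fix t t' assume t: "t \<in> tops l m" "t' \<in> tops l m" "R\<^sup>* `` {(t, l t)} = R\<^sup>* `` {(t', l t')}"
    then have "((t, l t), (t', l t')) \<in> R\<^sup>*" by blast
    from h_rtrancl[OF this] have "{u \<in> tops l m. u \<le> t} = {u \<in> tops l m. u \<le> t'}" by (simp add: h_def)
    with t(1,2) have "t \<le> t'" "t' \<le> t" by blast+
    then show "t = t'" by simp
  qed
  ultimately show ?thesis by (simp add: card_image)
qed

text \<open>Walking up from a nonempty row until the first top; all rows passed are nonempty and
  overlap the row above.\<close>

lemma row_below_top:
  assumes "antimono m" "i \<in> nonempty_rows l m"
  shows "\<exists>t\<in>tops l m. t \<le> i \<and> {t..i} \<subseteq> nonempty_rows l m \<and> {t<..i} \<inter> tops l m = {}"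
  using assms(2)
proof (induction i)
  case 0
  then show ?case by (intro bexI[of _ 0]) (auto simp: tops_def nonempty_rows_def)
next
  case (Suc i)
  show ?case
  proof (cases "Suc i \<in> tops l m")
    case True
    then show ?thesis using Suc.prems by (intro bexI[of _ "Suc i"]) auto
  next
    case False
    then have "l i < m (Suc i)" using Suc.prems by (auto simp: tops_def nonempty_rows_def)
    also have "m (Suc i) \<le> m i" using assms(1) by (rule antimonoD) simp
    finally have "i \<in> nonempty_rows l m" by (simp add: nonempty_rows_def)
    from Suc.IH[OF this] obtain t where t: "t \<in> tops l m" "t \<le> i" "{t..i} \<subseteq> nonempty_rows l m" "{t<..i} \<inter> tops l m = {}" by blast
    have "{t..Suc i} = insert (Suc i) {t..i}" "{t<..Suc i} = insert (Suc i) {t<..i}" using t(2) by auto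
    with t False Suc.prems show ?thesis by (intro bexI[of _ t]) auto
  qed
qed

text \<open>\<open>m / l\<close> is a border strip with top row \<open>t\<close> and bottom row \<open>b\<close>.\<close>
definition strip :: "(nat \<Rightarrow> nat) \<Rightarrow> (nat \<Rightarrow> nat) \<Rightarrow> nat \<Rightarrow> nat \<Rightarrow> bool" where
  "strip l m t b \<longleftrightarrow> t \<le> b \<and> l t < m t \<and> (\<forall>i. t = Suc i \<longrightarrow> m t \<le> l i) \<and>
     (\<forall>i. t \<le> i \<and> i < b \<longrightarrow> m (Suc i) = Suc (l i)) \<and> (\<forall>i. i < t \<or> b < i \<longrightarrow> m i = l i)"

context
  fixes l m :: "nat \<Rightarrow> nat" and t b :: nat
  assumes l: "antimono l" and strip: "strip l m t b"
begin

lemma strip_l_Suc: "l (Suc i) \<le> l i"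
  using l by (rule antimonoD) simp

lemma strip_row_cases:
  obtains "i < t" "m i = l i" | "i = t" "l i < m i" | i' where "i = Suc i'" "t \<le> i'" "i' < b" "m i = Suc (l i')"
    | "b < i" "m i = l i"
proof -
  consider "i < t" | "i = t" | "t < i" "i \<le> b" | "b < i" by linarith
  then show ?thesis
  proof cases
    case 3
    then obtain i' where "i = Suc i'" by (cases i) auto
    then show ?thesis using 3 strip that(3)[of i'] by (simp add: strip_def)
  qed (use strip that in \<open>auto simp: strip_def\<close>)
qed

lemma strip_ge: "l i \<le> m i"
  by (rule strip_row_cases[of i]) (use strip_l_Suc in \<open>auto intro: le_SucI\<close>)

lemma strip_rows: "nonempty_rows l m = {t..b}"
proof (rule Set.set_eqI)
  fix i show "i \<in> nonempty_rows l m \<longleftrightarrow> i \<in> {t..b}"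
    by (rule strip_row_cases[of i])
      (use strip strip_l_Suc in \<open>auto simp: nonempty_rows_def strip_def less_Suc_eq_le\<close>)
qed

lemma strip_tops: "tops l m = {t}"
proof (rule Set.set_eqI)
  fix i show "i \<in> tops l m \<longleftrightarrow> i \<in> {t}"
    by (rule strip_row_cases[of i])
      (use strip in \<open>auto simp: tops_def strip_def\<close>)
qed

lemma strip_bound: "m (Suc i) \<le> Suc (l i)"
proof (rule strip_row_cases[of "Suc i"])
  assume "Suc i = t"
  then have "m (Suc i) \<le> l i" using strip by (auto simp: strip_def)
  then show ?thesis by simp
qed (use strip_l_Suc[of i] in auto)

lemma strip_antimono: "antimono m"
proof (rule decseq_SucI)
  fix i show "m (Suc i) \<le> m i"
  proof (rule strip_row_cases[of "Suc i"])
    assume "Suc i = t"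
    then have "m (Suc i) \<le> l i" using strip by (auto simp: strip_def)
    then show ?thesis using strip_ge[of i] by simp
  next
    fix i' assume "Suc i = Suc i'" "t \<le> i'" "i' < b" "m (Suc i) = Suc (l i')"
    moreover from this have "i \<in> nonempty_rows l m" by (simp add: strip_rows)
    ultimately show ?thesis by (simp add: nonempty_rows_def)
  qed (use strip_l_Suc[of i] strip_ge[of i] in auto)
qed

text \<open>Besides the first box of the top row, corners occur only in rows \<open>Suc i\<close>
  with \<open>l (Suc i) < l i\<close>: a sharp one in column \<open>l (Suc i)\<close> and a dull one
  in column \<open>l i\<close> of the same row. The content differences telescope to
  \<open>l b - l t\<close>, and the first box has content \<open>l t - t\<close>.\<close>

lemma strip_corner_contents:
  "(\<Sum>c\<in>sharp_corners (skew_shape l m). content c) - (\<Sum>c\<in>dull_corners (skew_shape l m). content c) = int (l b) - int t"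
proof -
  let ?S = "skew_shape l m"
  define I where "I = {i. t \<le> i \<and> i < b \<and> l (Suc i) < l i}"
  have row: "m i = l i" if "i < t" for i using that strip by (simp add: strip_def)
  have t: "t \<le> b" "l t < m t" using strip by (auto simp: strip_def)
  have l_lt: "l i < m i" if "t \<le> i" "i \<le> b" for i
    using that strip_rows by (auto simp: nonempty_rows_def)
  have mS: "m (Suc i) = Suc (l i)" if "t \<le> i" "i < b" for i using that strip by (simp add: strip_def)
  have in_row: "t \<le> i" "i \<le> b" if "(i, j) \<in> ?S" for i j
  proof -
    have "i \<in> nonempty_rows l m" using that by (auto simp: skew_shape_def nonempty_rows_def)
    then show "t \<le> i" "i \<le> b" by (auto simp: strip_rows)
  qed
  have sharp_iff: "(i, j) \<in> sharp_corners ?S \<longleftrightarrow> (i, j) = (t, l t) \<or> (\<exists>i'\<in>I. (i, j) = (Suc i', l (Suc i')))" for i j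
  proof
    assume a: "(i, j) \<in> sharp_corners ?S"
    then have S: "(i, j) \<in> ?S" by (simp add: sharp_corners_def)
    note r = in_row[OF S]
    have j: "j = l i"
    proof (rule ccontr)
      assume "j \<noteq> l i"
      with S obtain j' where "j = Suc j'" "(i, j') \<in> ?S" by (cases j) (auto simp: skew_shape_def)
      with a show False by (auto simp: sharp_corners_def box_left_def)
    qed
    show "(i, j) = (t, l t) \<or> (\<exists>i'\<in>I. (i, j) = (Suc i', l (Suc i')))"
    proof (cases "i = t")
      case False
      with r obtain i' where i': "i = Suc i'" "t \<le> i'" "i' < b" by (cases i) auto
      have "l (Suc i') \<noteq> l i'"
      proof
        assume "l (Suc i') = l i'"
        then have "(i', j) \<in> ?S" using l_lt[of i'] i' by (simp add: skew_shape_def j)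
        with a i' show False by (auto simp: sharp_corners_def box_above_def)
      qed
      then have "i' \<in> I" using i' strip_l_Suc[of i'] by (simp add: I_def)
      with i' j show ?thesis by blast
    qed (use j in simp)
  next
    assume "(i, j) = (t, l t) \<or> (\<exists>i'\<in>I. (i, j) = (Suc i', l (Suc i')))"
    then show "(i, j) \<in> sharp_corners ?S"
    proof
      assume ij: "(i, j) = (t, l t)"
      have "\<not> box_above ?S (t, l t)" using row by (auto simp: box_above_def skew_shape_def)
      then show ?thesis using ij t by (auto simp: sharp_corners_def box_left_def skew_shape_def)
    next
      assume "\<exists>i'\<in>I. (i, j) = (Suc i', l (Suc i'))"
      then obtain i' where "i' \<in> I" "i = Suc i'" "j = l (Suc i')" by auto
      then show ?thesis using l_lt[of "Suc i'"]
        by (auto simp: sharp_corners_def box_left_def box_above_def skew_shape_def I_def)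
    qed
  qed
  have dull_iff: "(i, j) \<in> dull_corners ?S \<longleftrightarrow> (\<exists>i'\<in>I. (i, j) = (Suc i', l i'))" for i j
  proof
    assume a: "(i, j) \<in> dull_corners ?S"
    then obtain i' j' where ij: "i = Suc i'" "(i', j) \<in> ?S" "j = Suc j'" "(i, j') \<in> ?S" "(i', j') \<notin> ?S" and S: "(i, j) \<in> ?S"
      by (auto simp: dull_corners_def box_above_def box_left_def box_northwest_def)
    have "l i' = j" using ij by (auto simp: skew_shape_def)
    moreover have "l (Suc i') < j" using ij by (auto simp: skew_shape_def)
    moreover have "t \<le> i'" "Suc i' \<le> b" using in_row[OF ij(2)] in_row[OF S] ij(1) by auto
    ultimately have "i' \<in> I" "(i, j) = (Suc i', l i')" using ij(1) by (auto simp: I_def)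
    then show "\<exists>i'\<in>I. (i, j) = (Suc i', l i')" by blast
  next
    assume "\<exists>i'\<in>I. (i, j) = (Suc i', l i')"
    then obtain i' where i': "t \<le> i'" "i' < b" "l (Suc i') < l i'" "i = Suc i'" "j = l i'" by (auto simp: I_def)
    then obtain j' where j': "l i' = Suc j'" by (cases "l i'") auto
    have "(i, j) \<in> ?S" "(i', j) \<in> ?S" "(i, j') \<in> ?S" "(i', j') \<notin> ?S"
      using i' j' l_lt[of i'] mS[of i'] by (auto simp: skew_shape_def)
    then show "(i, j) \<in> dull_corners ?S"
      unfolding i'(4,5) j' by (auto simp: dull_corners_def box_above_def box_left_def box_northwest_def)
  qed
  have finI: "finite I" by (rule finite_subset[of _ "{..<b}"]) (auto simp: I_def)
  have "sharp_corners ?S = insert (t, l t) ((\<lambda>i. (Suc i, l (Suc i))) ` I)"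
    using sharp_iff by auto
  moreover have "(t, l t) \<notin> (\<lambda>i. (Suc i, l (Suc i))) ` I" by (auto simp: I_def)
  ultimately have "(\<Sum>c\<in>sharp_corners ?S. content c) = content (t, l t) + (\<Sum>i\<in>I. content (Suc i, l (Suc i)))"
    using finI by (simp add: sum.reindex inj_on_def)
  moreover have "(\<Sum>c\<in>dull_corners ?S. content c) = (\<Sum>i\<in>I. content (Suc i, l i))"
  proof -
    have "dull_corners ?S = (\<lambda>i. (Suc i, l i)) ` I" using dull_iff by auto
    then show ?thesis by (simp add: sum.reindex inj_on_def)
  qed
  ultimately have "(\<Sum>c\<in>sharp_corners ?S. content c) - (\<Sum>c\<in>dull_corners ?S. content c)
      = content (t, l t) + (\<Sum>i\<in>I. int (l (Suc i)) - int (l i))"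
    by (simp add: content_def sum_subtractf sum.distrib)
  also have "(\<Sum>i\<in>I. int (l (Suc i)) - int (l i)) = (\<Sum>i=t..<b. int (l (Suc i)) - int (l i))"
  proof (rule sum.mono_neutral_left)
    show "\<forall>i\<in>{t..<b} - I. int (l (Suc i)) - int (l i) = 0"
    proof
      fix i assume "i \<in> {t..<b} - I"
      then show "int (l (Suc i)) - int (l i) = 0" using strip_l_Suc[of i] by (auto simp: I_def)
    qed
  qed (auto simp: I_def)
  also have "\<dots> = int (l b) - int (l t)" using t(1) by (rule sum_Suc_diff')
  finally show ?thesis by (simp add: content_def)
qed

end

section \<open>Border strips as moves of beta-numbers\<close>

text \<open>The beta-numbers of \<open>l\<close>, which are the exponents of its alternant. In the
  rows below \<open>N\<close> they decrease strictly when \<open>l\<close> is antitone.\<close>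

definition betas :: "nat \<Rightarrow> (nat \<Rightarrow> nat) \<Rightarrow> nat \<Rightarrow> nat" where
  "betas N l i = l i + delta N i"

lemma delta_Suc: "Suc i < N \<Longrightarrow> delta N i = Suc (delta N (Suc i))"
  by (simp add: delta_def)

lemma betas_less:
  assumes "antimono l" "i < j" "j < N"
  shows "betas N l j < betas N l i"
  using antimonoD[OF assms(1), of i j] assms(2,3) by (simp add: betas_def delta_def)

lemma betas_le:
  assumes "antimono l" "i \<le> j" "j < N"
  shows "betas N l j \<le> betas N l i"
  using betas_less[OF assms(1) _ assms(3), of i] assms(2) by (cases "i = j") auto

text \<open>The sequence \<open>e(b := v)\<close> with position \<open>b\<close> moved up to
  \<open>t\<close> and the entries between shifted down; the old \<open>e b\<close> disappears. For
  decreasing \<open>e\<close> this is sorting, if \<open>v\<close> fits above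
  \<open>e t\<close>.\<close>

definition insert_at :: "nat \<Rightarrow> nat \<Rightarrow> nat \<Rightarrow> (nat \<Rightarrow> nat) \<Rightarrow> nat \<Rightarrow> nat" where
  "insert_at t b v e = (\<lambda>j. if j = t then v else if t < j \<and> j \<le> b then e (j - 1) else e j)"

text \<open>A cycle built from \<open>b - t\<close> adjacent transpositions, which yields the sign
  given by the height of a strip. One permutation serves all \<open>v\<close> and
  \<open>e\<close>.\<close>

lemma insert_at_permute:
  assumes "t \<le> b" "b < N"
  shows "\<exists>p. p permutes {0..<N} \<and> sign p = (- 1) ^ (b - t) \<and> (\<forall>v e. insert_at t b v e = e(b := v) \<circ> p)"
  using assms(1)
proof (induction t rule: inc_induct)
  case base
  show ?case
    by (intro exI[of _ id] conjI permutes_id) (auto simp: insert_at_def)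
next
  case (step t)
  then obtain p where p: "p permutes {0..<N}" "sign p = (- 1) ^ (b - Suc t)" "\<And>v e. insert_at (Suc t) b v e = e(b := v) \<circ> p"
    by blast
  let ?q = "Transposition.transpose t (Suc t)"
  have q: "?q permutes {0..<N}" using step assms by (intro permutes_swap_id) auto
  have "sign (p \<circ> ?q) = sign p * sign ?q"
    using p(1) q by (intro sign_compose) (auto simp: permutation_permutes)
  also have "\<dots> = (- 1) ^ (b - t)"
    using step.hyps by (simp add: p(2) sign_swap_id Suc_diff_Suc[symmetric])
  finally have "sign (p \<circ> ?q) = (- 1) ^ (b - t)" .
  moreover have "insert_at t b v e = e(b := v) \<circ> (p \<circ> ?q)" for v e
  proof -
    have "insert_at t b v e = insert_at (Suc t) b v e \<circ> ?q"
      using step.hyps by (auto simp: insert_at_def fun_eq_iff Transposition.transpose_def)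
    then show ?thesis by (simp only: p(3) o_assoc)
  qed
  ultimately show ?case using permutes_compose[OF q p(1)] by blast
qed

lemma alternant_insert_at:
  assumes "t \<le> b" "b < N"
  shows "alternant N (insert_at t b v e) x = (- 1) ^ (b - t) * (alternant N (e(b := v)) x :: rat)"
proof -
  obtain p where "p permutes {0..<N}" "sign p = (- 1) ^ (b - t)" "insert_at t b v e = e(b := v) \<circ> p"
    using insert_at_permute[OF assms] by blast
  then show ?thesis by (simp only: alternant_permute) simp
qed

lemma sum_insert_at:
  assumes "t \<le> b" "b < N"
  shows "(\<Sum>i<N. insert_at t b v e i) + e b = (\<Sum>i<N. e i) + v"
proof -
  obtain p where p: "p permutes {0..<N}" "insert_at t b v e = e(b := v) \<circ> p"
    using insert_at_permute[OF assms] by blast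
  have "(\<Sum>i<N. insert_at t b v e i) = (\<Sum>i<N. (e(b := v)) i)"
    unfolding p(2) lessThan_atLeast0 by (rule sum.permute[OF p(1), symmetric])
  also have "\<dots> = v + (\<Sum>i\<in>{..<N} - {b}. e i)"
    using assms(2) by (subst sum.remove[of _ b]) auto
  finally show ?thesis using assms(2) by (subst (2) sum.remove[of _ b]) auto
qed

context
  fixes l m :: "nat \<Rightarrow> nat" and t b N :: nat
  assumes l: "antimono l" and strip: "strip l m t b" and b: "b < N"
begin

lemma strip_t_le: "t \<le> b"
  using strip by (simp add: strip_def)

text \<open>The key translation. As \<open>delta N\<close> drops by 1 from row to row,
  \<open>m (Suc i) = Suc (l i)\<close> says that row \<open>Suc i\<close> of \<open>m\<close> has
  the beta-number of row \<open>i\<close> of \<open>l\<close>. Adding a strip thus discards the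
  beta-number of the bottom row and inserts a new one at the top row.\<close>

lemma strip_betas:
  assumes "i < N"
  shows "betas N m i = insert_at t b (betas N m t) (betas N l) i"
  by (rule strip_row_cases[OF l strip, of i])
    (use assms strip_t_le delta_Suc in \<open>auto simp: insert_at_def betas_def\<close>)

text \<open>Comparing the sums of all beta-numbers: the inserted value exceeds the discarded one by
  the number of boxes of the strip.\<close>

lemma strip_sum: "(\<Sum>i<N. m i) + betas N l b = (\<Sum>i<N. l i) + betas N m t"
proof -
  have "(\<Sum>i<N. betas N m i) = (\<Sum>i<N. insert_at t b (betas N m t) (betas N l) i)"
    by (intro sum.cong refl) (simp add: strip_betas)
  then have "(\<Sum>i<N. betas N m i) + betas N l b = (\<Sum>i<N. betas N l i) + betas N m t"
    using sum_insert_at[OF strip_t_le b] by simp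
  then show ?thesis by (simp add: betas_def sum.distrib)
qed

text \<open>With \<open>strip_betas_above\<close> this places the new value between the beta-numbers
  of rows \<open>t - 1\<close> and \<open>t\<close>. It is therefore new, and it determines
  \<open>t\<close>.\<close>

lemma strip_betas_below:
  assumes "t \<le> i" "i < N"
  shows "betas N l i < betas N m t"
proof -
  have "betas N l i \<le> betas N l t" using assms by (intro betas_le l)
  also have "\<dots> < betas N m t" using strip by (simp add: strip_def betas_def)
  finally show ?thesis .
qed

lemma strip_betas_above:
  assumes "i < t"
  shows "betas N m t < betas N l i"
proof -
  obtain t' where t': "t = Suc t'" using assms by (cases t) auto
  then have "m t \<le> l t'" using strip by (simp add: strip_def)
  moreover have "Suc t' < N" using t' strip_t_le b by simp
  ultimately have "betas N m t < betas N l t'" by (simp add: betas_def t' delta_Suc)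
  also have "\<dots> \<le> betas N l i" using assms \<open>Suc t' < N\<close> t' by (intro betas_le l) auto
  finally show ?thesis .
qed

lemma strip_betas_new:
  assumes "i < N"
  shows "betas N l i \<noteq> betas N m t"
  using strip_betas_below[of i] strip_betas_above[of i] assms by (cases "i < t") auto

lemma alternant_strip: "alternant N (betas N m) x = (- 1) ^ (b - t) * (alternant N ((betas N l)(b := betas N m t)) x :: rat)"
proof -
  have "alternant N (betas N m) x = alternant N (insert_at t b (betas N m t) (betas N l)) x"
    by (intro alternant_cong strip_betas)
  then show ?thesis by (simp only: alternant_insert_at[OF strip_t_le b])
qed

end

lemma strip_unique:
  assumes l: "antimono l" and s: "strip l m t b" "strip l m' t' b" and b: "b < N" and eq: "betas N m t = betas N m' t'"
  shows "m = m'"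
proof -
  have "\<not> t < t'"
    using strip_betas_above[OF l s(2) b, of t] strip_betas_below[OF l s(1) b, of t] strip_t_le[OF l s(1) b] b eq by auto
  moreover have "\<not> t' < t"
    using strip_betas_above[OF l s(1) b, of t'] strip_betas_below[OF l s(2) b, of t'] strip_t_le[OF l s(2) b] b eq by auto
  ultimately have t: "t = t'" by simp
  show ?thesis
  proof
    fix i
    show "m i = m' i"
      by (rule strip_row_cases[OF l s(1), of i])
        (use s(2) t eq in \<open>auto simp: strip_def betas_def\<close>)
  qed
qed

text \<open>The top row is the first row whose beta-number is below \<open>v\<close>. Since
  \<open>v\<close> differs from the beta-number of the row above, it is strictly smaller, which is
  the condition \<open>m t \<le> l i\<close> on a top row.\<close>

lemma strip_exists:
  assumes l: "antimono l" and b: "b < N" and v: "betas N l b < v" "\<And>i. i < N \<Longrightarrow> betas N l i \<noteq> v"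
  obtains m t where "strip l m t b" "betas N m t = v"
proof -
  define t where "t = (LEAST t. betas N l t < v)"
  have t: "betas N l t < v" unfolding t_def by (rule LeastI[of _ b]) (rule v)
  have tb: "t \<le> b" unfolding t_def by (rule Least_le) (rule v)
  define m where "m i = (if i = t then v - delta N t else if t < i \<and> i \<le> b then Suc (l (i - 1)) else l i)" for i
  have "m t \<le> l i" if "t = Suc i" for i
  proof -
    have "\<not> betas N l i < v" unfolding t_def by (rule not_less_Least) (use that in \<open>simp add: t_def\<close>)
    moreover have "betas N l i \<noteq> v" using that tb b by (intro v) simp
    moreover have "delta N i = Suc (delta N t)" using that tb b by (simp add: delta_Suc)
    ultimately show ?thesis by (simp add: m_def betas_def)
  qed
  moreover have "l t < m t" using t by (simp add: m_def betas_def)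
  ultimately have "strip l m t b" using tb by (auto simp: strip_def m_def)
  moreover have "betas N m t = v" using t by (simp add: m_def betas_def)
  ultimately show ?thesis by (rule that)
qed

text \<open>The value of \<open>d_coeff\<close> as a function of the box set, available for shapes
  given by row-length functions.\<close>

definition d_shape :: "box set \<Rightarrow> int" where
  "d_shape S = (if border_strip S then
       (- 1) ^ height S * ((\<Sum>b\<in>sharp_corners S. content b) - (\<Sum>b\<in>dull_corners S. content b))
     else if broken_border_strip S \<and> card (components S) = 2 then (- 1) ^ height S
     else 0)"

lemma d_coeff_eq_d_shape: "d_coeff lam mu = d_shape (skew_shape (part lam) (part mu))"
  by (simp add: d_coeff_def d_shape_def Let_def skew_eq_skew_shape)

lemma d_shape_strip:
  assumes l: "antimono l" and s: "strip l m t b"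
  shows "broken_border_strip (skew_shape l m)" "d_shape (skew_shape l m) = (- 1) ^ (b - t) * (int (l b) - int t)"
proof -
  show bbs: "broken_border_strip (skew_shape l m)"
    using strip_bound[OF l s] by (simp add: broken_border_strip_skew_shape l strip_antimono[OF l s])
  then have "border_strip (skew_shape l m)"
    by (simp add: border_strip_def card_components_skew_shape l strip_antimono[OF l s] strip_tops[OF l s])
  moreover have "height (skew_shape l m) = b - t"
    using s by (simp add: height_skew_shape strip_rows[OF l s] strip_def Suc_diff_le)
  ultimately show "d_shape (skew_shape l m) = (- 1) ^ (b - t) * (int (l b) - int t)"
    by (simp add: d_shape_def strip_corner_contents[OF l s])
qed

text \<open>Two border strips, the lower one (rows \<open>t2\<close> to \<open>b2\<close>) inside \<open>n / l\<close> and the upper one inside \<open>m / n\<close>.\<close>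
context
  fixes l m n :: "nat \<Rightarrow> nat" and t1 b1 t2 b2 :: nat
  assumes l: "antimono l" and low: "strip l n t2 b2" and up: "strip n m t1 b1" and sep: "b1 < t2"
begin

lemma double_strip_middle_antimono: "antimono n"
  by (rule strip_antimono[OF l low])

lemma double_strip_antimono: "antimono m"
  by (rule strip_antimono[OF double_strip_middle_antimono up])

lemma double_strip_middle_upper: "i < t2 \<Longrightarrow> n i = l i"
  using low by (simp add: strip_def)

lemma double_strip_lower: "b1 < i \<Longrightarrow> m i = n i"
  using up by (simp add: strip_def)

lemma double_strip_rows: "nonempty_rows l m = {t1..b1} \<union> {t2..b2}"
proof -
  have "i \<in> nonempty_rows l m \<longleftrightarrow> (if i < t2 then i \<in> nonempty_rows n m else i \<in> nonempty_rows l n)" for i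
    using double_strip_middle_upper[of i] double_strip_lower[of i] sep by (auto simp: nonempty_rows_def)
  moreover have "nonempty_rows n m = {t1..b1}" by (rule strip_rows[OF double_strip_middle_antimono up])
  moreover have "nonempty_rows l n = {t2..b2}" by (rule strip_rows[OF l low])
  ultimately show ?thesis using sep by (auto split: if_splits)
qed

lemma double_strip_tops: "tops l m = {t1, t2}"
proof -
  have "i \<in> tops l m \<longleftrightarrow> (if i < t2 then i \<in> tops n m else i \<in> tops l n)" for i
    using double_strip_middle_upper double_strip_lower[of i] sep by (auto simp: tops_def)
  moreover have "tops n m = {t1}" by (rule strip_tops[OF double_strip_middle_antimono up])
  moreover have "tops l n = {t2}" by (rule strip_tops[OF l low])
  moreover have "t1 < t2" using up sep by (simp add: strip_def)
  ultimately show ?thesis by (auto split: if_splits)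
qed

lemma double_strip_broken: "broken_border_strip (skew_shape l m)"
proof -
  have "m (Suc i) \<le> Suc (l i)" for i
  proof (cases "Suc i \<le> b1")
    case True
    then show ?thesis using strip_bound[OF double_strip_middle_antimono up, of i] double_strip_middle_upper[of i] sep by simp
  next
    case False
    then show ?thesis using strip_bound[OF l low, of i] double_strip_lower[of "Suc i"] by simp
  qed
  then show ?thesis by (simp add: broken_border_strip_skew_shape l double_strip_antimono)
qed

lemma double_strip_t1: "t1 \<le> b1" and double_strip_t2: "t2 \<le> b2"
  using low up by (simp_all add: strip_def)

text \<open>The height counts all rows of both strips minus 1, which is one more than the sum of the
  two heights. This extra sign accounts for the minus before the pair sum in
  \<open>reduced_deriv\<close>.\<close>

lemma d_shape_double_strip: "d_shape (skew_shape l m) = - ((- 1) ^ ((b1 - t1) + (b2 - t2)))"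
proof -
  have "card (components (skew_shape l m)) = 2"
    using double_strip_t1 sep by (simp add: card_components_skew_shape l double_strip_antimono double_strip_tops)
  moreover have "card (nonempty_rows l m) = Suc (b1 - t1) + Suc (b2 - t2)"
    using double_strip_t1 double_strip_t2 sep
    by (simp add: double_strip_rows card_Un_disjoint Suc_diff_le)
  then have "height (skew_shape l m) = Suc ((b1 - t1) + (b2 - t2))"
    by (simp add: height_skew_shape)
  ultimately show ?thesis
    using double_strip_broken by (simp add: d_shape_def border_strip_def)
qed

end

text \<open>By \<open>row_below_top\<close> every nonempty row is joined to \<open>t\<close> by
  nonempty rows without another top. Hence these rows form an interval starting at \<open>t\<close>,
  and the bottom row is its maximum.\<close>

lemma strip_of_single_top:
  assumes lm: "antimono m" "\<And>i. l i \<le> m i" and fin: "finite (nonempty_rows l m)"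
    and bound: "\<And>i. m (Suc i) \<le> Suc (l i)" and tops: "tops l m = {t}"
  obtains b where "strip l m t b" "b \<in> nonempty_rows l m"
proof -
  have t: "t \<in> nonempty_rows l m" using tops by (auto simp: tops_def nonempty_rows_def)
  have run: "t \<le> i \<and> {t..i} \<subseteq> nonempty_rows l m \<and> {t<..i} \<inter> tops l m = {}" if "i \<in> nonempty_rows l m" for i
    using row_below_top[OF lm(1) that] by (simp add: tops)
  define b where "b = Max (nonempty_rows l m)"
  have b: "b \<in> nonempty_rows l m" unfolding b_def using fin t by (intro Max_in) auto
  have "m (Suc i) = Suc (l i)" if "t \<le> i" "i < b" for i
  proof -
    have "Suc i \<in> {t..b}" "Suc i \<in> {t<..b}" using that by auto
    then have "Suc i \<in> nonempty_rows l m" "Suc i \<notin> tops l m" using run[OF b] by blast+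
    then show ?thesis using bound[of i] by (auto simp: tops_def nonempty_rows_def)
  qed
  moreover have "m i = l i" if "i < t \<or> b < i" for i
  proof -
    have "i \<notin> nonempty_rows l m"
      using that run[of i] Max_ge[OF fin, of i] by (auto simp flip: b_def)
    then show ?thesis using lm(2)[of i] by (simp add: nonempty_rows_def)
  qed
  moreover have "t \<le> b" using run[OF b] by simp
  moreover have "l t < m t" "\<And>i. t = Suc i \<Longrightarrow> m t \<le> l i" using tops by (auto simp: tops_def)
  ultimately have "strip l m t b" by (simp add: strip_def)
  then show ?thesis using b by (rule that)
qed

lemma strips_of_two_tops:
  assumes lm: "antimono m" "\<And>i. l i \<le> m i" and fin: "finite (nonempty_rows l m)"
    and bound: "\<And>i. m (Suc i) \<le> Suc (l i)" and tops: "tops l m = {t1, t2}" "t1 < t2"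
  obtains n b1 b2 where "strip l n t2 b2" "strip n m t1 b1" "b1 < t2" "b2 \<in> nonempty_rows l m"
proof -
  have t: "t1 \<in> nonempty_rows l m" "t2 \<in> nonempty_rows l m" using tops by (auto simp: tops_def nonempty_rows_def)
  have run: "\<exists>t\<in>{t1, t2}. t \<le> i \<and> {t..i} \<subseteq> nonempty_rows l m \<and> {t<..i} \<inter> {t1, t2} = {}" if "i \<in> nonempty_rows l m" for i
    using row_below_top[OF lm(1) that] by (simp only: tops)
  define b2 where "b2 = Max (nonempty_rows l m)"
  have b2: "b2 \<in> nonempty_rows l m" unfolding b2_def using fin t by (intro Max_in) auto
  have b2_max: "i \<le> b2" if "i \<in> nonempty_rows l m" for i using that fin by (simp add: b2_def)
  define U where "U = nonempty_rows l m \<inter> {..<t2}"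
  define b1 where "b1 = Max U"
  have U: "finite U" "t1 \<in> U" using fin t tops(2) by (auto simp: U_def)
  have "b1 \<in> U" unfolding b1_def using U by (intro Max_in) auto
  then have b1: "b1 \<in> nonempty_rows l m" "b1 < t2" by (auto simp: U_def)
  have b1_max: "i \<le> b1" if "i \<in> nonempty_rows l m" "i < t2" for i using that U by (simp add: b1_def U_def)
  have run2: "{t2..b2} \<subseteq> nonempty_rows l m" "{t2<..b2} \<inter> {t1, t2} = {}"
  proof -
    obtain t where t': "t \<in> {t1, t2}" "t \<le> b2" "{t..b2} \<subseteq> nonempty_rows l m" "{t<..b2} \<inter> {t1, t2} = {}" using run[OF b2] by blast
    have "t = t2" using t'(1,4) b2_max[OF t(2)] tops(2) by auto
    then show "{t2..b2} \<subseteq> nonempty_rows l m" "{t2<..b2} \<inter> {t1, t2} = {}" using t' by auto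
  qed
  have run1: "{t1..b1} \<subseteq> nonempty_rows l m" "{t1<..b1} \<inter> {t1, t2} = {}"
  proof -
    obtain t where t': "t \<in> {t1, t2}" "t \<le> b1" "{t..b1} \<subseteq> nonempty_rows l m" "{t<..b1} \<inter> {t1, t2} = {}" using run[OF b1(1)] by blast
    have "t = t1" using t'(1,2) b1(2) by auto
    then show "{t1..b1} \<subseteq> nonempty_rows l m" "{t1<..b1} \<inter> {t1, t2} = {}" using t' by auto
  qed
  have step: "m (Suc i) = Suc (l i)" if "Suc i \<in> nonempty_rows l m" "Suc i \<notin> {t1, t2}" for i
  proof -
    have "Suc i \<notin> tops l m" using that(2) by (simp only: tops not_False_eq_True)
    then show ?thesis using that(1) bound[of i] by (auto simp: tops_def nonempty_rows_def)
  qed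
  have eq: "m i = l i" if "i \<notin> nonempty_rows l m" for i
    using that lm(2)[of i] by (simp add: nonempty_rows_def)
  have top: "l t < m t" "\<And>i. t = Suc i \<Longrightarrow> m t \<le> l i" if "t \<in> {t1, t2}" for t
    using that unfolding tops(1)[symmetric] by (auto simp: tops_def)
  \<comment> \<open>The intermediate shape: from row \<open>t2\<close> on it agrees with
    \<open>m\<close>, above with \<open>l\<close>, so the lower strip is already added and the upper
    one is not.\<close>
  define n where "n i = (if i < t2 then l i else m i)" for i
  have "strip l n t2 b2"
    unfolding strip_def
  proof (intro conjI allI impI)
    show "t2 \<le> b2" using b2_max[OF t(2)] .
    show "l t2 < n t2" using top(1)[of t2] by (simp add: n_def)
    fix i
    show "n t2 \<le> l i" if "t2 = Suc i" using top(2)[of t2 i] that by (simp add: n_def)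
    show "n (Suc i) = Suc (l i)" if "t2 \<le> i \<and> i < b2"
    proof -
      have "Suc i \<in> {t2..b2}" "Suc i \<in> {t2<..b2}" using that by auto
      then have "m (Suc i) = Suc (l i)" using run2 by (intro step) blast+
      then show ?thesis using that by (simp add: n_def)
    qed
    show "n i = l i" if "i < t2 \<or> b2 < i"
    proof (cases "i < t2")
      case False
      then have "i \<notin> nonempty_rows l m" using that b2_max[of i] by auto
      then show ?thesis using eq False by (simp add: n_def)
    qed (simp add: n_def)
  qed
  moreover have "strip n m t1 b1"
    unfolding strip_def
  proof (intro conjI allI impI)
    show "t1 \<le> b1" using b1_max[OF t(1)] tops(2) by simp
    show "n t1 < m t1" using top(1)[of t1] tops(2) by (simp add: n_def)
    fix i
    show "m t1 \<le> n i" if "t1 = Suc i" using top(2)[of t1 i] that tops(2) by (simp add: n_def)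
    show "m (Suc i) = Suc (n i)" if "t1 \<le> i \<and> i < b1"
    proof -
      have "Suc i \<in> {t1..b1}" "Suc i \<in> {t1<..b1}" using that by auto
      then have "m (Suc i) = Suc (l i)" using run1 by (intro step) blast+
      then show ?thesis using that b1(2) by (simp add: n_def)
    qed
    show "m i = n i" if "i < t1 \<or> b1 < i"
    proof (cases "i < t2")
      case True
      have "i \<notin> nonempty_rows l m"
      proof
        assume i: "i \<in> nonempty_rows l m"
        then have "\<not> b1 < i" using b1_max[OF i True] by simp
        moreover obtain t where "t \<in> {t1, t2}" "t \<le> i" using run[OF i] by blast
        ultimately show False using that True tops(2) by auto
      qed
      then show ?thesis using eq True by (simp add: n_def)
    qed (simp add: n_def)
  qed
  ultimately show ?thesis using b1(2) b2 by (rule that)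
qed

text \<open>Reindexing along a relation. The strips belonging to given exponents come from existence
  statements, so neither direction of the bijection is available as an explicit function.\<close>

lemma sum_bij_rel:
  assumes "\<And>s. s \<in> S \<Longrightarrow> \<exists>t\<in>T. R s t" "\<And>t. t \<in> T \<Longrightarrow> \<exists>s\<in>S. R s t"
    and functional: "\<And>s t t'. R s t \<Longrightarrow> R s t' \<Longrightarrow> t = t'" and inj: "\<And>s s' t. R s t \<Longrightarrow> R s' t \<Longrightarrow> s = s'"
    and "\<And>s t. s \<in> S \<Longrightarrow> t \<in> T \<Longrightarrow> R s t \<Longrightarrow> f s = g t"
  shows "sum f S = sum g T"
proof -
  from assms(1) obtain h where h: "\<And>s. s \<in> S \<Longrightarrow> h s \<in> T \<and> R s (h s)" by metis
  have "bij_betw h S T"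
    unfolding bij_betw_def
  proof (intro conjI inj_onI equalityI subsetI)
    fix s s' assume "s \<in> S" "s' \<in> S" "h s = h s'"
    then show "s = s'" using inj[of s "h s" s'] h by metis
  next
    fix t assume "t \<in> T"
    then obtain s where "s \<in> S" "R s t" using assms(2) by blast
    then have "t = h s" using functional h by blast
    then show "t \<in> h ` S" using \<open>s \<in> S\<close> by blast
  qed (use h in auto)
  then have "sum g T = (\<Sum>s\<in>S. g (h s))" by (rule sum.reindex_bij_betw[symmetric])
  also have "\<dots> = sum f S"
  proof (rule sum.cong[OF refl])
    fix s assume "s \<in> S"
    with h[OF this] assms(5)[of s "h s"] show "g (h s) = f s" by simp
  qed
  finally show ?thesis by simp
qed

section \<open>Matching the reduced derivative with shapes\<close>

text \<open>The counterpart of \<open>extensions\<close> for row-length functions with at most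
  \<open>N\<close> rows.\<close>

definition growths :: "nat \<Rightarrow> nat \<Rightarrow> (nat \<Rightarrow> nat) \<Rightarrow> (nat \<Rightarrow> nat) set" where
  "growths N r l = {m. antimono m \<and> (\<forall>i. l i \<le> m i) \<and> (\<forall>i\<ge>N. m i = 0) \<and> (\<Sum>i<N. m i) = (\<Sum>i<N. l i) + r}"

lemma finite_growths: "finite (growths N r l)"
proof (rule finite_subset)
  let ?K = "(\<Sum>i<N. l i) + r"
  show "growths N r l \<subseteq> {m. \<forall>i. (i \<in> {..<N} \<longrightarrow> m i \<in> {..?K}) \<and> (i \<notin> {..<N} \<longrightarrow> m i = 0)}"
  proof (intro subsetI CollectI allI conjI impI)
    fix m i assume m: "m \<in> growths N r l"
    show "m i \<in> {..?K}" if "i \<in> {..<N}"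
      using m member_le_sum[of i "{..<N}" m] that by (simp add: growths_def)
    show "m i = 0" if "i \<notin> {..<N}" using m that by (simp add: growths_def)
  qed
  show "finite {m. \<forall>i. (i \<in> {..<N} \<longrightarrow> m i \<in> {..?K}) \<and> (i \<notin> {..<N} \<longrightarrow> m i = (0 :: nat))}"
    by (rule finite_set_of_finite_funs) auto
qed

lemma growths_rows:
  assumes "m \<in> growths N r l"
  shows "nonempty_rows l m \<subseteq> {..<N}"
proof
  fix i assume "i \<in> nonempty_rows l m"
  then show "i \<in> {..<N}" using assms by (cases "i < N") (auto simp: growths_def nonempty_rows_def)
qed

context
  fixes l :: "nat \<Rightarrow> nat" and N r :: nat and x :: "nat \<Rightarrow> rat"
  assumes l: "antimono l" and l0: "\<And>i. i \<ge> N \<Longrightarrow> l i = 0" and r: "r \<ge> 1"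
begin

definition "one_strip = {m \<in> growths N r l. broken_border_strip (skew_shape l m) \<and> card (tops l m) = 1}"
definition "two_strips = {m \<in> growths N r l. broken_border_strip (skew_shape l m) \<and> card (tops l m) = 2}"

lemma sum_growths:
  "(\<Sum>m\<in>growths N r l. of_int (d_shape (skew_shape l m)) * alternant N (betas N m) x)
    = (\<Sum>m\<in>one_strip. of_int (d_shape (skew_shape l m)) * alternant N (betas N m) x)
      + (\<Sum>m\<in>two_strips. of_int (d_shape (skew_shape l m)) * alternant N (betas N m) x)"
proof -
  have fin: "finite one_strip" "finite two_strips"
    by (simp_all add: one_strip_def two_strips_def finite_growths)
  have "(\<Sum>m\<in>growths N r l. of_int (d_shape (skew_shape l m)) * alternant N (betas N m) x)
    = (\<Sum>m\<in>one_strip \<union> two_strips. of_int (d_shape (skew_shape l m)) * alternant N (betas N m) x)"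
  proof (rule sum.mono_neutral_right[OF finite_growths])
    show "\<forall>m\<in>growths N r l - (one_strip \<union> two_strips). of_int (d_shape (skew_shape l m)) * alternant N (betas N m) x = 0"
    proof
      fix m assume m: "m \<in> growths N r l - (one_strip \<union> two_strips)"
      then have "card (components (skew_shape l m)) = card (tops l m)"
        by (intro card_components_skew_shape l) (simp add: growths_def)
      with m have "d_shape (skew_shape l m) = 0"
        by (auto simp: one_strip_def two_strips_def d_shape_def border_strip_def)
      then show "of_int (d_shape (skew_shape l m)) * alternant N (betas N m) x = 0" by simp
    qed
  qed (auto simp: one_strip_def two_strips_def)
  also have "\<dots> = (\<Sum>m\<in>one_strip. of_int (d_shape (skew_shape l m)) * alternant N (betas N m) x)
      + (\<Sum>m\<in>two_strips. of_int (d_shape (skew_shape l m)) * alternant N (betas N m) x)"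
    by (rule sum.union_disjoint[OF fin]) (auto simp: one_strip_def two_strips_def)
  finally show ?thesis .
qed

lemma growths_bound:
  assumes "m \<in> growths N r l" "broken_border_strip (skew_shape l m)"
  shows "m (Suc i) \<le> Suc (l i)"
  using assms broken_border_strip_skew_shape[OF l, of m] by (auto simp: growths_def)

lemma strip_zero:
  assumes "strip l m t b" "b < N" "i \<ge> N"
  shows "m i = l i"
  using assms by (simp add: strip_def)

text \<open>The index \<open>j\<close> is the bottom row of the strip; indices where
  \<open>e j + r\<close> is already a beta-number give a repeated exponent and drop out. The rows
  overtaken are those from \<open>t\<close> to \<open>j - 1\<close>, so the coefficient is
  \<open>(l j - j) + (j - t) = l j - t\<close>, the corner sum of
  \<open>strip_corner_contents\<close>. The sign from sorting cancels the one from the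
  height.\<close>

lemma sum_one_strip:
  "(\<Sum>m\<in>one_strip. of_int (d_shape (skew_shape l m)) * alternant N (betas N m) x) =
    (\<Sum>j<N. (of_nat (betas N l j) + 1 - of_nat N + of_nat (card {i. i < j \<and> betas N l i < betas N l j + r}))
      * alternant N ((betas N l)(j := betas N l j + r)) x)"
proof -
  let ?e = "betas N l"
  let ?J = "{j \<in> {..<N}. \<forall>i<N. ?e i \<noteq> ?e j + r}"
  let ?g = "\<lambda>j. (of_nat (?e j) + 1 - of_nat N + of_nat (card {i. i < j \<and> ?e i < ?e j + r})) * alternant N (?e(j := ?e j + r)) x"
  have "(\<Sum>j<N. ?g j) = (\<Sum>j\<in>?J. ?g j)"
  proof (rule sum.mono_neutral_right)
    show "\<forall>j\<in>{..<N} - ?J. ?g j = 0"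
    proof
      fix j assume "j \<in> {..<N} - ?J"
      then obtain i where i: "j < N" "i < N" "?e i = ?e j + r" by auto
      then have "alternant N (?e(j := ?e j + r)) x = 0"
        using r by (intro alternant_repeated[of i _ j]) auto
      then show "?g j = 0" by simp
    qed
  qed auto
  also have "\<dots> = (\<Sum>m\<in>one_strip. of_int (d_shape (skew_shape l m)) * alternant N (betas N m) x)"
  proof (rule sum_bij_rel[symmetric, where R = "\<lambda>m j. j < N \<and> (\<exists>t. strip l m t j \<and> betas N m t = ?e j + r)"])
    fix m assume m: "m \<in> one_strip"
    then have g: "m \<in> growths N r l" and bbs: "broken_border_strip (skew_shape l m)" by (simp_all add: one_strip_def)
    from m obtain t where t: "tops l m = {t}" by (auto simp: one_strip_def card_1_singleton_iff)
    have fin: "finite (nonempty_rows l m)" using growths_rows[OF g] finite_subset by blast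
    obtain b where b: "strip l m t b" "b \<in> nonempty_rows l m"
      using strip_of_single_top[of m l t] g fin growths_bound[OF g bbs] t by (auto simp: growths_def)
    have bN: "b < N" using b(2) growths_rows[OF g] by auto
    have e: "betas N m t = ?e b + r"
      using strip_sum[OF l b(1) bN] g by (simp add: growths_def)
    then have "b \<in> ?J" using bN strip_betas_new[OF l b(1) bN] by auto
    then show "\<exists>j\<in>?J. j < N \<and> (\<exists>t. strip l m t j \<and> betas N m t = ?e j + r)" using bN b e by blast
  next
    fix j assume j: "j \<in> ?J"
    then have jN: "j < N" by simp
    obtain m t where m: "strip l m t j" "betas N m t = ?e j + r"
      using strip_exists[OF l jN, of "?e j + r"] j r by auto
    have "m \<in> growths N r l"
      unfolding growths_def
    proof (intro CollectI conjI allI impI)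
      show "antimono m" by (rule strip_antimono[OF l m(1)])
      show "l i \<le> m i" for i by (rule strip_ge[OF l m(1)])
      show "m i = 0" if "N \<le> i" for i using strip_zero[OF m(1) jN that] l0[OF that] by simp
      show "(\<Sum>i<N. m i) = (\<Sum>i<N. l i) + r" using strip_sum[OF l m(1) jN] m(2) by simp
    qed
    then have "m \<in> one_strip"
      by (simp add: one_strip_def d_shape_strip(1)[OF l m(1)] strip_tops[OF l m(1)])
    then show "\<exists>m\<in>one_strip. j < N \<and> (\<exists>t. strip l m t j \<and> betas N m t = ?e j + r)" using m jN by blast
  next
    fix m j j' assume "j < N \<and> (\<exists>t. strip l m t j \<and> betas N m t = ?e j + r)"
      "j' < N \<and> (\<exists>t. strip l m t j' \<and> betas N m t = ?e j' + r)"
    then obtain t t' where s: "strip l m t j" "strip l m t' j'" by blast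
    have "{t..j} = {t'..j'}" by (rule trans[OF strip_rows[OF l s(1), symmetric] strip_rows[OF l s(2)]])
    moreover have "t \<le> j" "t' \<le> j'" using s by (simp_all add: strip_def)
    ultimately show "j = j'" unfolding Icc_eq_Icc by auto
  next
    fix m m' j assume "j < N \<and> (\<exists>t. strip l m t j \<and> betas N m t = ?e j + r)"
      "j < N \<and> (\<exists>t. strip l m' t j \<and> betas N m' t = ?e j + r)"
    then show "m = m'" using strip_unique[OF l] by metis
  next
    fix m j assume "j < N \<and> (\<exists>t. strip l m t j \<and> betas N m t = ?e j + r)"
    then obtain t where j: "j < N" and s: "strip l m t j" and e: "betas N m t = ?e j + r" by blast
    have tj: "t \<le> j" using s by (simp add: strip_def)
    have "i < j \<and> ?e i < ?e j + r \<longleftrightarrow> i \<in> {t..<j}" for i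
      using strip_betas_below[OF l s j, of i] strip_betas_above[OF l s j, of i] j e by (cases "i < t") auto
    then have "{i. i < j \<and> ?e i < ?e j + r} = {t..<j}" by blast
    then have "of_nat (card {i. i < j \<and> ?e i < ?e j + r}) = (of_nat j - of_nat t :: rat)"
      using tj by (simp add: of_nat_diff)
    moreover have "of_nat (?e j) + 1 - of_nat N = (of_nat (l j) - of_nat j :: rat)"
      using j by (simp add: betas_def delta_def of_nat_diff)
    ultimately have g: "?g j = (of_nat (l j) - of_nat t) * alternant N (?e(j := ?e j + r)) x" by simp
    have "of_int (d_shape (skew_shape l m)) * alternant N (betas N m) x
      = (((- 1) ^ (j - t)) * ((- 1) ^ (j - t))) * ((of_nat (l j) - of_nat t) * alternant N (?e(j := ?e j + r)) x)"
      unfolding d_shape_strip(2)[OF l s] alternant_strip[OF l s j] e by simp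
    also have "((- 1) ^ (j - t)) * ((- 1) ^ (j - t)) = (1 :: rat)"
      by (simp flip: power_mult_distrib)
    finally show "of_int (d_shape (skew_shape l m)) * alternant N (betas N m) x = ?g j" by (simp only: g mult_1_left)
  qed
  finally show ?thesis by simp
qed

text \<open>In a triple \<open>(j, i, a)\<close>, \<open>j\<close> and \<open>i\<close> are the
  bottom rows of the lower and the upper strip, which have \<open>r - a\<close> and \<open>a\<close>
  boxes. The condition \<open>betas N l j + (r - a) < betas N l i\<close> means that the lower strip
  begins below row \<open>i\<close>, which makes the two strips disconnected.\<close>

lemma sum_two_strips:
  "(\<Sum>m\<in>two_strips. of_int (d_shape (skew_shape l m)) * alternant N (betas N m) x) =
    - (\<Sum>j<N. \<Sum>i<j. \<Sum>a | a \<in> {1..<r} \<and> betas N l j + (r - a) < betas N l i.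
        alternant N ((betas N l)(i := betas N l i + a, j := betas N l j + (r - a))) x)"
proof -
  let ?e = "betas N l"
  let ?A = "\<lambda>j i. {a. a \<in> {1..<r} \<and> ?e j + (r - a) < ?e i}"
  let ?I = "SIGMA j:{..<N}. SIGMA i:{..<j}. ?A j i"
  \<comment> \<open>Only triples whose two raised exponents are both new. For the others some third
    row has the same exponent as a raised row, and the alternant vanishes.\<close>
  let ?J = "{(j, i, a) \<in> ?I. (\<forall>i'<N. ?e i' \<noteq> ?e j + (r - a)) \<and> (\<forall>i'<N. ?e i' \<noteq> ?e i + a)}"
  let ?g = "\<lambda>(j, i, a). - alternant N (?e(i := ?e i + a, j := ?e j + (r - a))) x"
  define R where "R m = (\<lambda>(j, i, a). j < N \<and> a \<in> {1..<r} \<and> (\<exists>n t1 t2. strip l n t2 j \<and> strip n m t1 i \<and> i < t2 \<and>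
      betas N n t2 = ?e j + (r - a) \<and> betas N m t1 = ?e i + a))" for m
  have finA: "finite (?A j i)" for j i by (rule finite_subset[of _ "{1..<r}"]) auto
  have "- (\<Sum>j<N. \<Sum>i<j. \<Sum>a\<in>?A j i. alternant N (?e(i := ?e i + a, j := ?e j + (r - a))) x) = (\<Sum>z\<in>?I. ?g z)"
  proof -
    have "(\<Sum>i<j. \<Sum>a\<in>?A j i. alternant N (?e(i := ?e i + a, j := ?e j + (r - a))) x)
      = (\<Sum>(i, a)\<in>(SIGMA i:{..<j}. ?A j i). alternant N (?e(i := ?e i + a, j := ?e j + (r - a))) x)" for j
      by (rule sum.Sigma) (use finA in auto)
    then have "(\<Sum>j<N. \<Sum>i<j. \<Sum>a\<in>?A j i. alternant N (?e(i := ?e i + a, j := ?e j + (r - a))) x)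
      = (\<Sum>j<N. \<Sum>(i, a)\<in>(SIGMA i:{..<j}. ?A j i). alternant N (?e(i := ?e i + a, j := ?e j + (r - a))) x)"
      by (simp only:)
    also have "\<dots> = (\<Sum>(j, i, a)\<in>?I. alternant N (?e(i := ?e i + a, j := ?e j + (r - a))) x)"
      by (rule sum.Sigma) (use finA in \<open>auto intro!: finite_SigmaI\<close>)
    finally show ?thesis by (simp add: sum_negf split_def)
  qed
  also have "\<dots> = (\<Sum>z\<in>?J. ?g z)"
  proof (rule sum.mono_neutral_right)
    show "finite ?I" using finA by (auto intro!: finite_SigmaI)
    show "\<forall>z\<in>?I - ?J. ?g z = 0"
    proof
      fix z assume zIJ: "z \<in> ?I - ?J"
      obtain j i a where z: "z = (j, i, a)" by (metis prod_cases3)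
      then have jia: "j < N" "i < j" "a \<in> {1..<r}" "?e j + (r - a) < ?e i" using zIJ by auto
      have "\<not> ((\<forall>i'<N. ?e i' \<noteq> ?e j + (r - a)) \<and> (\<forall>i'<N. ?e i' \<noteq> ?e i + a))"
        using zIJ jia unfolding z by simp
      then have "(\<exists>i'<N. ?e i' = ?e j + (r - a)) \<or> (\<exists>i'<N. ?e i' = ?e i + a)" by blast
      then have "alternant N (?e(i := ?e i + a, j := ?e j + (r - a))) x = 0"
      proof
        assume "\<exists>i'<N. ?e i' = ?e j + (r - a)"
        then obtain i' where "i' < N" "?e i' = ?e j + (r - a)" by blast
        moreover from this have "i' \<noteq> j" "i' \<noteq> i" using jia by auto
        ultimately show ?thesis using jia by (intro alternant_repeated[of i' _ j]) auto
      next
        assume "\<exists>i'<N. ?e i' = ?e i + a"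
        then obtain i' where "i' < N" "?e i' = ?e i + a" by blast
        moreover from this have "i' \<noteq> j" "i' \<noteq> i" using jia by auto
        ultimately show ?thesis using jia by (intro alternant_repeated[of i' _ i]) auto
      qed
      then show "?g z = 0" by (simp add: z)
    qed
  qed auto
  also have "\<dots> = (\<Sum>m\<in>two_strips. of_int (d_shape (skew_shape l m)) * alternant N (betas N m) x)"
  proof (rule sum_bij_rel[symmetric, where R = R])
    fix m assume m: "m \<in> two_strips"
    then have g: "m \<in> growths N r l" and bbs: "broken_border_strip (skew_shape l m)" by (simp_all add: two_strips_def)
    from m obtain u v where "tops l m = {u, v}" "u \<noteq> v" by (auto simp: two_strips_def card_2_iff)
    then obtain t1 t2 where t: "tops l m = {t1, t2}" "t1 < t2"
      by (metis insert_commute linorder_neqE_nat)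
    have fin: "finite (nonempty_rows l m)" using growths_rows[OF g] finite_subset by blast
    have "antimono m" "\<And>i. l i \<le> m i" using g by (auto simp: growths_def)
    from strips_of_two_tops[OF this fin growths_bound[OF g bbs] t]
    obtain n i j where s: "strip l n t2 j" "strip n m t1 i" "i < t2" "j \<in> nonempty_rows l m" by metis
    have j: "j < N" using s(4) growths_rows[OF g] by auto
    have t2: "t2 \<le> j" using s(1) by (simp add: strip_def)
    have i: "i < N" using s(3) t2 j by simp
    have n: "antimono n" by (rule strip_antimono[OF l s(1)])
    have ni: "betas N n i' = ?e i'" if "i' < t2" for i'
      using s(1) that by (simp add: strip_def betas_def)
    have lt1: "?e j < betas N n t2" by (rule strip_betas_below[OF l s(1) j t2 j])
    have lt2: "?e i < betas N m t1"
      using strip_betas_below[OF n s(2) i _ i] s(2) ni[OF s(3)] by (simp add: strip_def)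
    have sum: "(betas N n t2 - ?e j) + (betas N m t1 - ?e i) = r"
      using strip_sum[OF l s(1) j] strip_sum[OF n s(2) i] ni[OF s(3)] g lt1 lt2 by (simp add: growths_def)
    define a where "a = betas N m t1 - ?e i"
    have a: "a \<in> {1..<r}" "betas N m t1 = ?e i + a" "betas N n t2 = ?e j + (r - a)"
      using sum lt1 lt2 by (auto simp: a_def)
    have "?e j + (r - a) < ?e i"
      using strip_betas_above[OF l s(1) j s(3)] a(3) by simp
    moreover have "?e i' \<noteq> ?e j + (r - a)" if "i' < N" for i'
      using strip_betas_new[OF l s(1) j that] a(3) by simp
    moreover have "?e i' \<noteq> ?e i + a" if "i' < N" for i'
    proof (cases "i' < t2")
      case True
      then show ?thesis using strip_betas_new[OF n s(2) i that] a(2) ni by simp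
    next
      case False
      then have "?e i' \<le> ?e i" using s(3) that by (intro betas_le l) auto
      then show ?thesis using a(1) by simp
    qed
    ultimately have "(j, i, a) \<in> ?J" using a(1) j s(3) t2 by auto
    moreover have "R m (j, i, a)" unfolding R_def using j a s by auto
    ultimately show "\<exists>z\<in>?J. R m z" by blast
  next
    fix z assume "z \<in> ?J"
    then obtain j i a where z: "z = (j, i, a)" and j: "j < N" "i < j" and a: "a \<in> {1..<r}" "?e j + (r - a) < ?e i"
      and new: "\<And>i'. i' < N \<Longrightarrow> ?e i' \<noteq> ?e j + (r - a)" "\<And>i'. i' < N \<Longrightarrow> ?e i' \<noteq> ?e i + a" by auto
    have i: "i < N" using j by simp
    obtain n t2 where n: "strip l n t2 j" "betas N n t2 = ?e j + (r - a)"
      using strip_exists[OF l j(1), of "?e j + (r - a)"] new a by auto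
    have an: "antimono n" by (rule strip_antimono[OF l n(1)])
    have it: "i < t2" using strip_betas_below[OF l n(1) j(1), of i] i a(2) n(2) by (metis less_asym' not_less)
    have ni: "betas N n i = ?e i" using n(1) it by (simp add: strip_def betas_def)
    \<comment> \<open>The value for the upper strip has to be new relative to \<open>n\<close>. The
      beta-numbers of \<open>n\<close> are beta-numbers of \<open>l\<close>, except for the one
      inserted at \<open>t2\<close>, which is smaller than \<open>?e i\<close>.\<close>
    have "betas N n i' \<noteq> ?e i + a" if "i' < N" for i'
    proof (rule strip_row_cases[OF l n(1), of i'])
      assume "i' = t2"
      then show ?thesis using n(2) a(2) by simp
    next
      fix i'' assume "i' = Suc i''" "n i' = Suc (l i'')"
      then have "betas N n i' = ?e i''" using that by (simp add: betas_def delta_Suc)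
      then show ?thesis using new(2)[of i''] that \<open>i' = Suc i''\<close> by simp
    qed (use new(2)[OF that] in \<open>auto simp: betas_def\<close>)
    then obtain m t1 where m: "strip n m t1 i" "betas N m t1 = ?e i + a"
      using strip_exists[OF an i, of "?e i + a"] ni a(1) by auto
    have R: "R m (j, i, a)" unfolding R_def using j a n m it by auto
    have "m \<in> growths N r l"
      unfolding growths_def
    proof (intro CollectI conjI allI impI)
      show "antimono m" by (rule strip_antimono[OF an m(1)])
      show "l i \<le> m i" for i using strip_ge[OF l n(1), of i] strip_ge[OF an m(1), of i] by simp
      show "m i' = 0" if "N \<le> i'" for i'
        using n(1) m(1) l0[OF that] that i j(1) by (simp add: strip_def)
      show "(\<Sum>i<N. m i) = (\<Sum>i<N. l i) + r"
        using strip_sum[OF l n(1) j(1)] strip_sum[OF an m(1) i] n(2) m(2) ni a(1) by simp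
    qed
    moreover have "t1 < t2" using m(1) it by (simp add: strip_def)
    ultimately have "m \<in> two_strips"
      using double_strip_broken[OF l n(1) m(1) it] double_strip_tops[OF l n(1) m(1) it]
      by (simp add: two_strips_def)
    then show "\<exists>m\<in>two_strips. R m z" using R z by blast
  next
    fix m z z' assume R: "R m z" "R m z'"
    obtain j i a j' i' a' where z: "z = (j, i, a)" "z' = (j', i', a')" by (metis prod_cases3)
    from R obtain n t1 t2 n' t1' t2' where s: "strip l n t2 j" "strip n m t1 i" "i < t2" "betas N m t1 = ?e i + a"
      and s': "strip l n' t2' j'" "strip n' m t1' i'" "i' < t2'" "betas N m t1' = ?e i' + a'"
      unfolding R_def z by auto
    have le: "t1 \<le> i" "t2 \<le> j" "t1' \<le> i'" "t2' \<le> j'" using s s' by (auto simp: strip_def)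
    \<comment> \<open>The shape alone determines the triple: its tops are the top rows of the
      strips, its nonempty rows then give the bottom rows, and the new beta-number at
      \<open>t1\<close> gives \<open>a\<close>.\<close>
    have "{t1, t2} = {t1', t2'}"
      using double_strip_tops[OF l s(1-3)] double_strip_tops[OF l s'(1-3)] by simp
    then have t: "t1 = t1'" "t2 = t2'" using le s(3) s'(3) by (auto simp: doubleton_eq_iff)
    have rows: "{t1..i} \<union> {t2..j} = {t1..i'} \<union> {t2..j'}"
      using double_strip_rows[OF l s(1-3)] double_strip_rows[OF l s'(1-3)] t by simp
    have "j \<in> {t1..i} \<union> {t2..j}" "i \<in> {t1..i} \<union> {t2..j}" using le by auto
    then have 1: "j \<in> {t1..i'} \<union> {t2..j'}" "i \<in> {t1..i'} \<union> {t2..j'}" by (simp_all only: rows)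
    have "j' \<in> {t1..i'} \<union> {t2..j'}" "i' \<in> {t1..i'} \<union> {t2..j'}" using le t by auto
    then have 2: "j' \<in> {t1..i} \<union> {t2..j}" "i' \<in> {t1..i} \<union> {t2..j}" by (simp_all only: rows)
    have "j = j'" using 1(1) 2(1) le s(3) s'(3) t by auto
    moreover have "i = i'" using 1(2) 2(2) s(3) s'(3) t by auto
    ultimately show "z = z'" using s(4) s'(4) z t by simp
  next
    fix m m' z assume R: "R m z" "R m' z"
    obtain j i a where z: "z = (j, i, a)" by (metis prod_cases3)
    from R obtain n t1 t2 n' t1' t2' where j: "j < N" and s: "strip l n t2 j" "strip n m t1 i" "i < t2"
        "betas N n t2 = ?e j + (r - a)" "betas N m t1 = ?e i + a"
      and s': "strip l n' t2' j" "strip n' m' t1' i" "betas N n' t2' = ?e j + (r - a)" "betas N m' t1' = ?e i + a"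
      unfolding R_def z by auto
    have n: "n = n'" by (rule strip_unique[OF l s(1) s'(1) j]) (simp add: s s')
    have "i < N" using s(1,3) j by (simp add: strip_def)
    then show "m = m'"
      using s' by (intro strip_unique[OF strip_antimono[OF l s(1)] s(2), of m' t1' N]) (simp_all add: n s)
  next
    fix m z assume R: "R m z"
    obtain j i a where z: "z = (j, i, a)" by (metis prod_cases3)
    from R obtain n t1 t2 where j: "j < N" and s: "strip l n t2 j" "strip n m t1 i" "i < t2"
        "betas N n t2 = ?e j + (r - a)" "betas N m t1 = ?e i + a"
      unfolding R_def z by auto
    have t2: "t2 \<le> j" using s(1) by (simp add: strip_def)
    have i: "i < N" using s(3) t2 j by simp
    have an: "antimono n" by (rule strip_antimono[OF l s(1)])
    \<comment> \<open>The upper strip is undone before the lower one. Row \<open>i\<close> lies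
      above \<open>t2\<close>, so raising its exponent does not interfere with the shift by
      \<open>insert_at\<close>.\<close>
    have "alternant N (betas N m) x = (- 1) ^ (i - t1) * alternant N ((betas N n)(i := ?e i + a)) x"
      unfolding alternant_strip[OF an s(2) i] s(5) ..
    also have "alternant N ((betas N n)(i := ?e i + a)) x = alternant N (insert_at t2 j (?e j + (r - a)) (?e(i := ?e i + a))) x"
    proof (rule alternant_cong)
      fix i' assume "i' < N"
      then show "((betas N n)(i := ?e i + a)) i' = insert_at t2 j (?e j + (r - a)) (?e(i := ?e i + a)) i'"
        using strip_betas[OF l s(1) j, of i'] s(3) by (auto simp: s(4) insert_at_def)
    qed
    also have "\<dots> = (- 1) ^ (j - t2) * alternant N (?e(i := ?e i + a, j := ?e j + (r - a))) x"
      by (rule alternant_insert_at[OF t2 j])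
    finally have "alternant N (betas N m) x = (- 1) ^ ((i - t1) + (j - t2)) * alternant N (?e(i := ?e i + a, j := ?e j + (r - a))) x"
      by (simp add: power_add)
    moreover have "(- 1) ^ c * ((- 1) ^ c * y) = y" for c :: nat and y :: rat
      by (simp flip: mult.assoc power_mult_distrib)
    ultimately show "of_int (d_shape (skew_shape l m)) * alternant N (betas N m) x = ?g z"
      by (simp add: z d_shape_double_strip[OF l s(1-3)])
  qed
  finally show ?thesis by simp
qed

lemma reduced_deriv_growths:
  "reduced_deriv N r (betas N l) x = (\<Sum>m\<in>growths N r l. of_int (d_shape (skew_shape l m)) * alternant N (betas N m) x)"
  using reduced_deriv_decreasing[of N "betas N l" r x] betas_less[OF l]
  by (simp only: sum_growths sum_one_strip sum_two_strips)

end

section \<open>From row-length functions back to partitions\<close>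

lemma partition_of_antimono:
  assumes "antimono m" "m N = 0"
  obtains mu where "is_partition mu" "part mu = m"
proof -
  define n where "n = (LEAST n. m n = 0)"
  have n: "m n = 0" unfolding n_def by (rule LeastI) (rule assms)
  have pos: "m i \<noteq> 0" if "i < n" for i using not_less_Least that unfolding n_def by blast
  define mu where "mu = map m [0..<n]"
  have "0 \<notin> set mu"
  proof
    assume "0 \<in> set mu"
    then obtain i where "i < n" "m i = 0" by (auto simp: mu_def)
    with pos show False by blast
  qed
  moreover have "sorted_wrt (\<ge>) mu"
    using antimonoD[OF assms(1)] by (simp add: mu_def sorted_wrt_iff_nth_less)
  ultimately have "is_partition mu" by (simp add: is_partition_def)
  moreover have "part mu = m"
  proof
    fix i
    show "part mu i = m i" using antimonoD[OF assms(1), of n i] n by (auto simp: part_def mu_def)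
  qed
  ultimately show ?thesis by (rule that)
qed

lemma psize_eq_sum_part:
  assumes "\<And>i. i \<ge> N \<Longrightarrow> part lam i = 0"
  shows "psize lam = (\<Sum>i<N. part lam i)"
  using card_shape[of N "part lam", OF assms] by (simp add: card_diagram flip: diagram_eq_shape)

text \<open>\<open>part\<close> is a bijection from \<open>extensions lam r\<close> onto
  \<open>growths N r (part lam)\<close>; the bound on \<open>N\<close> guarantees that no extension
  has more than \<open>N\<close> rows.\<close>

lemma reduced_deriv_partition:
  assumes r: "r \<ge> 1" and lam: "is_partition lam" and N: "N \<ge> psize lam + r"
  shows "reduced_deriv N r (\<lambda>i. part lam i + delta N i) x =
    (\<Sum>mu\<in>extensions lam r. of_int (d_coeff lam mu) * alternant N (\<lambda>i. part mu i + delta N i) x)"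
proof -
  have betas: "(\<lambda>i. m i + delta N i) = betas N m" for m by (simp add: betas_def[abs_def])
  have l0: "part lam i = 0" if "i \<ge> N" for i using that N by (intro part_eq_0[OF lam]) simp
  have sub: "(diagram lam \<subseteq> diagram mu) = (\<forall>i. part lam i \<le> part mu i)" for mu
  proof
    assume s: "diagram lam \<subseteq> diagram mu"
    show "\<forall>i. part lam i \<le> part mu i"
    proof (rule allI, rule ccontr)
      fix i assume "\<not> part lam i \<le> part mu i"
      then have "(i, part mu i) \<in> diagram lam" "(i, part mu i) \<notin> diagram mu"
        by (simp_all add: diagram_eq_shape shape_def)
      with s show False by blast
    qed
  qed (auto simp: diagram_eq_shape shape_def intro: less_le_trans)
  have ext: "part mu \<in> growths N r (part lam)" if "mu \<in> extensions lam r" for mu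
  proof -
    have mu: "is_partition mu" "psize mu = psize lam + r" "diagram lam \<subseteq> diagram mu" using that by (auto simp: extensions_def)
    have m0: "part mu i = 0" if "i \<ge> N" for i using that N mu by (intro part_eq_0) auto
    show ?thesis
      using mu sub m0 psize_eq_sum_part[OF l0] psize_eq_sum_part[OF m0]
      by (simp add: growths_def antimono_part)
  qed
  have "reduced_deriv N r (betas N (part lam)) x =
      (\<Sum>m\<in>growths N r (part lam). of_int (d_shape (skew_shape (part lam) m)) * alternant N (betas N m) x)"
    by (rule reduced_deriv_growths[OF antimono_part[OF lam] l0 r])
  also have "\<dots> = (\<Sum>mu\<in>extensions lam r. of_int (d_coeff lam mu) * alternant N (betas N (part mu)) x)"
  proof (rule sum_bij_rel[symmetric, where R = "\<lambda>mu m. is_partition mu \<and> part mu = m"])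
    fix mu assume "mu \<in> extensions lam r"
    then show "\<exists>m\<in>growths N r (part lam). is_partition mu \<and> part mu = m"
      using ext by (auto simp: extensions_def)
  next
    fix m assume m: "m \<in> growths N r (part lam)"
    then have "antimono m" "m N = 0" by (auto simp: growths_def)
    then obtain mu where mu: "is_partition mu" "part mu = m" by (rule partition_of_antimono)
    have m0: "part mu i = 0" if "i \<ge> N" for i using m that by (simp add: mu(2) growths_def)
    have "mu \<in> extensions lam r"
      using m mu sub[of mu] psize_eq_sum_part[OF l0] psize_eq_sum_part[OF m0]
      by (simp add: extensions_def growths_def)
    then show "\<exists>mu\<in>extensions lam r. is_partition mu \<and> part mu = m" using mu by blast
  next
    fix mu mu' m assume "is_partition mu \<and> part mu = m" "is_partition mu' \<and> part mu' = m"
    then show "mu = mu'" by (intro diagram_inject) (auto simp: diagram_eq_shape)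
  qed (auto simp: d_coeff_eq_d_shape)
  finally show ?thesis by (simp only: betas)
qed

theorem corollary6:
  fixes k n :: nat and lam :: "nat list"
  assumes "k \<ge> 1" and "is_partition lam"
  shows "apply_op (D_rect k n) (schur lam) =
    (\<lambda>\<alpha>. \<Sum>mu | is_partition mu \<and> diagram lam \<subseteq> diagram mu \<and> psize mu = psize lam + k * n.
        a_coeff k lam mu * schur mu \<alpha>)"
proof
  fix \<alpha>
  have "subst_coeff r 1 (schur nu) \<gamma> = (\<Sum>mu\<in>extensions nu r. of_int (d_coeff nu mu) * schur mu \<gamma>)"
    if "r \<ge> 1" "is_partition nu" for r nu \<gamma>
    using that by (intro subst_coeff_1_schur reduced_deriv_partition)
  from subst_coeff_schur[OF this assms]
  show "apply_op (D_rect k n) (schur lam) \<alpha> =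
    (\<Sum>mu | is_partition mu \<and> diagram lam \<subseteq> diagram mu \<and> psize mu = psize lam + k * n. a_coeff k lam mu * schur mu \<alpha>)"
    by (simp add: apply_op_D_rect[OF assms(1)] extensions_def)
qed

end
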